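(* There is an absolute constant $C > 0$ such that for every prime $p$ and every generalized arithmetic progression $A \subset \mathbb{F}_p$ of rank $2$ (not necessarily proper), $$E_{\times}(A) \leq C \Big(|A|^2 + \frac{|A|^4}{p}\Big) \log p.$$
   Context: A generalized arithmetic progression (GAP) of rank $2$ in $\mathbb{F}_p$ is a set $A \subset \mathbb{F}_p$ of the form $$A = \{a_0 + a_1x_1 + a_2x_2 : x_1,x_2 \in \mathbb{Z},\ 1 \leq x_1 \leq H_1,\ 1 \le x_2 \le H_2\}$$ for positive integers $H_1,H_2$ and elements $a_0,a_1,a_2 \in \mathbb{F}_p$ with $a_1,a_2 \neq 0$. The multiplicative energy of $A \subset \mathbb{F}_p$ is $$E_\times(A) := |\{(a_1,a_2,a_3,a_4) \in A^4 : a_1a_2 = a_3a_4 \}|.$$ *)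

theory Defs
  imports "HOL-Number_Theory.Residues"
begin

text \<open>The field with \<open>p\<close> elements is \<^const>\<open>residue_ring\<close> at \<open>p\<close>, whose carrier is \<open>{0..p - 1}\<close>.
  It depends on \<open>p\<close> as a value, which lets the constant in the energy bound be
  chosen before the prime.\<close>

text \<open>\<open>[x] \<cdot> a\<close> is the \<open>x\<close>-fold sum of \<open>a\<close> in the additive group of \<open>R\<close>. The
  parametrization by \<open>(x1, x2)\<close> is not required to be injective, so progressions need not be
  proper.\<close>

definition is_gap2 :: "('a, 'm) ring_scheme \<Rightarrow> 'a set \<Rightarrow> bool" where
  "is_gap2 R A \<longleftrightarrow>
     (\<exists>(H1::int) (H2::int) a0 a1 a2.
        H1 > 0 \<and> H2 > 0 \<and>
        a0 \<in> carrier R \<and> a1 \<in> carrier R \<and> a2 \<in> carrier R \<and>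
        a1 \<noteq> \<zero>\<^bsub>R\<^esub> \<and> a2 \<noteq> \<zero>\<^bsub>R\<^esub> \<and>
        A = {a0 \<oplus>\<^bsub>R\<^esub> [x1] \<cdot>\<^bsub>R\<^esub> a1 \<oplus>\<^bsub>R\<^esub> [x2] \<cdot>\<^bsub>R\<^esub> a2 | (x1::int) (x2::int).
               1 \<le> x1 \<and> x1 \<le> H1 \<and> 1 \<le> x2 \<and> x2 \<le> H2})"

definition mult_energy :: "('a, 'm) ring_scheme \<Rightarrow> 'a set \<Rightarrow> nat" where
  "mult_energy R A =
     card {(a1, a2, a3, a4). a1 \<in> A \<and> a2 \<in> A \<and> a3 \<in> A \<and> a4 \<in> A \<and>
       a1 \<otimes>\<^bsub>R\<^esub> a2 = a3 \<otimes>\<^bsub>R\<^esub> a4}"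

end

theory Submission
  imports Defs "HOL-Analysis.Finite_Cartesian_Product" "HOL-Analysis.Harmonic_Numbers"
begin

text \<open>
  Let \<open>\<phi> x = a1 x1 + a2 x2\<close>. Up to terms with a zero factor, the energy is the sum over
  \<open>l \<noteq> 0\<close> of the squares of \<open>r l\<close>, the number of \<open>(a, c) \<in> A \<times> A\<close> with \<open>a = l c\<close>. Taking
  differences, \<open>r l\<close> is at most the number \<open>n\<close> of points of the lattice
  \<open>M l = {(x, y). \<phi> x = l \<phi> y}\<close> of index \<open>p\<close> in \<open>\<int>\<^sup>4\<close> in a box of side lengths about
  \<open>H1, H2, H1, H2\<close>. Write \<open>N = H1 H2\<close>. Once \<open>R\<close> exceeds a constant multiple of \<open>N\<^sup>2/p\<close>, at most
  \<open>O(N\<^sup>2/R\<^sup>2)\<close> ratios \<open>l\<close> have \<open>n \<ge> R\<close>; summing over \<open>R\<close> gives the logarithm. The proof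
  distinguishes the rank of the points in the box. In rank 4 a determinant is a nonzero multiple
  of \<open>p\<close> of size \<open>O(N\<^sup>2/n)\<close>, so \<open>n = O(N\<^sup>2/p)\<close>. In rank 3 a cross product is a short vector that
  is congruent to a multiple of \<open>(a1, a2, -l a1, -l a2)\<close>. In rank 1 or 2 the lattice itself has
  a short vector. The short vector determines \<open>l\<close>, so it remains to count short vectors. An
  improper progression is contained in a progression of rank 1 of comparable size, which in turn
  lies in a proper one, unless it contains a positive proportion of the field.
\<close>

section \<open>Small minors in integer boxes\<close>

text \<open>The obstacle is the uneven box. Shrinking the sides \<open>H1, H2, H1, H2\<close> by a
  factor \<open>s < 1\<close> leaves \<open>O(s^4 N^2)\<close> points only while \<open>s H1\<close>
  is bounded below, and \<open>H1\<close> may be \<open>1\<close>. Planes of lattice points are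
  therefore split by \<open>n\<close>. Up to \<open>9 H1^2\<close>, all four sides can be shrunk by
  about \<open>1 / sqrt n\<close>. Beyond that, a pigeonhole on the two short coordinates gives a
  lattice vector on which both vanish, and only two long coordinates remain to be counted. Either
  way \<open>O(N^2 / R^2)\<close> vectors are left, which is what makes the sum over
  \<open>R\<close> harmonic. In rank 3 the short vector may leave the range where the progression is
  proper. There \<open>l\<close> is recovered from a pair of vectors of the planar lattice
  \<open>L\<close> that is nonzero modulo \<open>p\<close>. The minor bounds replace Minkowski's
  second theorem by pigeonholes. Step \<open>k\<close> multiplies the constant by \<open>8\<close>
  (close pair), by the \<open>k\<close> terms of the expansion and by the size of the box:
  \<open>64 = 8 * 8\<close>, \<open>4096 = 64 * 8 * 2 * 4\<close>,
  \<open>196608 = 4096 * 8 * 3 * 2\<close>, \<open>6291456 = 196608 * 8 * 4 * 1\<close>.\<close>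

lemma close_pair:
  fixes V :: "real set"
  assumes fin: "finite V" and two: "card V \<ge> 2" and bd: "\<And>v. v \<in> V \<Longrightarrow> \<bar>v\<bar> \<le> Y"
  shows "\<exists>a\<in>V. \<exists>b\<in>V. a \<noteq> b \<and> \<bar>a - b\<bar> \<le> 8 * Y / card V"
proof -
  obtain a b where ab: "a \<in> V" "b \<in> V" "a \<noteq> b"
    using two by (metis card_2_iff' card_le_Suc0_iff_eq fin not_less_eq_eq numeral_2_eq_2)
  have Y: "Y > 0" using bd[OF ab(1)] bd[OF ab(2)] ab(3) by linarith
  define n where "n = card V"
  \<comment> \<open>Cells of length \<open>8 * Y / n\<close>: only \<open>n div 4 + 1\<close> of
    them are needed, which is less than \<open>n\<close> already for \<open>n = 2\<close>.\<close>
  define f where "f v = \<lfloor>(v + Y) * n / (8 * Y)\<rfloor>" for v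
  have n: "real n \<ge> 2" using two n_def by simp
  have "f v \<in> {0..int n div 4}" if "v \<in> V" for v
  proof -
    have v: "0 \<le> v + Y" "v + Y \<le> 2 * Y" using bd[OF that] by auto
    have "(v + Y) * n / (8 * Y) \<le> 2 * Y * n / (8 * Y)"
      using v Y by (intro divide_right_mono mult_right_mono) auto
    also have "\<dots> = real n / 4" using Y by simp
    finally have "f v \<le> \<lfloor>real n / 4\<rfloor>" unfolding f_def by (rule floor_mono)
    moreover have "\<lfloor>real n / 4\<rfloor> = int n div 4" using floor_divide_of_int_eq[of "int n" 4] by simp
    moreover have "0 \<le> f v" unfolding f_def using v Y by simp
    ultimately show ?thesis by simp
  qed
  hence "f ` V \<subseteq> {0..int n div 4}" by blast
  hence "card (f ` V) \<le> card {0..int n div 4}" by (intro card_mono) auto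
  also have "\<dots> < n" using two n_def by simp
  finally have "\<not> inj_on f V" unfolding n_def by (rule pigeonhole)
  then obtain a b where ab: "a \<in> V" "b \<in> V" "a \<noteq> b" "f a = f b"
    unfolding inj_on_def by blast
  have "\<bar>(a + Y) * n / (8 * Y) - (b + Y) * n / (8 * Y)\<bar> < 1"
    using ab(4) unfolding f_def by linarith
  also have "(a + Y) * n / (8 * Y) - (b + Y) * n / (8 * Y) = (a - b) * (n / (8 * Y))"
    by (simp add: field_simps add_divide_distrib diff_divide_distrib)
  finally have "\<bar>a - b\<bar> * (n / (8 * Y)) < 1" using Y n by (simp add: abs_mult)
  hence "\<bar>a - b\<bar> \<le> 8 * Y / n" using Y n by (simp add: field_simps)
  thus ?thesis using ab n_def by blast
qed

text \<open>The pigeonhole shared by all dimensions. Minors at different index sets are multiples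
  \<open>c x * q j\<close> of one scalar, so a single close pair of values of \<open>c\<close>
  serves every \<open>j\<close>. With at most \<open>F\<close> points per value, \<open>c\<close>
  takes at least \<open>card T / F\<close> values.\<close>

lemma close_pair_fibres:
  fixes c :: "'a \<Rightarrow> real" and q X :: "'j \<Rightarrow> real"
  assumes fin: "finite T"
    and bd: "\<And>x j. x \<in> T \<Longrightarrow> \<bar>c x * q j\<bar> \<le> X j"
    and fib: "\<And>x. x \<in> T \<Longrightarrow> card {y \<in> T. c y = c x} \<le> F"
    and x0: "x0 \<in> T" "y0 \<in> T" "c x0 \<noteq> c y0"
  shows "\<exists>x\<in>T. \<exists>y\<in>T. c x \<noteq> c y \<and> (\<forall>j. \<bar>(c x - c y) * q j\<bar> \<le> 8 * X j * F / card T)"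
proof -
  define V where "V = c ` T"
  have finV: "finite V" using fin V_def by simp
  have two: "card V \<ge> 2"
  proof -
    have "card {c x0, c y0} \<le> card V" unfolding V_def using x0 fin by (intro card_mono) auto
    thus ?thesis using x0 by simp
  qed
  have ne: "(\<lambda>x. \<bar>c x\<bar>) ` T \<noteq> {}" using x0 by auto
  \<comment> \<open>The range of \<open>c\<close> is measured by its own largest absolute value;
    times \<open>q j\<close> this is below \<open>X j\<close> for all \<open>j\<close> at
    once.\<close>
  obtain z where z: "z \<in> T" "\<And>x. x \<in> T \<Longrightarrow> \<bar>c x\<bar> \<le> \<bar>c z\<bar>"
    using Max_in[OF finite_imageI[OF fin] ne] Max_ge[OF finite_imageI[OF fin], of _ "\<lambda>x. \<bar>c x\<bar>"]
    by (smt (verit) imageE imageI)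
  from close_pair[OF finV two, of "\<bar>c z\<bar>"] z V_def
  obtain x y where xy: "x \<in> T" "y \<in> T" "c x \<noteq> c y" "\<bar>c x - c y\<bar> \<le> 8 * \<bar>c z\<bar> / card V"
    by auto
  have "T = (\<Union>v\<in>V. {y \<in> T. c y = v})" unfolding V_def by auto
  hence "card T \<le> (\<Sum>v\<in>V. card {y \<in> T. c y = v})"
    using card_UN_le[OF finV] by metis
  also have "\<dots> \<le> (\<Sum>v\<in>V. F)" unfolding V_def by (intro sum_mono) (auto intro: fib)
  finally have TF: "card T \<le> F * card V" by (simp add: mult.commute)
  have cT: "card T > 0" using x0 fin card_gt_0_iff by blast
  have cV: "card V > 0" using two by simp
  have inv: "1 / real (card V) \<le> F / card T"
  proof -
    have "real (card T) \<le> F * card V" using TF by (metis of_nat_le_iff of_nat_mult)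
    thus ?thesis using cT cV by (simp add: field_simps)
  qed
  have "\<bar>(c x - c y) * q j\<bar> \<le> 8 * X j * F / card T" for j
  proof -
    have "\<bar>(c x - c y) * q j\<bar> \<le> 8 * \<bar>c z\<bar> / card V * \<bar>q j\<bar>"
      unfolding abs_mult using xy by (intro mult_right_mono) auto
    also have "\<dots> = 8 * \<bar>c z * q j\<bar> * (1 / card V)" by (simp add: abs_mult)
    also have "\<dots> \<le> 8 * X j * (F / card T)"
      using bd[OF z(1), of j] inv by (intro mult_mono) auto
    finally show ?thesis by simp
  qed
  thus ?thesis using xy by blast
qed

section \<open>Lattice points in boxes, minors and slices\<close>

definition lbox :: "('n \<Rightarrow> real) \<Rightarrow> real \<Rightarrow> (int ^ 'n::finite) set" where
  "lbox h t = {x. \<forall>i. \<bar>real_of_int (x $ i)\<bar> \<le> t * h i}"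

lemma lboxD: "x \<in> lbox h t \<Longrightarrow> \<bar>real_of_int (x $ i)\<bar> \<le> t * h i"
  by (simp add: lbox_def)

lemma lbox_mono: "s \<le> t \<Longrightarrow> (\<And>i. h i \<ge> 0) \<Longrightarrow> x \<in> lbox h s \<Longrightarrow> x \<in> lbox h t"
proof -
  assume a: "s \<le> t" "\<And>i. h i \<ge> 0" "x \<in> lbox h s"
  have "\<bar>real_of_int (x $ i)\<bar> \<le> t * h i" for i
    using lboxD[OF a(3), of i] mult_right_mono[OF a(1) a(2)[of i]] by linarith
  thus ?thesis unfolding lbox_def by blast
qed

lemma lbox_diff: "x \<in> lbox h s \<Longrightarrow> y \<in> lbox h t \<Longrightarrow> x - y \<in> lbox h (s + t)"
proof -
  assume a: "x \<in> lbox h s" "y \<in> lbox h t"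
  have "\<bar>real_of_int ((x - y) $ i)\<bar> \<le> (s + t) * h i" for i
    using lboxD[OF a(1), of i] lboxD[OF a(2), of i]
    abs_triangle_ineq4[of "real_of_int (x $ i)" "real_of_int (y $ i)"]
    unfolding distrib_right vector_minus_component of_int_diff by linarith
  thus ?thesis unfolding lbox_def by blast
qed

lemma card_vec_box:
  fixes b :: "'n::finite \<Rightarrow> nat"
  shows "finite {x :: int ^ 'n. \<forall>i. \<bar>x $ i\<bar> \<le> int (b i)}"
    and "card {x :: int ^ 'n. \<forall>i. \<bar>x $ i\<bar> \<le> int (b i)} = (\<Prod>i\<in>UNIV. 2 * b i + 1)"
proof -
  let ?B = "{x :: int ^ 'n. \<forall>i. \<bar>x $ i\<bar> \<le> int (b i)}"
  let ?P = "Pi\<^sub>E UNIV (\<lambda>i. {- int (b i)..int (b i)})"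
  have bij: "bij_betw (($)) ?B ?P"
    by (rule bij_betwI[where g = vec_lambda]) (auto simp: abs_le_iff vec_eq_iff PiE_def Pi_def minus_le_iff)
  have "finite ?P" by (intro finite_PiE) auto
  thus "finite ?B" using bij bij_betw_finite by blast
  have "card ?P = (\<Prod>i\<in>UNIV. 2 * b i + 1)"
    by (subst card_PiE) (auto intro!: prod.cong simp: nat_add_distrib)
  thus "card ?B = (\<Prod>i\<in>UNIV. 2 * b i + 1)" using bij_betw_same_card[OF bij] by simp
qed

lemma lbox_nat: "(\<And>i. t * h i \<ge> 0) \<Longrightarrow> lbox h t = {x. \<forall>i. \<bar>x $ i\<bar> \<le> int (nat \<lfloor>t * h i\<rfloor>)}"
proof -
  assume "\<And>i. t * h i \<ge> 0"
  hence "int (nat \<lfloor>t * h i\<rfloor>) = \<lfloor>t * h i\<rfloor>" for i by simp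
  moreover have "\<bar>real_of_int k\<bar> \<le> r \<longleftrightarrow> \<bar>k\<bar> \<le> \<lfloor>r\<rfloor>" for k r
    by (metis le_floor_iff of_int_abs)
  ultimately show ?thesis unfolding lbox_def by auto
qed

lemma finite_lbox [simp]: "(\<And>i. t * h i \<ge> 0) \<Longrightarrow> finite (lbox h t)"
  using card_vec_box(1)[of "\<lambda>i. nat \<lfloor>t * h i\<rfloor>"] lbox_nat[of t h] by simp

lemma card_lbox:
  assumes "\<And>i. t * h i \<ge> 0"
  shows "real (card (lbox h t)) \<le> (\<Prod>i\<in>UNIV. 2 * (t * h i) + 1)"
proof -
  have "real (card (lbox h t)) = (\<Prod>i\<in>UNIV. real (2 * nat \<lfloor>t * h i\<rfloor> + 1))"
    using lbox_nat[of t h] assms card_vec_box(2)[of "\<lambda>i. nat \<lfloor>t * h i\<rfloor>"] by simp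
  also have "\<dots> \<le> (\<Prod>i\<in>UNIV. 2 * (t * h i) + 1)"
    using assms by (intro prod_mono) auto
  finally show ?thesis .
qed

text \<open>Minors are explicit polynomials over any commutative ring because they are used twice:
  over the reals for size, over the integers for divisibility by \<open>p\<close>.\<close>

definition minor2 :: "('n \<Rightarrow> 'b::comm_ring_1) \<Rightarrow> ('n \<Rightarrow> 'b) \<Rightarrow> 'n \<Rightarrow> 'n \<Rightarrow> 'b" where
  "minor2 u v i j = u i * v j - u j * v i"
definition minor3 :: "('n \<Rightarrow> 'b::comm_ring_1) \<Rightarrow> ('n \<Rightarrow> 'b) \<Rightarrow> ('n \<Rightarrow> 'b) \<Rightarrow> 'n \<Rightarrow> 'n \<Rightarrow> 'n \<Rightarrow> 'b" where
  "minor3 u v w i j k = minor2 u v i j * w k - minor2 u v i k * w j + minor2 u v j k * w i"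
definition minor4 :: "('n \<Rightarrow> 'b::comm_ring_1) \<Rightarrow> ('n \<Rightarrow> 'b) \<Rightarrow> ('n \<Rightarrow> 'b) \<Rightarrow> ('n \<Rightarrow> 'b) \<Rightarrow> 'n \<Rightarrow> 'n \<Rightarrow> 'n \<Rightarrow> 'n \<Rightarrow> 'b" where
  "minor4 u v w x i j k l = minor3 u v w i j k * x l - minor3 u v w i j l * x k + minor3 u v w i k l * x j - minor3 u v w j k l * x i"

definition coord :: "int ^ 'n \<Rightarrow> 'n \<Rightarrow> real" where "coord x i = real_of_int (x $ i)"

lemma coord_diff [simp]: "coord (x - y) i = coord x i - coord y i" by (simp add: coord_def)
lemma coord_zero [simp]: "coord 0 i = 0" by (simp add: coord_def)
lemma coord_eq_iff: "x = y \<longleftrightarrow> (\<forall>i. coord x i = coord y i)" by (simp add: coord_def vec_eq_iff)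

text \<open>Spans are real, not integral: membership comes from Cramer's rule, whose coefficients
  are quotients.\<close>

definition span1 :: "(int ^ 'n) \<Rightarrow> (int ^ 'n) set" where
  "span1 w1 = {x. \<exists>a. \<forall>i. coord x i = a * coord w1 i}"
definition span2 :: "(int ^ 'n) \<Rightarrow> (int ^ 'n) \<Rightarrow> (int ^ 'n) set" where
  "span2 w1 w2 = {x. \<exists>a b. \<forall>i. coord x i = a * coord w1 i + b * coord w2 i}"
definition span3 :: "(int ^ 'n) \<Rightarrow> (int ^ 'n) \<Rightarrow> (int ^ 'n) \<Rightarrow> (int ^ 'n) set" where
  "span3 w1 w2 w3 = {x. \<exists>a b c. \<forall>i. coord x i = a * coord w1 i + b * coord w2 i + c * coord w3 i}"

lemma span1I: "(\<And>i. coord x i = a * coord w1 i) \<Longrightarrow> x \<in> span1 w1"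
  unfolding span1_def by (intro CollectI exI[of _ a] allI)
lemma span2I: "(\<And>i. coord x i = a * coord w1 i + b * coord w2 i) \<Longrightarrow> x \<in> span2 w1 w2"
  unfolding span2_def by (intro CollectI exI[of _ a] exI[of _ b] allI)
lemma span3I: "(\<And>i. coord x i = a * coord w1 i + b * coord w2 i + c * coord w3 i) \<Longrightarrow> x \<in> span3 w1 w2 w3"
  unfolding span3_def by (intro CollectI exI[of _ a] exI[of _ b] exI[of _ c] allI)

lemma zero_lbox [simp]: "(\<And>i. t * h i \<ge> 0) \<Longrightarrow> 0 \<in> lbox h t"
  by (simp add: lbox_def)

lemma fibre_card_le:
  fixes c :: "'a::ab_group_add \<Rightarrow> real"
  assumes "\<And>y. y \<in> T \<Longrightarrow> c y = c x \<Longrightarrow> y - x \<in> U" "finite U"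
  shows "card {y \<in> T. c y = c x} \<le> card U"
  by (rule card_inj_on_le[where f = "\<lambda>y. y - x"]) (use assms in \<open>auto simp: inj_on_def\<close>)

text \<open>
  Minors are bounded by induction on the dimension \<open>k\<close> of the slice. If the minors of
  \<open>v1, \<dots>, v(k-1)\<close> are small, so is the range of \<open>x \<mapsto> minor (v1, \<dots>, v(k-1), x)\<close> on the lattice points of
  the \<open>k\<close>-dimensional slice, and two points with the same value differ by a point of the
  \<open>(k-1)\<close>-dimensional slice. By \<open>close_pair_fibres\<close>, two points have distinct values that are close,
  and the number of points of the smaller slice cancels from the bound. The boxes double when \<open>k\<close>
  decreases because of these differences.
\<close>

lemma short_vector_on_line:
  fixes M :: "(int ^ 'n::finite) set"
  assumes M: "\<And>x y. x \<in> M \<Longrightarrow> y \<in> M \<Longrightarrow> x - y \<in> M" and h: "\<And>i. h i \<ge> 0"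
    and w1: "w1 \<in> M" "w1 \<in> lbox h 8" "w1 \<noteq> 0"
  shows "\<exists>v g. v \<in> M \<and> v \<in> lbox h 16 \<and> g \<noteq> 0 \<and> (\<forall>i. coord v i = g * coord w1 i) \<and>
           (\<forall>i. \<bar>coord v i\<bar> \<le> 64 * h i / card (M \<inter> lbox h 8 \<inter> span1 w1))"
proof -
  define T where "T = M \<inter> lbox h 8 \<inter> span1 w1"
  obtain i0 where i0: "coord w1 i0 \<noteq> 0" using w1(3) coord_eq_iff by (metis coord_zero)
  have finT: "finite T" using h by (simp add: T_def)
  have "\<forall>x\<in>T. \<exists>a. \<forall>i. coord x i = a * coord w1 i" unfolding T_def span1_def by auto
  then obtain c where c: "\<And>x i. x \<in> T \<Longrightarrow> coord x i = c x * coord w1 i" by metis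
  have w1T: "w1 \<in> T" unfolding T_def span1_def using w1 by (auto intro: exI[of _ 1])
  have zT: "0 \<in> T" unfolding T_def span1_def lbox_def using M[OF w1(1) w1(1)] h
    by (auto intro: exI[of _ 0])
  have "\<exists>x\<in>T. \<exists>y\<in>T. c x \<noteq> c y \<and> (\<forall>j. \<bar>(c x - c y) * coord w1 j\<bar> \<le> 8 * (8 * h j) * real 1 / card T)"
  proof (rule close_pair_fibres[OF finT])
    show "\<bar>c x * coord w1 j\<bar> \<le> 8 * h j" if "x \<in> T" for x j
      using c[OF that, symmetric] that lboxD unfolding T_def coord_def by auto
    \<comment> \<open>On a line the coordinate along \<open>w1\<close> determines the point, so the
      induction starts with \<open>F = 1\<close>.\<close>
    show "card {y \<in> T. c y = c x} \<le> 1" if "x \<in> T" for x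
    proof -
      have "{y \<in> T. c y = c x} \<subseteq> {x}" using c that by (auto simp: coord_eq_iff)
      from card_mono[OF _ this] show ?thesis by simp
    qed
    show "w1 \<in> T" "0 \<in> T" by fact+
    show "c w1 \<noteq> c 0" using c[OF w1T, of i0] c[OF zT, of i0] i0 by auto
  qed
  then obtain x y where xy: "x \<in> T" "y \<in> T" "c x \<noteq> c y"
    "\<And>j. \<bar>(c x - c y) * coord w1 j\<bar> \<le> 64 * h j / card T" by auto
  have e: "coord (x - y) i = (c x - c y) * coord w1 i" for i using c xy by (simp add: algebra_simps)
  have "x - y \<in> lbox h (8 + 8)" using xy unfolding T_def by (intro lbox_diff) auto
  thus ?thesis using xy e M unfolding T_def[symmetric]
    by (intro exI[of _ "x - y"] exI[of _ "c x - c y"]) (auto simp: T_def)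
qed

text \<open>The coefficients \<open>g\<close>, \<open>a\<close>, \<open>b\<close> record that
  \<open>v1, v2\<close> span the same plane as \<open>w1, w2\<close>, so a nonzero minor of the
  latter stays nonzero for the former.\<close>

lemma small_minor2:
  fixes M :: "(int ^ 'n::finite) set"
  assumes M: "\<And>x y. x \<in> M \<Longrightarrow> y \<in> M \<Longrightarrow> x - y \<in> M" and h: "\<And>i. h i \<ge> 0"
    and w: "w1 \<in> M" "w1 \<in> lbox h 8" "w2 \<in> M" "w2 \<in> lbox h 4"
    and nz: "minor2 (coord w1) (coord w2) i0 j0 \<noteq> 0"
  shows "\<exists>v1 v2 g a b. v1 \<in> M \<and> v2 \<in> M \<and> g \<noteq> 0 \<and> b \<noteq> 0 \<and> (\<forall>i. coord v1 i = g * coord w1 i) \<and>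
           (\<forall>i. coord v2 i = a * coord w1 i + b * coord w2 i) \<and>
           (\<forall>i j. \<bar>minor2 (coord v1) (coord v2) i j\<bar> \<le> 4096 * (h i * h j) / card (M \<inter> lbox h 4 \<inter> span2 w1 w2))"
proof -
  define T where "T = M \<inter> lbox h 4 \<inter> span2 w1 w2"
  define U where "U = M \<inter> lbox h 8 \<inter> span1 w1"
  have w1nz: "w1 \<noteq> 0" using nz by (auto simp: minor2_def)
  have "\<exists>v g. v \<in> M \<and> v \<in> lbox h 16 \<and> g \<noteq> 0 \<and> (\<forall>i. coord v i = g * coord w1 i) \<and>
           (\<forall>i. \<bar>coord v i\<bar> \<le> 64 * h i / card U)"
    unfolding U_def by (rule short_vector_on_line[OF M h w(1,2) w1nz])
  then obtain v1 g where v1: "v1 \<in> M" "v1 \<in> lbox h 16" "g \<noteq> 0" "\<And>i. coord v1 i = g * coord w1 i"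
    "\<And>i. \<bar>coord v1 i\<bar> \<le> 64 * h i / card U" by blast
  have finT: "finite T" and finU: "finite U" using h by (simp_all add: T_def U_def)
  have "\<forall>x\<in>T. \<exists>b a. \<forall>i. coord x i = a * coord w1 i + b * coord w2 i" unfolding T_def span2_def by auto
  then obtain c a where c: "\<And>x i. x \<in> T \<Longrightarrow> coord x i = a x * coord w1 i + c x * coord w2 i" by metis
  \<comment> \<open>The \<open>w1\<close> part of \<open>x\<close> drops out of the determinant, so
    every minor is a fixed multiple of the one coefficient \<open>c x\<close>.\<close>
  have D: "minor2 (coord v1) (coord x) i j = c x * (g * minor2 (coord w1) (coord w2) i j)" if "x \<in> T" for x i j
    unfolding minor2_def v1(4) c[OF that] by (simp add: algebra_simps)
  have w2T: "w2 \<in> T" unfolding T_def using w span2I[of w2 0 w1 1 w2] by simp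
  have zT: "0 \<in> T" unfolding T_def using M[OF w(1) w(1)] h span2I[of 0 0 w1 0 w2] by simp
  have U0: "card U > 0"
  proof -
    have "w1 \<in> U" unfolding U_def using w span1I[of w1 1 w1] by simp
    thus ?thesis using finU card_gt_0_iff by blast
  qed
  have "\<exists>x\<in>T. \<exists>y\<in>T. c x \<noteq> c y \<and> (\<forall>j. \<bar>(c x - c y) * (case j of (i,j) \<Rightarrow> g * minor2 (coord w1) (coord w2) i j)\<bar>
     \<le> 8 * (case j of (i,j) \<Rightarrow> 512 * (h i * h j) / card U) * real (card U) / card T)"
  proof (rule close_pair_fibres[OF finT])
    show "\<bar>c x * (case j of (i,j) \<Rightarrow> g * minor2 (coord w1) (coord w2) i j)\<bar> \<le> (case j of (i,j) \<Rightarrow> 512 * (h i * h j) / card U)"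
      if x: "x \<in> T" for x j
    proof -
      have "\<bar>minor2 (coord v1) (coord x) i j\<bar> \<le> 512 * (h i * h j) / card U" for i j
      proof -
        have b: "\<bar>coord x i\<bar> \<le> 4 * h i" for i using x lboxD unfolding T_def coord_def by auto
        have m: "\<bar>coord v1 i * coord x j\<bar> \<le> 256 * (h i * h j / card U)" for i j
        proof -
          have "\<bar>coord v1 i * coord x j\<bar> \<le> (64 * h i / card U) * (4 * h j)"
            unfolding abs_mult using h v1(5) b by (intro mult_mono) auto
          thus ?thesis by simp
        qed
        have "h j * h i / card U = h i * h j / card U" by simp
        thus ?thesis unfolding minor2_def using m[of i j] m[of j i] by linarith
      qed
      thus ?thesis using D[OF x] by (auto split: prod.splits)
    qed
    show "card {y \<in> T. c y = c x} \<le> card U" if x: "x \<in> T" for x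
    proof (rule fibre_card_le[OF _ finU])
      fix y assume y: "y \<in> T" "c y = c x"
      have "y - x \<in> lbox h (4 + 4)" using x y unfolding T_def by (intro lbox_diff) auto
      moreover have "coord (y - x) i = (a y - a x) * coord w1 i" for i
        using c[OF x] c[OF y(1)] y by (simp add: algebra_simps)
      ultimately show "y - x \<in> U" using x y M span1I[of "y - x" "a y - a x" w1] unfolding U_def T_def by simp
    qed
    show "w2 \<in> T" "0 \<in> T" by fact+
    show "c w2 \<noteq> c 0" 
      using D[OF w2T, of i0 j0] D[OF zT, of i0 j0] nz v1(3) unfolding v1(4) minor2_def 
      by (auto simp: algebra_simps)
  qed
  then obtain x y where xy: "x \<in> T" "y \<in> T" "c x \<noteq> c y"
    "\<And>i j. \<bar>(c x - c y) * (g * minor2 (coord w1) (coord w2) i j)\<bar> \<le> 4096 * (h i * h j) / card T"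
    using U0 by auto
  have e: "coord (x - y) i = (a x - a y) * coord w1 i + (c x - c y) * coord w2 i" for i
    using c xy by (simp add: algebra_simps)
  have "minor2 (coord v1) (coord (x - y)) i j = (c x - c y) * (g * minor2 (coord w1) (coord w2) i j)" for i j
    unfolding minor2_def v1(4) e by (simp add: algebra_simps)
  hence "\<bar>minor2 (coord v1) (coord (x - y)) i j\<bar> \<le> 4096 * (h i * h j) / card T" for i j using xy(4) by simp
  moreover have "x - y \<in> M" using xy M T_def by auto
  ultimately show ?thesis using xy(3) e v1(1,3,4) unfolding T_def[symmetric]
    by (intro exI[of _ v1] exI[of _ "x - y"] exI[of _ g] exI[of _ "a x - a y"] exI[of _ "c x - c y"]) simp
qed

lemma span1_if_minors_zero:
  assumes "coord w1 i \<noteq> 0" "\<And>j. minor2 (coord w1) (coord x) i j = 0"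
  shows "x \<in> span1 w1"
proof (rule span1I)
  fix j show "coord x j = (coord x i / coord w1 i) * coord w1 j"
    using assms(1) assms(2)[of j] by (simp add: minor2_def field_simps)
qed

text \<open>Cramer's rule with the rows \<open>i, j\<close> of the nonzero minor as pivot: only the
  minors extending these two rows have to vanish.\<close>

lemma span2_if_minors_zero:
  assumes nz: "minor2 (coord w1) (coord w2) i j \<noteq> 0" and z: "\<And>k. minor3 (coord w1) (coord w2) (coord x) i j k = 0"
  shows "x \<in> span2 w1 w2"
proof (rule span2I)
  fix k
  let ?D = "minor2 (coord w1) (coord w2) i j"
  have "coord x k * ?D = minor2 (coord x) (coord w2) i j * coord w1 k + minor2 (coord w1) (coord x) i j * coord w2 k"
    using z[of k] unfolding minor3_def minor2_def by (simp add: algebra_simps)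
  thus "coord x k = (minor2 (coord x) (coord w2) i j / ?D) * coord w1 k + (minor2 (coord w1) (coord x) i j / ?D) * coord w2 k"
    using nz by (simp add: field_simps)
qed

lemma span3_if_minors_zero:
  assumes nz: "minor3 (coord w1) (coord w2) (coord w3) i j k \<noteq> 0"
    and z: "\<And>l. minor4 (coord w1) (coord w2) (coord w3) (coord x) i j k l = 0"
  shows "x \<in> span3 w1 w2 w3"
proof (rule span3I)
  fix l
  let ?D = "minor3 (coord w1) (coord w2) (coord w3) i j k"
  have "minor4 (coord w1) (coord w2) (coord w3) (coord x) i j k l =
      coord x l * ?D - (minor3 (coord x) (coord w2) (coord w3) i j k * coord w1 l
       + minor3 (coord w1) (coord x) (coord w3) i j k * coord w2 l + minor3 (coord w1) (coord w2) (coord x) i j k * coord w3 l)"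
    unfolding minor4_def minor3_def minor2_def by (simp add: algebra_simps)
  hence "coord x l * ?D = minor3 (coord x) (coord w2) (coord w3) i j k * coord w1 l
       + minor3 (coord w1) (coord x) (coord w3) i j k * coord w2 l + minor3 (coord w1) (coord w2) (coord x) i j k * coord w3 l"
    using z[of l] by simp
  hence "coord x l = (minor3 (coord x) (coord w2) (coord w3) i j k * coord w1 l
       + minor3 (coord w1) (coord x) (coord w3) i j k * coord w2 l + minor3 (coord w1) (coord w2) (coord x) i j k * coord w3 l) / ?D"
    using nz by (simp add: nonzero_eq_divide_eq)
  thus "coord x l = (minor3 (coord x) (coord w2) (coord w3) i j k / ?D) * coord w1 l
      + (minor3 (coord w1) (coord x) (coord w3) i j k / ?D) * coord w2 l
      + (minor3 (coord w1) (coord w2) (coord x) i j k / ?D) * coord w3 l"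
    by (simp add: add_divide_distrib)
qed

lemma card_pos_mem: "finite U \<Longrightarrow> x \<in> U \<Longrightarrow> card U > 0"
  using card_gt_0_iff by blast

text \<open>The change of basis is summarised by one factor \<open>q\<close>, since the next
  dimension and the cross product only need that all minors are scaled alike.\<close>

lemma small_minor3:
  fixes M :: "(int ^ 'n::finite) set"
  assumes M: "\<And>x y. x \<in> M \<Longrightarrow> y \<in> M \<Longrightarrow> x - y \<in> M" and h: "\<And>i. h i \<ge> 0"
    and w: "w1 \<in> M" "w1 \<in> lbox h 8" "w2 \<in> M" "w2 \<in> lbox h 4" "w3 \<in> M" "w3 \<in> lbox h 2"
    and nz: "minor3 (coord w1) (coord w2) (coord w3) i0 j0 k0 \<noteq> 0"
  shows "\<exists>v1 v2 v3 q. v1 \<in> M \<and> v2 \<in> M \<and> v3 \<in> M \<and> q \<noteq> 0 \<and> 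
           (\<forall>i j k. minor3 (coord v1) (coord v2) (coord v3) i j k = q * minor3 (coord w1) (coord w2) (coord w3) i j k) \<and>
           (\<forall>i j k. \<bar>minor3 (coord v1) (coord v2) (coord v3) i j k\<bar>
              \<le> 196608 * (h i * h j * h k) / card (M \<inter> lbox h 2 \<inter> span3 w1 w2 w3))"
proof -
  define T where "T = M \<inter> lbox h 2 \<inter> span3 w1 w2 w3"
  define U where "U = M \<inter> lbox h 4 \<inter> span2 w1 w2"
  obtain i1 j1 where nz2: "minor2 (coord w1) (coord w2) i1 j1 \<noteq> 0"
    using nz unfolding minor3_def by fastforce
  have "\<exists>v1 v2 g a b. v1 \<in> M \<and> v2 \<in> M \<and> g \<noteq> 0 \<and> b \<noteq> 0 \<and> (\<forall>i. coord v1 i = g * coord w1 i) \<and>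
           (\<forall>i. coord v2 i = a * coord w1 i + b * coord w2 i) \<and>
           (\<forall>i j. \<bar>minor2 (coord v1) (coord v2) i j\<bar> \<le> 4096 * (h i * h j) / card U)"
    unfolding U_def by (rule small_minor2[OF M h w(1-4) nz2])
  then obtain v1 v2 g a b where v: "v1 \<in> M" "v2 \<in> M" "g \<noteq> 0" "b \<noteq> 0"
    "\<And>i. coord v1 i = g * coord w1 i" "\<And>i. coord v2 i = a * coord w1 i + b * coord w2 i"
    "\<And>i j. \<bar>minor2 (coord v1) (coord v2) i j\<bar> \<le> 4096 * (h i * h j) / card U" by blast
  define q where "q = g * b"
  have q: "q \<noteq> 0" using v q_def by simp
  have minor2: "minor2 (coord v1) (coord v2) i j = q * minor2 (coord w1) (coord w2) i j" for i j
    unfolding minor2_def v(5,6) q_def by (simp add: algebra_simps)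
  have finT: "finite T" and finU: "finite U" using h by (simp_all add: T_def U_def)
  have "\<forall>x\<in>T. \<exists>c a b. \<forall>i. coord x i = a * coord w1 i + b * coord w2 i + c * coord w3 i"
    unfolding T_def span3_def by auto
  then obtain c a' b' where c: "\<And>x i. x \<in> T \<Longrightarrow> coord x i = a' x * coord w1 i + b' x * coord w2 i + c x * coord w3 i"
    by metis
  have D: "minor3 (coord v1) (coord v2) (coord x) i j k = c x * (q * minor3 (coord w1) (coord w2) (coord w3) i j k)"
    if "x \<in> T" for x i j k
    unfolding minor3_def minor2 c[OF that] unfolding minor2_def by (simp add: algebra_simps)
  have w3T: "w3 \<in> T" unfolding T_def using w span3I[of w3 0 w1 0 w2 1 w3] by simp
  have zT: "0 \<in> T" unfolding T_def using M[OF w(1) w(1)] h span3I[of 0 0 w1 0 w2 0 w3] by simp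
  have U0: "card U > 0"
  proof (rule card_pos_mem[OF finU])
    show "w2 \<in> U" unfolding U_def using w span2I[of w2 0 w1 1 w2] by simp
  qed
  define Q where "Q = (\<lambda>(i,j,k). q * minor3 (coord w1) (coord w2) (coord w3) i j k)"
  define X where "X = (\<lambda>(i,j,k). 24576 * (h i * h j * h k) / card U)"
  have "\<exists>x\<in>T. \<exists>y\<in>T. c x \<noteq> c y \<and> (\<forall>j. \<bar>(c x - c y) * Q j\<bar> \<le> 8 * X j * real (card U) / card T)"
  proof (rule close_pair_fibres[OF finT])
    show "\<bar>c x * Q j\<bar> \<le> X j" if x: "x \<in> T" for x j
    proof -
      obtain i' j' k' where j: "j = (i',j',k')" by (cases j)
      have b: "\<bar>coord x i\<bar> \<le> 2 * h i" for i using x lboxD unfolding T_def coord_def by auto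
      have m: "\<bar>minor2 (coord v1) (coord v2) i j * coord x k\<bar> \<le> 8192 * (h i * h j * h k / card U)" for i j k
      proof -
        have "\<bar>minor2 (coord v1) (coord v2) i j * coord x k\<bar> \<le> (4096 * (h i * h j) / card U) * (2 * h k)"
          unfolding abs_mult using h v(7) b by (intro mult_mono) auto
        thus ?thesis by simp
      qed
      have e: "h i' * h k' * h j' / card U = h i' * h j' * h k' / card U"
        "h j' * h k' * h i' / card U = h i' * h j' * h k' / card U" by simp_all
      have "\<bar>minor3 (coord v1) (coord v2) (coord x) i' j' k'\<bar> \<le> 24576 * (h i' * h j' * h k' / card U)"
        unfolding minor3_def using m[of i' j' k'] m[of i' k' j'] m[of j' k' i'] unfolding e by linarith
      thus ?thesis unfolding D[OF x] j Q_def X_def by simp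
    qed
    show "card {y \<in> T. c y = c x} \<le> card U" if x: "x \<in> T" for x
    proof (rule fibre_card_le[OF _ finU])
      fix y assume y: "y \<in> T" "c y = c x"
      have "y - x \<in> lbox h (2 + 2)" using x y unfolding T_def by (intro lbox_diff) auto
      moreover have "coord (y - x) i = (a' y - a' x) * coord w1 i + (b' y - b' x) * coord w2 i" for i
        using c[OF x] c[OF y(1)] y by (simp add: algebra_simps)
      ultimately show "y - x \<in> U"
        using x y M span2I[of "y - x" "a' y - a' x" w1 "b' y - b' x" w2] unfolding U_def T_def by simp
    qed
    show "w3 \<in> T" "0 \<in> T" by fact+
    have "c w3 * (q * minor3 (coord w1) (coord w2) (coord w3) i0 j0 k0) \<noteq> c 0 * (q * minor3 (coord w1) (coord w2) (coord w3) i0 j0 k0)"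
      using nz q unfolding D[OF w3T, symmetric] D[OF zT, symmetric] 
      by (simp add: minor3_def minor2 right_diff_distrib[symmetric] distrib_left[symmetric] mult.assoc)
    thus "c w3 \<noteq> c 0" by auto
  qed
  then obtain x y where xy: "x \<in> T" "y \<in> T" "c x \<noteq> c y"
    "\<And>j. \<bar>(c x - c y) * Q j\<bar> \<le> 8 * X j * real (card U) / card T" by blast
  have e: "minor3 (coord v1) (coord v2) (coord (x - y)) i j k = ((c x - c y) * q) * minor3 (coord w1) (coord w2) (coord w3) i j k" for i j k
  proof -
    have "minor3 (coord v1) (coord v2) (coord (x - y)) i j k = minor3 (coord v1) (coord v2) (coord x) i j k - minor3 (coord v1) (coord v2) (coord y) i j k"
      unfolding minor3_def by (simp add: algebra_simps)
    thus ?thesis unfolding D[OF xy(1)] D[OF xy(2)] by (simp add: algebra_simps)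
  qed
  have "\<bar>minor3 (coord v1) (coord v2) (coord (x - y)) i j k\<bar> \<le> 196608 * (h i * h j * h k) / card T" for i j k
    using xy(4)[of "(i,j,k)"] U0 unfolding e Q_def X_def by (simp add: mult.assoc)
  moreover have "x - y \<in> M" using xy M T_def by auto
  ultimately show ?thesis using xy(3) e v(1,2) q unfolding T_def[symmetric]
    by (intro exI[of _ v1] exI[of _ v2] exI[of _ "x - y"] exI[of _ "(c x - c y) * q"]) simp
qed

text \<open>\<open>full\<close> ensures that two points with the same determinant differ by a point
  of the three-dimensional slice. In ambient dimension four it follows from Cramer's rule, and one
  choice of rows is the whole determinant.\<close>

lemma small_minor4:
  fixes M :: "(int ^ 'n::finite) set"
  assumes M: "\<And>x y. x \<in> M \<Longrightarrow> y \<in> M \<Longrightarrow> x - y \<in> M" and h: "\<And>i. h i \<ge> 0"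
    and w: "w1 \<in> M" "w1 \<in> lbox h 8" "w2 \<in> M" "w2 \<in> lbox h 4" "w3 \<in> M" "w3 \<in> lbox h 2"
      "w4 \<in> M" "w4 \<in> lbox h 1"
    and nz: "minor4 (coord w1) (coord w2) (coord w3) (coord w4) i j k l \<noteq> 0"
    and full: "\<And>x. minor4 (coord w1) (coord w2) (coord w3) (coord x) i j k l = 0 \<Longrightarrow> x \<in> span3 w1 w2 w3"
  shows "\<exists>v1 v2 v3 v4. v1 \<in> M \<and> v2 \<in> M \<and> v3 \<in> M \<and> v4 \<in> M \<and>
           minor4 (coord v1) (coord v2) (coord v3) (coord v4) i j k l \<noteq> 0 \<and>
           \<bar>minor4 (coord v1) (coord v2) (coord v3) (coord v4) i j k l\<bar>
              \<le> 6291456 * (h i * h j * h k * h l) / card (M \<inter> lbox h 1)"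
proof -
  define T where "T = M \<inter> lbox h 1"
  define U where "U = M \<inter> lbox h 2 \<inter> span3 w1 w2 w3"
  obtain i1 j1 k1 where nz3: "minor3 (coord w1) (coord w2) (coord w3) i1 j1 k1 \<noteq> 0"
    using nz unfolding minor4_def by fastforce
  have "\<exists>v1 v2 v3 q. v1 \<in> M \<and> v2 \<in> M \<and> v3 \<in> M \<and> q \<noteq> 0 \<and> 
           (\<forall>i j k. minor3 (coord v1) (coord v2) (coord v3) i j k = q * minor3 (coord w1) (coord w2) (coord w3) i j k) \<and>
           (\<forall>i j k. \<bar>minor3 (coord v1) (coord v2) (coord v3) i j k\<bar> \<le> 196608 * (h i * h j * h k) / card U)"
    unfolding U_def by (rule small_minor3[OF M h w(1-6) nz3])
  then obtain v1 v2 v3 q where v: "v1 \<in> M" "v2 \<in> M" "v3 \<in> M" "q \<noteq> 0"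
    "\<And>i j k. minor3 (coord v1) (coord v2) (coord v3) i j k = q * minor3 (coord w1) (coord w2) (coord w3) i j k"
    "\<And>i j k. \<bar>minor3 (coord v1) (coord v2) (coord v3) i j k\<bar> \<le> 196608 * (h i * h j * h k) / card U" by blast
  have finT: "finite T" and finU: "finite U" using h by (simp_all add: T_def U_def)
  define c where "c x = minor4 (coord w1) (coord w2) (coord w3) (coord x) i j k l" for x
  have D: "minor4 (coord v1) (coord v2) (coord v3) (coord x) i j k l = c x * q" for x
    unfolding minor4_def v(5) c_def by (simp add: algebra_simps)
  have w4T: "w4 \<in> T" unfolding T_def using w by simp
  have zT: "0 \<in> T" unfolding T_def using M[OF w(1) w(1)] h by simp
  have U0: "card U > 0"
  proof (rule card_pos_mem[OF finU])
    show "w3 \<in> U" unfolding U_def using w span3I[of w3 0 w1 0 w2 1 w3] by simp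
  qed
  define X where "X = 786432 * (h i * h j * h k * h l) / card U"
  \<comment> \<open>Only one determinant is at stake, so the index type of the pigeonhole is
    \<open>unit\<close>.\<close>
  have "\<exists>x\<in>T. \<exists>y\<in>T. c x \<noteq> c y \<and> (\<forall>u::unit. \<bar>(c x - c y) * q\<bar> \<le> 8 * X * real (card U) / card T)"
  proof (rule close_pair_fibres[OF finT])
    show "\<bar>c x * q\<bar> \<le> X" if x: "x \<in> T" for x
    proof -
      have b: "\<bar>coord x i\<bar> \<le> h i" for i using x lboxD[of x h 1] unfolding T_def coord_def by auto
      have m: "\<bar>minor3 (coord v1) (coord v2) (coord v3) i j k * coord x l\<bar> \<le> 196608 * (h i * h j * h k * h l / card U)" for i j k l
      proof -
        have "\<bar>minor3 (coord v1) (coord v2) (coord v3) i j k * coord x l\<bar> \<le> (196608 * (h i * h j * h k) / card U) * h l"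
          unfolding abs_mult using h v(6) b by (intro mult_mono) auto
        thus ?thesis by simp
      qed
      have e: "h i * h j * h l * h k / card U = h i * h j * h k * h l / card U"
        "h i * h k * h l * h j / card U = h i * h j * h k * h l / card U"
        "h j * h k * h l * h i / card U = h i * h j * h k * h l / card U" by simp_all
      have "\<bar>minor4 (coord v1) (coord v2) (coord v3) (coord x) i j k l\<bar> \<le> 786432 * (h i * h j * h k * h l / card U)"
        unfolding minor4_def using m[of i j k l] m[of i j l k] m[of i k l j] m[of j k l i]
        unfolding e by linarith
      thus ?thesis unfolding D X_def by simp
    qed
    show "card {y \<in> T. c y = c x} \<le> card U" if x: "x \<in> T" for x
    proof (rule fibre_card_le[OF _ finU])
      fix y assume y: "y \<in> T" "c y = c x"
      have "y - x \<in> lbox h (1 + 1)" using x y unfolding T_def by (intro lbox_diff) auto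
      moreover have "c (y - x) = c y - c x" unfolding c_def minor4_def by (simp add: algebra_simps)
      ultimately show "y - x \<in> U"
        using x y M full[of "y - x"] unfolding U_def T_def c_def[symmetric] by simp
    qed
    show "w4 \<in> T" "0 \<in> T" by fact+
    have "c 0 = 0" unfolding c_def minor4_def by simp
    thus "c w4 \<noteq> c 0" using nz unfolding c_def by simp
  qed
  then obtain x y where xy: "x \<in> T" "y \<in> T" "c x \<noteq> c y"
    "\<bar>(c x - c y) * q\<bar> \<le> 8 * X * real (card U) / card T" by blast
  have e: "minor4 (coord v1) (coord v2) (coord v3) (coord (x - y)) i j k l = (c x - c y) * q"
    unfolding D unfolding c_def minor4_def by (simp add: algebra_simps)
  have "\<bar>minor4 (coord v1) (coord v2) (coord v3) (coord (x - y)) i j k l\<bar> \<le> 6291456 * (h i * h j * h k * h l) / card T"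
    using xy(4) U0 unfolding e X_def by simp
  moreover have "x - y \<in> M" using xy M T_def by auto
  ultimately show ?thesis using xy(3) e v unfolding T_def[symmetric]
    by (intro exI[of _ v1] exI[of _ v2] exI[of _ v3] exI[of _ "x - y"]) simp
qed

text \<open>In a plane two coordinates determine the others. For the pair \<open>i, j\<close> whose
  minor is largest relative to \<open>h i * h j\<close>, this dependence is bounded in the scale of
  the box, so a pigeonhole on these two coordinates is enough. Two coordinates sharing
  \<open>n\<close> cells give the exponent one half.\<close>

lemma plane_pigeonhole:
  fixes S :: "(int ^ 'n::finite) set"
  assumes fin: "finite S" and n2: "card S \<ge> 2" and h: "\<And>i. h i > 0"
    and Sb: "S \<subseteq> lbox h 1" and span2: "S \<subseteq> span2 w1 w2"
    and nz: "minor2 (coord w1) (coord w2) i1 j1 \<noteq> 0"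
  shows "\<exists>x\<in>S. \<exists>y\<in>S. x \<noteq> y \<and> (\<forall>k. \<bar>coord x k - coord y k\<bar> \<le> 12 * h k / sqrt (card S))"
proof -
  define n where "n = card S"
  define f where "f = (\<lambda>(i,j). \<bar>minor2 (coord w1) (coord w2) i j\<bar> / (h i * h j))"
  have "\<exists>z. f z = Max (range f)" using Max_in[of "range f"] by fastforce
  then obtain i j where ij: "f (i, j) = Max (range f)" by (metis surj_pair)
  have mx: "f (k, l) \<le> f (i, j)" for k l unfolding ij by (intro Max_ge) auto
  have "f (i1, j1) > 0" using nz h unfolding f_def by simp
  hence "f (i, j) > 0" using mx[of i1 j1] by linarith
  hence Dnz: "\<bar>minor2 (coord w1) (coord w2) i j\<bar> > 0" unfolding f_def using h by (auto simp: zero_less_divide_iff)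
  have hn: "h i \<noteq> 0" "h i \<ge> 0" for i using h[of i] by auto
  \<comment> \<open>\<open>D i j * d k = D i k * d j - D j k * d i\<close> in the plane; maximality
    of \<open>f (i, j)\<close> bounds both ratios of minors.\<close>
  have key: "\<bar>d k\<bar> \<le> h k / h j * \<bar>d j\<bar> + h k / h i * \<bar>d i\<bar>" 
    if d: "\<And>i. d i = a * coord w1 i + b * coord w2 i" for d a b k
  proof -
    let ?D = "\<lambda>i j. minor2 (coord w1) (coord w2) i j"
    have id: "?D i j * d k = ?D i k * d j - ?D j k * d i"
      unfolding minor2_def d by (simp add: algebra_simps)
    have b1: "\<bar>?D i k\<bar> \<le> \<bar>?D i j\<bar> * (h k / h j)"
      using mx[of i k] h hn unfolding f_def by (simp add: field_simps)
    have "\<bar>?D k j\<bar> \<le> \<bar>?D i j\<bar> * (h k / h i)"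
      using mx[of k j] h hn unfolding f_def by (simp add: field_simps)
    moreover have "\<bar>?D k j\<bar> = \<bar>?D j k\<bar>" unfolding minor2_def by (simp add: abs_minus_commute)
    ultimately have b2: "\<bar>?D j k\<bar> \<le> \<bar>?D i j\<bar> * (h k / h i)" by simp
    have "\<bar>?D i j\<bar> * \<bar>d k\<bar> \<le> \<bar>?D i k\<bar> * \<bar>d j\<bar> + \<bar>?D j k\<bar> * \<bar>d i\<bar>"
      unfolding abs_mult[symmetric] id by (rule abs_triangle_ineq4)
    also have "\<dots> \<le> \<bar>?D i j\<bar> * (h k / h j) * \<bar>d j\<bar> + \<bar>?D i j\<bar> * (h k / h i) * \<bar>d i\<bar>"
      using b1 b2 by (intro add_mono mult_right_mono) auto
    also have "\<dots> = \<bar>?D i j\<bar> * (h k / h j * \<bar>d j\<bar> + h k / h i * \<bar>d i\<bar>)"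
      by (simp add: algebra_simps)
    finally show ?thesis using Dnz by (simp only: mult_le_cancel_left_pos)
  qed
  have bd: "\<bar>coord x k\<bar> \<le> h k" if "x \<in> S" for x k
    using Sb that lboxD[of x h 1] unfolding coord_def by auto
  have sq: "sqrt n > 0" using n2 n_def by simp
  have "\<exists>x\<in>S. \<exists>y\<in>S. x \<noteq> y \<and> \<bar>coord x i - coord y i\<bar> \<le> 6 * h i / sqrt n \<and> \<bar>coord x j - coord y j\<bar> \<le> 6 * h j / sqrt n"
  proof (cases "n \<le> 9")
    case True
    \<comment> \<open>With at most nine points \<open>sqrt n <= 3\<close>, and any two points
      already satisfy the bound.\<close>
    obtain x y where xy: "x \<in> S" "y \<in> S" "x \<noteq> y"
      using n2 by (metis card_le_Suc0_iff_eq fin not_less_eq_eq numeral_2_eq_2)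
    have s3: "sqrt n \<le> 3" by (rule real_le_lsqrt) (use True in auto)
    have "\<bar>coord x k - coord y k\<bar> \<le> 6 * h k / sqrt n" for k
    proof -
      have "\<bar>coord x k - coord y k\<bar> \<le> 2 * h k" using bd[OF xy(1), of k] bd[OF xy(2), of k] by linarith
      also have "2 * h k \<le> 6 * h k / sqrt n" 
        using mult_left_mono[OF s3, of "2 * h k"] hn sq by (simp add: pos_le_divide_eq)
      finally show ?thesis .
    qed
    thus ?thesis using xy by blast
  next
    case False
    \<comment> \<open>From \<open>sqrt n > 3\<close> follows \<open>2 * m + 1 < sqrt n\<close>, so
      there are fewer cells than points; \<open>m >= sqrt n / 6\<close> keeps the cells
      small.\<close>
    define m where "m = nat \<lfloor>sqrt n / 3\<rfloor>"
    have s3: "sqrt n > 3" by (rule real_less_rsqrt) (use False in auto)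
    have m1: "real m \<le> sqrt n / 3" "real m > sqrt n / 3 - 1" "m \<ge> 1"
      unfolding m_def using s3 by (simp_all add: le_nat_iff le_floor_iff) linarith+
    have m2: "real m \<ge> sqrt n / 6"
    proof (cases "sqrt n \<ge> 6")
      case True thus ?thesis using m1(2) by linarith
    next
      case False thus ?thesis using m1(3) by simp
    qed
    define F where "F k x = \<lfloor>coord x k * m / h k\<rfloor>" for k and x :: "int ^ 'n"
    have Fr: "F k x \<in> {- int m..int m}" if "x \<in> S" for k x
    proof -
      have "\<bar>coord x k * m / h k\<bar> \<le> m"
        using mult_right_mono[OF bd[OF that, of k], of "real m"] h[of k] by (simp add: abs_mult field_simps)
      hence "- real m \<le> coord x k * m / h k" "coord x k * m / h k \<le> real m" by linarith+
      thus ?thesis unfolding F_def by (simp add: le_floor_iff floor_le_iff)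
    qed
    have cm: "card {- int m..int m} = 2 * m + 1" by auto
    have "card ((\<lambda>x. (F i x, F j x)) ` S) \<le> card ({- int m..int m} \<times> {- int m..int m})"
      using Fr by (intro card_mono) auto
    also have "\<dots> = (2 * m + 1) ^ 2" by (simp only: card_cartesian_product power2_eq_square cm)
    also have "(2 * m + 1) ^ 2 < n"
    proof -
      have "2 * real m + 1 < sqrt n" using m1 s3 by linarith
      hence "(2 * real m + 1) ^ 2 < (sqrt n) ^ 2" by (intro power_strict_mono) auto
      hence "real ((2 * m + 1) ^ 2) < real n" by (simp add: add.commute)
      thus ?thesis by linarith
    qed
    finally have "\<not> inj_on (\<lambda>x. (F i x, F j x)) S" unfolding n_def by (rule pigeonhole)
    then obtain x y where xy: "x \<in> S" "y \<in> S" "x \<noteq> y" "F i x = F i y" "F j x = F j y"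
      unfolding inj_on_def by auto
    have "\<bar>coord x k - coord y k\<bar> \<le> 6 * h k / sqrt n" if "F k x = F k y" for k
    proof -
      have "\<bar>coord x k * m / h k - coord y k * m / h k\<bar> < 1" using that unfolding F_def by linarith
      moreover have "coord x k * m / h k - coord y k * m / h k = (coord x k - coord y k) * (m / h k)"
        by (simp add: algebra_simps diff_divide_distrib)
      ultimately have "\<bar>coord x k - coord y k\<bar> * (m / h k) < 1" using h[of k] by (simp add: abs_mult)
      hence a: "\<bar>coord x k - coord y k\<bar> * m < h k" using h[of k] by (simp add: field_simps)
      have "\<bar>coord x k - coord y k\<bar> * (sqrt n / 6) \<le> \<bar>coord x k - coord y k\<bar> * m"
        using m2 by (intro mult_left_mono) auto
      hence "\<bar>coord x k - coord y k\<bar> * (sqrt n / 6) \<le> h k" using a by linarith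
      thus ?thesis using sq by (simp add: pos_le_divide_eq)
    qed
    thus ?thesis using xy by blast
  qed
  then obtain x y where xy: "x \<in> S" "y \<in> S" "x \<noteq> y" "\<bar>coord x i - coord y i\<bar> \<le> 6 * h i / sqrt n"
    "\<bar>coord x j - coord y j\<bar> \<le> 6 * h j / sqrt n" by blast
  obtain a b where ab: "\<And>k. coord x k = a * coord w1 k + b * coord w2 k" using xy span2 unfolding span2_def by auto
  obtain a' b' where ab': "\<And>k. coord y k = a' * coord w1 k + b' * coord w2 k" using xy span2 unfolding span2_def by auto
  have "\<bar>coord x k - coord y k\<bar> \<le> 12 * h k / sqrt n" for k
  proof -
    have "\<bar>coord x k - coord y k\<bar> \<le> h k / h j * \<bar>coord x j - coord y j\<bar> + h k / h i * \<bar>coord x i - coord y i\<bar>"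
      by (rule key[of "\<lambda>k. coord x k - coord y k" "a - a'" "b - b'"]) (simp add: ab ab' algebra_simps)
    also have "\<dots> \<le> h k / h j * (6 * h j / sqrt n) + h k / h i * (6 * h i / sqrt n)"
      using xy hn by (intro add_mono mult_left_mono) auto
    also have "\<dots> = 12 * h k / sqrt n" using hn by simp
    finally show ?thesis .
  qed
  thus ?thesis using xy n_def by blast
qed

lemma coord_minor2: "minor2 (coord u) (coord v) i j = real_of_int (minor2 (($) u) (($) v) i j)"
  by (simp add: minor2_def coord_def)
lemma coord_minor3: "minor3 (coord u) (coord v) (coord w) i j k = real_of_int (minor3 (($) u) (($) v) (($) w) i j k)"
  by (simp add: minor3_def coord_minor2 coord_def)
lemma coord_minor4: "minor4 (coord u) (coord v) (coord w) (coord x) i j k l = real_of_int (minor4 (($) u) (($) v) (($) w) (($) x) i j k l)"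
  by (simp add: minor4_def coord_minor3 coord_def)

text \<open>A nonzero multiple of \<open>p\<close> is at least \<open>p\<close> in absolute value; a
  bound on it with denominator \<open>n\<close> thus becomes a bound on \<open>n\<close>.\<close>

lemma mult_le_if_dvd_abs_le:
  assumes "p dvd (z::int)" "z \<noteq> 0" "p > 0" "\<bar>real_of_int z\<bar> \<le> C / n" "n > 0"
  shows "n * real_of_int p \<le> C"
proof -
  have "p \<le> \<bar>z\<bar>" using assms by (intro zdvd_imp_le) auto
  hence "real_of_int p \<le> \<bar>real_of_int z\<bar>" by linarith
  hence "real_of_int p \<le> C / n" using assms by linarith
  thus ?thesis using assms by (simp add: field_simps)
qed

section \<open>The lattices of a proper progression\<close>

text \<open>The factor 16 leaves room for the short vectors found below, which are differences of
  points of \<open>lbox h 8\<close>.\<close>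

locale proper_gap =
  fixes p a1 a2 :: int and H1 H2 :: nat
  assumes p: "prime p" and H: "H1 \<ge> 1" "H1 \<le> H2"
    and proper: "\<And>x y. \<bar>x\<bar> \<le> 16 * int H1 \<Longrightarrow> \<bar>y\<bar> \<le> 16 * int H2 \<Longrightarrow> p dvd a1 * x + a2 * y \<Longrightarrow> x = 0 \<and> y = 0"
begin

definition N :: real where "N = real H1 * real H2"
text \<open>\<open>M l\<close> is the set of pairs \<open>(x, y)\<close> with \<open>\<phi> x = l \<phi> y\<close> modulo \<open>p\<close>, and
  \<open>L\<close> consists of the integer vectors congruent to multiples of \<open>(a1, a2)\<close> modulo \<open>p\<close>.\<close>

definition M :: "int \<Rightarrow> (int ^ 4) set" where
  "M l = {u. p dvd a1 * u $ 1 + a2 * u $ 2 - l * (a1 * u $ 3 + a2 * u $ 4)}"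
definition h :: "4 \<Rightarrow> real" where "h i = (if i = 1 \<or> i = 3 then real H1 else real H2)"
definition L :: "(int ^ 2) set" where "L = {v. p dvd a1 * v $ 2 - a2 * v $ 1}"
text \<open>The sides are swapped against \<open>h\<close>: for \<open>v\<close> in \<open>L\<close>
  it is \<open>(v $ 2, - v $ 1)\<close> on which \<open>a1 x1 + a2 x2\<close> vanishes modulo
  \<open>p\<close>, and to which properness applies.\<close>

definition h' :: "2 \<Rightarrow> real" where "h' i = (if i = 1 then real H2 else real H1)"

lemma p0: "p > 0" using p prime_gt_0_int by blast
lemma H2: "H2 \<ge> 1" using H by simp
lemma a1: "\<not> p dvd a1" using proper[of 1 0] H by auto
lemma a2: "\<not> p dvd a2" using proper[of 0 1] H by auto
lemma N1: "N \<ge> 1" unfolding N_def using H H2 mult_mono[of 1 "real H1" 1 "real H2"] by simp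
lemma h1: "h i \<ge> 1" unfolding h_def using H by simp
lemma h1': "h' i \<ge> 1" unfolding h'_def using H by simp
lemma hpos: "h i > 0" "h i \<ge> 0" using h1[of i] by simp_all
lemma hpos': "h' i > 0" "h' i \<ge> 0" using h1'[of i] by simp_all

lemma M_diff: "x \<in> M l \<Longrightarrow> y \<in> M l \<Longrightarrow> x - y \<in> M l"
proof -
  assume "x \<in> M l" "y \<in> M l"
  hence "p dvd (a1 * x $ 1 + a2 * x $ 2 - l * (a1 * x $ 3 + a2 * x $ 4)) - 
       (a1 * y $ 1 + a2 * y $ 2 - l * (a1 * y $ 3 + a2 * y $ 4))" unfolding M_def mem_Collect_eq by (rule dvd_diff)
  thus ?thesis unfolding M_def by (simp add: algebra_simps)
qed

lemma L_diff: "x \<in> L \<Longrightarrow> y \<in> L \<Longrightarrow> x - y \<in> L"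
proof -
  assume "x \<in> L" "y \<in> L"
  hence "p dvd (a1 * x $ 2 - a2 * x $ 1) - (a1 * y $ 2 - a2 * y $ 1)" unfolding L_def mem_Collect_eq by (rule dvd_diff)
  thus ?thesis unfolding L_def by (simp add: algebra_simps)
qed

text \<open>\<open>L\<close> has index \<open>p\<close> in the integer plane, so its expected share
  of the box is of order \<open>B^2 * N / p <= k * B\<close>. Two independent points have a
  determinant divisible by \<open>p\<close>, which gives this share. If all points lie on a line,
  too many of them would yield a nonzero vector short enough to contradict properness.\<close>

lemma card_L_le:
  fixes k :: real
  assumes B: "B > 0" and k: "k \<ge> 1" "B * N \<le> k * p" and ex: "\<exists>w \<in> L \<inter> lbox h' B. w \<noteq> 0"
  shows "real (card (L \<inter> lbox h' B)) \<le> 256 * k * B"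
proof -
  define T where "T = L \<inter> lbox h' B"
  have finT: "finite T" unfolding T_def using B hpos' by simp
  obtain w1 where w1: "w1 \<in> T" "w1 \<noteq> 0" using ex T_def by blast
  have c0: "real (card T) > 0" using card_pos_mem[OF finT w1(1)] by simp
  obtain i0 where i0: "coord w1 i0 \<noteq> 0" using w1(2) coord_eq_iff by (metis coord_zero)
  \<comment> \<open>The same box is rewritten with size factor \<open>8\<close> or \<open>4\<close>,
    as the lemmas on lines and planes expect.\<close>
  have bx: "lbox (\<lambda>i. B * h' i / t) t = lbox h' B" if "t > 0" for t using that by (simp add: lbox_def)
  have bpos: "B * h' i / t \<ge> 0" if "t > 0" for t i using B hpos' that by simp
  show ?thesis
  proof (cases "\<forall>x\<in>T. \<forall>j. minor2 (coord w1) (coord x) i0 j = 0")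
    case True
    hence "T \<subseteq> span1 w1" using span1_if_minors_zero[OF i0] by blast
    hence Te: "L \<inter> lbox (\<lambda>i. B * h' i / 8) 8 \<inter> span1 w1 = T" unfolding bx[of 8, simplified] T_def by blast
    have "\<exists>v g. v \<in> L \<and> v \<in> lbox (\<lambda>i. B * h' i / 8) 16 \<and> g \<noteq> 0 \<and> (\<forall>i. coord v i = g * coord w1 i) \<and>
           (\<forall>i. \<bar>coord v i\<bar> \<le> 64 * (B * h' i / 8) / card (L \<inter> lbox (\<lambda>i. B * h' i / 8) 8 \<inter> span1 w1))"
      by (rule short_vector_on_line[OF L_diff]) (use w1 bx[of 8] bpos[of 8] in \<open>auto simp: T_def\<close>)
    then obtain v g where v: "v \<in> L" "g \<noteq> 0" "\<And>i. coord v i = g * coord w1 i"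
      "\<And>i. \<bar>coord v i\<bar> \<le> 64 * (B * h' i / 8) / card T" unfolding Te by blast
    show ?thesis
    proof (rule ccontr)
      assume "\<not> ?thesis"
      hence "real (card T) \<ge> 256 * k * B" unfolding T_def by simp
      moreover have "256 * k * B \<ge> B / 2" using k B mult_right_mono[of 1 k B] by simp
      \<comment> \<open>From \<open>B / 2\<close> points on, the bound
        \<open>8 * B * h' i / card T\<close> falls to \<open>16 * h' i\<close>, the range of
        properness.\<close>
      ultimately have cT: "card T \<ge> B / 2" by linarith
      have b: "\<bar>coord v i\<bar> \<le> 16 * h' i" for i
      proof -
        have "\<bar>coord v i\<bar> \<le> 8 * B * h' i / card T" using v(4)[of i] by simp
        also have "\<dots> \<le> 16 * h' i"
          using mult_right_mono[OF cT hpos'(2)[of i]] c0 by (simp add: pos_divide_le_eq algebra_simps)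
        finally show ?thesis .
      qed
      have "\<bar>v $ 2\<bar> \<le> 16 * int H1" "\<bar>- (v $ 1)\<bar> \<le> 16 * int H2"
        using b[of 1] b[of 2] unfolding h'_def coord_def by simp_all
      moreover have "p dvd a1 * v $ 2 + a2 * (- (v $ 1))" using v(1) unfolding L_def by simp
      ultimately have "v $ 2 = 0 \<and> - (v $ 1) = 0" by (rule proper)
      hence "coord v i = 0" for i using exhaust_2[of i] by (auto simp: coord_def)
      thus False using v(2) v(3)[of i0] i0 by simp
    qed
  next
    case False
    then obtain w2 j0 where w2: "w2 \<in> T" "minor2 (coord w1) (coord w2) i0 j0 \<noteq> 0" by blast
    let ?h = "\<lambda>i. B * h' i / 4"
    have "T \<subseteq> span2 w1 w2"
    proof
      fix x assume "x \<in> T"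
      have "minor3 (coord w1) (coord w2) (coord x) i0 j0 k = 0" for k
        using exhaust_2[of k] exhaust_2[of i0] exhaust_2[of j0]
        by (elim disjE) (simp_all add: minor3_def minor2_def algebra_simps)
      thus "x \<in> span2 w1 w2" by (rule span2_if_minors_zero[OF w2(2)])
    qed
    hence Te: "L \<inter> lbox ?h 4 \<inter> span2 w1 w2 = T" using bx[of 4] unfolding T_def by auto
    have w8: "w1 \<in> lbox ?h 8"
      by (rule lbox_mono[of 4]) (use w1 bx[of 4] bpos[of 4] in \<open>auto simp: T_def\<close>)
    have "\<exists>v1 v2 g a b. v1 \<in> L \<and> v2 \<in> L \<and> g \<noteq> 0 \<and> b \<noteq> 0 \<and> (\<forall>i. coord v1 i = g * coord w1 i) \<and>
           (\<forall>i. coord v2 i = a * coord w1 i + b * coord w2 i) \<and>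
           (\<forall>i j. \<bar>minor2 (coord v1) (coord v2) i j\<bar> \<le> 4096 * (?h i * ?h j) / card (L \<inter> lbox ?h 4 \<inter> span2 w1 w2))"
      by (rule small_minor2[OF L_diff _ _ w8 _ _ w2(2)]) (use w1 w2 bx[of 4] bpos[of 4] in \<open>auto simp: T_def\<close>)
    then obtain v1 v2 g a b where v: "v1 \<in> L" "v2 \<in> L" "g \<noteq> 0" "b \<noteq> 0"
      "\<And>i. coord v1 i = g * coord w1 i" "\<And>i. coord v2 i = a * coord w1 i + b * coord w2 i"
      "\<And>i j. \<bar>minor2 (coord v1) (coord v2) i j\<bar> \<le> 4096 * (?h i * ?h j) / card T" unfolding Te by blast
    define z where "z = v1 $ 1 * v2 $ 2 - v1 $ 2 * v2 $ 1"
    have z: "real_of_int z = minor2 (coord v1) (coord v2) 1 2" unfolding z_def minor2_def coord_def by simp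
    have "minor2 (coord v1) (coord v2) i0 j0 = g * b * minor2 (coord w1) (coord w2) i0 j0"
      unfolding minor2_def v(5,6) by (simp add: algebra_simps)
    hence "minor2 (coord v1) (coord v2) i0 j0 \<noteq> 0" using v w2 by simp
    hence "z \<noteq> 0" using exhaust_2[of i0] exhaust_2[of j0] unfolding z_def minor2_def coord_def
      by (elim disjE) (auto simp: algebra_simps simp flip: of_int_mult)
    \<comment> \<open>Modulo \<open>p\<close> both vectors are multiples of \<open>(a1, a2)\<close>,
      so their determinant vanishes.\<close>
    moreover have "p dvd z"
    proof -
      have "p dvd (a1 * v2 $ 2 - a2 * v2 $ 1) * v1 $ 1 - (a1 * v1 $ 2 - a2 * v1 $ 1) * v2 $ 1"
        using v(1,2) unfolding L_def mem_Collect_eq by (metis dvd_diff dvd_mult2)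
      also have "\<dots> = a1 * z" unfolding z_def by (simp add: algebra_simps)
      finally show ?thesis using a1 p prime_dvd_mult_iff by blast
    qed
    moreover have "\<bar>real_of_int z\<bar> \<le> 256 * B * (B * N) / card T"
      using v(7)[of 1 2] unfolding z h'_def N_def by (simp add: field_simps)
    ultimately have "card T * real_of_int p \<le> 256 * B * (B * N)" using mult_le_if_dvd_abs_le p0 c0 by blast
    also have "\<dots> \<le> 256 * B * (k * p)" using k B by (intro mult_left_mono) auto
    finally have "card T * real_of_int p \<le> (256 * k * B) * real_of_int p" by (simp add: algebra_simps)
    thus ?thesis using p0 unfolding T_def by simp
  qed
qed

end

section \<open>Expansion and antisymmetry of minors\<close>

lemma minor3_col: "minor3 u v w i j k = u i * minor2 v w j k - v i * minor2 u w j k + w i * minor2 u v j k"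
  by (simp add: minor3_def minor2_def algebra_simps)
lemma minor4_col: "minor4 u v w x i j k l =
    u i * minor3 v w x j k l - v i * minor3 u w x j k l + w i * minor3 u v x j k l - x i * minor3 u v w j k l"
  by (simp add: minor4_def minor3_def minor2_def algebra_simps)
lemma minor2_same [simp]: "minor2 u v i i = 0" by (simp add: minor2_def)
lemma minor2_swap: "minor2 u v i j = - minor2 u v j i" by (simp add: minor2_def)
lemma minor3_swap: "minor3 u v w i j k = - minor3 u v w j i k" "minor3 u v w i j k = - minor3 u v w i k j"
  by (simp_all add: minor3_def minor2_def algebra_simps)
lemma minor3_same [simp]: "minor3 u v w i i k = 0" "minor3 u v w i k k = 0" "minor3 u v w i k i = 0"
  by (simp_all add: minor3_def minor2_def algebra_simps)
lemma minor4_same [simp]: "minor4 u v w x i i k l = 0" "minor4 u v w x i k i l = 0" "minor4 u v w x i k l i = 0"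
   "minor4 u v w x i k k l = 0" "minor4 u v w x i k l k = 0" "minor4 u v w x i k l l = 0"
  by (simp_all add: minor4_def minor3_def minor2_def algebra_simps)

text \<open>Three indices miss some \<open>t\<close> among the four. Up to sign, a minor avoiding
  \<open>t\<close> is the sorted one on the complement of \<open>t\<close>, unless a repeated index
  makes it zero.\<close>

lemma minor3_zero:
  fixes u v w :: "4 \<Rightarrow> int"
  assumes "minor3 u v w 1 2 3 = 0" "minor3 u v w 1 2 4 = 0" "minor3 u v w 1 3 4 = 0" "minor3 u v w 2 3 4 = 0"
  shows "minor3 u v w i j k = 0"
proof -
  note s = minor3_swap[of u v w]
  have a: "minor3 u v w i j k = 0" if "minor3 u v w 1 2 3 = 0" "i \<in> {1,2,3}" "j \<in> {1,2,3}" "k \<in> {1,2,3}" for i j k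
    using that s(1)[of 2 1 3] s(2)[of 1 3 2] s(1)[of 3 1 2] s(2)[of 2 3 1] s(1)[of 3 2 1] by auto
  have b: "minor3 u v w i j k = 0" if "minor3 u v w 1 2 4 = 0" "i \<in> {1,2,4}" "j \<in> {1,2,4}" "k \<in> {1,2,4}" for i j k
    using that s(1)[of 2 1 4] s(2)[of 1 4 2] s(1)[of 4 1 2] s(2)[of 2 4 1] s(1)[of 4 2 1] by auto
  have c: "minor3 u v w i j k = 0" if "minor3 u v w 1 3 4 = 0" "i \<in> {1,3,4}" "j \<in> {1,3,4}" "k \<in> {1,3,4}" for i j k
    using that s(1)[of 3 1 4] s(2)[of 1 4 3] s(1)[of 4 1 3] s(2)[of 3 4 1] s(1)[of 4 3 1] by auto
  have d: "minor3 u v w i j k = 0" if "minor3 u v w 2 3 4 = 0" "i \<in> {2,3,4}" "j \<in> {2,3,4}" "k \<in> {2,3,4}" for i j k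
    using that s(1)[of 3 2 4] s(2)[of 2 4 3] s(1)[of 4 2 3] s(2)[of 3 4 2] s(1)[of 4 3 2] by auto
  have "card {i, j, k} \<le> 3" by (simp add: card_insert_if)
  hence "{i, j, k} \<noteq> UNIV" by auto
  then obtain t where t: "t \<noteq> i" "t \<noteq> j" "t \<noteq> k" by blast
  have m: "x \<in> {1,2,3,4}" for x :: 4 using exhaust_4[of x] by blast
  consider "t = 1" | "t = 2" | "t = 3" | "t = 4" using m[of t] by blast
  thus ?thesis
  proof cases
    case 1 show ?thesis by (rule d[OF assms(4)]) (use t m[of i] m[of j] m[of k] 1 in blast)+
  next
    case 2 show ?thesis by (rule c[OF assms(3)]) (use t m[of i] m[of j] m[of k] 2 in blast)+
  next
    case 3 show ?thesis by (rule b[OF assms(2)]) (use t m[of i] m[of j] m[of k] 3 in blast)+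
  next
    case 4 show ?thesis by (rule a[OF assms(1)]) (use t m[of i] m[of j] m[of k] 4 in blast)+
  qed
qed

section \<open>Lattice points in the box, by rank\<close>

context proper_gap
begin

text \<open>The coefficient vector of the linear form whose zeros modulo \<open>p\<close> are
  \<open>M l\<close>.\<close>

definition c :: "int \<Rightarrow> 4 \<Rightarrow> int" where
  "c l i = (if i = 1 then a1 else if i = 2 then a2 else if i = 3 then - (l * a1) else - (l * a2))"

lemma c_simps [simp]: "c l 1 = a1" "c l 2 = a2" "c l 3 = - (l * a1)" "c l 4 = - (l * a2)"
  by (simp_all add: c_def)

lemma h_simps [simp]: "h 1 = H1" "h 2 = H2" "h 3 = H1" "h 4 = H2"
  by (simp_all add: h_def)

lemma c_not_dvd: "\<not> p dvd l \<Longrightarrow> \<not> p dvd c l i"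
  unfolding c_def using a1 a2 p by (auto simp: prime_dvd_mult_iff)

lemma M_iff: "u \<in> M l \<longleftrightarrow> p dvd (\<Sum>i\<in>UNIV. c l i * u $ i)"
  unfolding M_def sum_4 c_simps by (simp add: algebra_simps)

text \<open>Expanding the minor along the index \<open>i\<close> turns the sum into a combination of
  the values of the linear form at \<open>u\<close>, \<open>v\<close>, \<open>w\<close>, all
  divisible by \<open>p\<close>.\<close>

lemma M_dvd_minor3:
  assumes "u \<in> M l" "v \<in> M l" "w \<in> M l"
  shows "p dvd (\<Sum>i\<in>UNIV. c l i * minor3 (($) u) (($) v) (($) w) i j k)"
proof -
  have "(\<Sum>i\<in>UNIV. c l i * minor3 (($) u) (($) v) (($) w) i j k) =
     (\<Sum>i\<in>UNIV. c l i * u $ i) * minor2 (($) v) (($) w) j k - (\<Sum>i\<in>UNIV. c l i * v $ i) * minor2 (($) u) (($) w) j k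
     + (\<Sum>i\<in>UNIV. c l i * w $ i) * minor2 (($) u) (($) v) j k"
    unfolding minor3_col sum_distrib_right by (simp add: sum.distrib sum_subtractf algebra_simps)
  also have "p dvd \<dots>" using assms unfolding M_iff by (intro dvd_add dvd_diff dvd_mult2)
  finally show ?thesis .
qed

lemma M_dvd_minor4:
  assumes "u \<in> M l" "v \<in> M l" "w \<in> M l" "x \<in> M l"
  shows "p dvd (\<Sum>i\<in>UNIV. c l i * minor4 (($) u) (($) v) (($) w) (($) x) i j k m)"
proof -
  have "(\<Sum>i\<in>UNIV. c l i * minor4 (($) u) (($) v) (($) w) (($) x) i j k m) =
     (\<Sum>i\<in>UNIV. c l i * u $ i) * minor3 (($) v) (($) w) (($) x) j k m
     - (\<Sum>i\<in>UNIV. c l i * v $ i) * minor3 (($) u) (($) w) (($) x) j k m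
     + (\<Sum>i\<in>UNIV. c l i * w $ i) * minor3 (($) u) (($) v) (($) x) j k m
     - (\<Sum>i\<in>UNIV. c l i * x $ i) * minor3 (($) u) (($) v) (($) w) j k m"
    unfolding minor4_col sum_distrib_right by (simp add: sum.distrib sum_subtractf algebra_simps)
  also have "p dvd \<dots>" using assms unfolding M_iff by (intro dvd_add dvd_diff dvd_mult2)
  finally show ?thesis .
qed

lemma dvd_cancel: "p dvd a * z \<Longrightarrow> \<not> p dvd a \<Longrightarrow> p dvd z"
  using p prime_dvd_mult_iff by blast

text \<open>In the contraction of a determinant with \<open>c l\<close>, repeated indices kill all
  terms but one, so \<open>p\<close> divides \<open>c l i\<close> times the determinant and hence
  the determinant itself. Its size is \<open>O(N^2 / n)\<close>, as the four sides multiply to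
  \<open>N^2\<close>.\<close>

lemma rank4_bound:
  assumes l: "\<not> p dvd l"
    and w: "w1 \<in> M l" "w1 \<in> lbox h 8" "w2 \<in> M l" "w2 \<in> lbox h 4" "w3 \<in> M l" "w3 \<in> lbox h 2"
      "w4 \<in> M l" "w4 \<in> lbox h 1"
    and nz3: "minor3 (coord w1) (coord w2) (coord w3) i j k \<noteq> 0"
    and nz: "minor4 (coord w1) (coord w2) (coord w3) (coord w4) i j k m \<noteq> 0"
  shows "card (M l \<inter> lbox h 1) * real_of_int p \<le> 6291456 * N ^ 2"
proof -
  have dist: "i \<noteq> j" "i \<noteq> k" "i \<noteq> m" "j \<noteq> k" "j \<noteq> m" "k \<noteq> m" using nz by auto
  have U: "UNIV = {i,j,k,m}"
    by (rule card_subset_eq[symmetric]) (use dist in auto)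
  have hh: "h i * h j * h k * h m = N ^ 2"
  proof -
    have "h i * h j * h k * h m = prod h UNIV" unfolding U using dist by (simp add: mult.assoc)
    also have "\<dots> = N ^ 2" unfolding UNIV_4 by (simp add: N_def power2_eq_square)
    finally show ?thesis .
  qed
  have full: "x \<in> span3 w1 w2 w3" if "minor4 (coord w1) (coord w2) (coord w3) (coord x) i j k m = 0" for x
  proof (rule span3_if_minors_zero[OF nz3])
    fix l have "l \<in> {i,j,k,m}" using U by auto
    thus "minor4 (coord w1) (coord w2) (coord w3) (coord x) i j k l = 0" using that by auto
  qed
  have "\<exists>v1 v2 v3 v4. v1 \<in> M l \<and> v2 \<in> M l \<and> v3 \<in> M l \<and> v4 \<in> M l \<and>
           minor4 (coord v1) (coord v2) (coord v3) (coord v4) i j k m \<noteq> 0 \<and>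
           \<bar>minor4 (coord v1) (coord v2) (coord v3) (coord v4) i j k m\<bar>
              \<le> 6291456 * (h i * h j * h k * h m) / card (M l \<inter> lbox h 1)"
    by (rule small_minor4[OF M_diff hpos(2) w nz full])
  then obtain v1 v2 v3 v4 where v: "v1 \<in> M l" "v2 \<in> M l" "v3 \<in> M l" "v4 \<in> M l"
    "minor4 (coord v1) (coord v2) (coord v3) (coord v4) i j k m \<noteq> 0"
    "\<bar>minor4 (coord v1) (coord v2) (coord v3) (coord v4) i j k m\<bar> \<le> 6291456 * N ^ 2 / card (M l \<inter> lbox h 1)"
    unfolding hh by blast
  define z where "z = minor4 (($) v1) (($) v2) (($) v3) (($) v4) i j k m"
  have "p dvd (\<Sum>i\<in>UNIV. c l i * minor4 (($) v1) (($) v2) (($) v3) (($) v4) i j k m)"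
    by (rule M_dvd_minor4[OF v(1-4)])
  also have "(\<Sum>i\<in>UNIV. c l i * minor4 (($) v1) (($) v2) (($) v3) (($) v4) i j k m) = c l i * z"
    unfolding U z_def using dist by simp
  finally have dz: "p dvd z" using dvd_cancel c_not_dvd[OF l] by blast
  have "card (M l \<inter> lbox h 1) > 0"
    by (rule card_pos_mem[of _ w4]) (use w hpos in auto)
  thus ?thesis using mult_le_if_dvd_abs_le[OF dz _ p0] v(5,6) unfolding coord_minor4 z_def[symmetric] by simp
qed

text \<open>Modulo \<open>p\<close> the three vectors are orthogonal to \<open>c l\<close>, so their
  cross product is a multiple of \<open>c l\<close>. Each entry omits one coordinate, whence sizes
  \<open>N * H2\<close> for entries 1 and 3 and \<open>N * H1\<close> for entries 2 and 4, the shape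
  of \<open>h'\<close>.\<close>

lemma rank3_dual_vector:
  assumes l: "\<not> p dvd l"
    and w: "w1 \<in> M l" "w1 \<in> lbox h 8" "w2 \<in> M l" "w2 \<in> lbox h 4" "w3 \<in> M l" "w3 \<in> lbox h 2"
    and nz: "minor3 (coord w1) (coord w2) (coord w3) i j k \<noteq> 0"
    and S: "M l \<inter> lbox h 1 \<subseteq> span3 w1 w2 w3" and n: "n = card (M l \<inter> lbox h 1)"
    and big: "196608 * N ^ 2 < n * real_of_int p"
  shows "\<exists>w1 w2 w3 w4 :: int. \<not> (p dvd w1 \<and> p dvd w2) \<and> p dvd a1 * w2 - a2 * w1 \<and>
     p dvd a1 * w4 - a2 * w3 \<and> p dvd w3 + l * w1 \<and> p dvd w4 + l * w2 \<and>
     \<bar>real_of_int w1\<bar> \<le> 196608 * N * H2 / n \<and> \<bar>real_of_int w2\<bar> \<le> 196608 * N * H1 / n \<and>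
     \<bar>real_of_int w3\<bar> \<le> 196608 * N * H2 / n \<and> \<bar>real_of_int w4\<bar> \<le> 196608 * N * H1 / n"
proof -
  define T where "T = M l \<inter> lbox h 2 \<inter> span3 w1 w2 w3"
  have finT: "finite T" using hpos by (simp add: T_def)
  have "\<exists>v1 v2 v3 q. v1 \<in> M l \<and> v2 \<in> M l \<and> v3 \<in> M l \<and> q \<noteq> 0 \<and> 
           (\<forall>i j k. minor3 (coord v1) (coord v2) (coord v3) i j k = q * minor3 (coord w1) (coord w2) (coord w3) i j k) \<and>
           (\<forall>i j k. \<bar>minor3 (coord v1) (coord v2) (coord v3) i j k\<bar> \<le> 196608 * (h i * h j * h k) / card T)"
    unfolding T_def by (rule small_minor3[OF M_diff hpos(2) w nz])
  then obtain v1 v2 v3 q where v: "v1 \<in> M l" "v2 \<in> M l" "v3 \<in> M l" "q \<noteq> 0"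
    "\<And>i j k. minor3 (coord v1) (coord v2) (coord v3) i j k = q * minor3 (coord w1) (coord w2) (coord w3) i j k"
    "\<And>i j k. \<bar>minor3 (coord v1) (coord v2) (coord v3) i j k\<bar> \<le> 196608 * (h i * h j * h k) / card T" by blast
  have n0: "real n > 0"
  proof -
    have "N ^ 2 \<ge> 0" by simp
    hence "n * real_of_int p > 0" using big by linarith
    thus ?thesis using p0 by (simp add: zero_less_mult_iff)
  qed
  have "M l \<inter> lbox h 1 \<subseteq> T" using S lbox_mono[of 1 2 h] hpos unfolding T_def by auto
  hence nT: "n \<le> card T" unfolding n using finT card_mono by blast
  let ?D = "minor3 (($) v1) (($) v2) (($) v3)"
  have b: "\<bar>real_of_int (?D i j k)\<bar> \<le> 196608 * (h i * h j * h k) / n" for i j k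
  proof -
    have "\<bar>real_of_int (?D i j k)\<bar> \<le> 196608 * (h i * h j * h k) / card T" using v(6) unfolding coord_minor3 .
    also have "\<dots> \<le> 196608 * (h i * h j * h k) / n"
      using nT n0 hpos by (intro divide_left_mono) auto
    finally show ?thesis .
  qed
  have s: "p dvd (\<Sum>i\<in>UNIV. c l i * ?D i j k)" for j k by (rule M_dvd_minor3[OF v(1-3)])
  \<comment> \<open>The cross product of \<open>v1\<close>, \<open>v2\<close>, \<open>v3\<close>,
    with alternating signs.\<close>
  define W1 W2 W3 W4 where "W1 = ?D 2 3 4" and "W2 = - ?D 1 3 4" and "W3 = ?D 1 2 4" and "W4 = - ?D 1 2 3"
  \<comment> \<open>In \<open>s\<close>, the free indices \<open>3 4\<close> leave only the terms 1
    and 2; the choice \<open>2 4\<close> below leaves 1 and 3, and \<open>1 3\<close> leaves 2 and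
    4.\<close>
  have e1: "p dvd a1 * W2 - a2 * W1"
  proof -
    have "p dvd a1 * ?D 1 3 4 + a2 * ?D 2 3 4" using s[of 3 4] unfolding sum_4 by simp
    hence "p dvd - (a1 * ?D 1 3 4 + a2 * ?D 2 3 4)" by (simp only: dvd_minus_iff)
    thus ?thesis unfolding W1_def W2_def by (simp add: algebra_simps)
  qed
  have e3: "p dvd W3 + l * W1"
  proof -
    have "p dvd a1 * (W3 + l * W1)"
      using s[of 2 4] minor3_swap(1)[of "($) v1" _ _ 3 2 4] unfolding sum_4 W1_def W3_def
      by (simp add: algebra_simps)
    thus ?thesis using dvd_cancel a1 by blast
  qed
  have e4: "p dvd W4 + l * W2"
  proof -
    have "?D 4 1 3 = ?D 1 3 4" using minor3_swap(1)[of "($) v1" "($) v2" "($) v3" 4 1 3] minor3_swap(2)[of "($) v1" "($) v2" "($) v3" 1 4 3] by simp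
    hence "p dvd a2 * (W4 + l * W2)"
      using s[of 1 3] minor3_swap(1)[of "($) v1" "($) v2" "($) v3" 2 1 3] unfolding sum_4 W4_def W2_def
      by (simp add: algebra_simps)
    thus ?thesis using dvd_cancel a2 by blast
  qed
  have e2: "p dvd a1 * W4 - a2 * W3"
  proof -
    have "p dvd a1 * (W4 + l * W2) - a2 * (W3 + l * W1) - l * (a1 * W2 - a2 * W1)"
      by (rule dvd_diff[OF dvd_diff[OF dvd_mult[OF e4] dvd_mult[OF e3]] dvd_mult[OF e1]])
    thus ?thesis by (simp add: algebra_simps)
  qed
  have B: "\<bar>real_of_int W1\<bar> \<le> 196608 * N * H2 / n" "\<bar>real_of_int W2\<bar> \<le> 196608 * N * H1 / n"
    "\<bar>real_of_int W3\<bar> \<le> 196608 * N * H2 / n" "\<bar>real_of_int W4\<bar> \<le> 196608 * N * H1 / n"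
    using b[of 2 3 4] b[of 1 3 4] b[of 1 2 4] b[of 1 2 3]
    unfolding W1_def W2_def W3_def W4_def by (simp_all add: N_def mult_ac)
  have HN: "N * H1 \<le> N ^ 2" "N * H2 \<le> N ^ 2"
  proof -
    have "real H1 \<le> N" "real H2 \<le> N" unfolding N_def using H H2 by simp_all
    thus "N * H1 \<le> N ^ 2" "N * H2 \<le> N ^ 2" unfolding power2_eq_square using N1 by (auto intro: mult_left_mono)
  qed
  \<comment> \<open>By \<open>big\<close> every entry is below \<open>p\<close>. If the first two
    entries vanished modulo \<open>p\<close>, so would the others, and all four would be zero,
    against independence.\<close>
  have small: "W = 0" if "p dvd W" "\<bar>real_of_int W\<bar> \<le> 196608 * N * H1 / n \<or> \<bar>real_of_int W\<bar> \<le> 196608 * N * H2 / n" for W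
  proof (rule ccontr)
    assume nzW: "W \<noteq> 0"
    have "\<bar>real_of_int W\<bar> \<le> 196608 * N ^ 2 / n"
    proof -
      have "196608 * N * H1 / n \<le> 196608 * N ^ 2 / n" "196608 * N * H2 / n \<le> 196608 * N ^ 2 / n"
        using HN n0 by (auto intro!: divide_right_mono)
      thus ?thesis using that by linarith
    qed
    hence "n * real_of_int p \<le> 196608 * N ^ 2" using mult_le_if_dvd_abs_le[OF that(1) nzW p0 _ n0] by blast
    thus False using big by simp
  qed
  have "\<not> (p dvd W1 \<and> p dvd W2)"
  proof
    assume a: "p dvd W1 \<and> p dvd W2"
    have d: "p dvd W3" "p dvd W4"
      using a e3 e4 by (metis dvd_add_left_iff dvd_mult)+
    have "W1 = 0" "W2 = 0" "W3 = 0" "W4 = 0" using small a d B by blast+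
    hence "?D 1 2 3 = 0" "?D 1 2 4 = 0" "?D 1 3 4 = 0" "?D 2 3 4 = 0"
      unfolding W1_def W2_def W3_def W4_def by simp_all
    hence "?D i j k = 0" by (rule minor3_zero)
    hence "minor3 (coord v1) (coord v2) (coord v3) i j k = 0" unfolding coord_minor3 by simp
    thus False using v(4,5) nz by simp
  qed
  thus ?thesis using e1 e2 e3 e4 B by blast
qed


text \<open>\<open>w1\<close> vanishes in the short coordinates 1 and 3. If \<open>w2\<close> does
  too, the minor in rows 2 and 4 is a nonzero multiple of \<open>p\<close> that \<open>big\<close>
  makes too small. Otherwise a short coordinate \<open>m\<close> separates the points into at most
  \<open>2 * H1 + 1 <= 3 * H1\<close> translates of the line of \<open>w1\<close>. That line then
  has at least \<open>n / (3 * H1)\<close> points, and its short vector has long coordinates at most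
  \<open>64 * H2 * 3 * H1 / n\<close>.\<close>

lemma rank2_kernel_vector:
  assumes w: "w1 \<in> M l" "w1 \<in> lbox h 2" "w1 $ 1 = 0" "w1 $ 3 = 0" "w2 \<in> M l" "w2 \<in> lbox h 1"
    and nz: "minor2 (coord w1) (coord w2) i0 j0 \<noteq> 0"
    and S: "M l \<inter> lbox h 1 \<subseteq> span2 w1 w2" and n: "n = card (M l \<inter> lbox h 1)"
    and big: "4096 * N ^ 2 < n * real_of_int p"
  shows "\<exists>v\<in>M l \<inter> lbox h 16. v \<noteq> 0 \<and> v $ 1 = 0 \<and> v $ 3 = 0 \<and>
     \<bar>coord v 2\<bar> \<le> 192 * N / n \<and> \<bar>coord v 4\<bar> \<le> 192 * N / n"
proof -
  have n0: "real n > 0"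
  proof -
    have "N ^ 2 \<ge> 0" by simp
    hence "n * real_of_int p > 0" using big by linarith
    thus ?thesis using p0 by (simp add: zero_less_mult_iff)
  qed
  have w8: "w1 \<in> lbox h 8" by (rule lbox_mono[OF _ _ w(2)]) (use hpos in auto)
  have w4: "w2 \<in> lbox h 4" by (rule lbox_mono[OF _ _ w(6)]) (use hpos in auto)
  have w1nz: "w1 \<noteq> 0" using nz by (auto simp: minor2_def)
  show ?thesis
  proof (cases "w2 $ 1 = 0 \<and> w2 $ 3 = 0")
    case True
    define T where "T = M l \<inter> lbox h 4 \<inter> span2 w1 w2"
    have finT: "finite T" using hpos by (simp add: T_def)
    have "\<exists>v1 v2 g a b. v1 \<in> M l \<and> v2 \<in> M l \<and> g \<noteq> 0 \<and> b \<noteq> 0 \<and> (\<forall>i. coord v1 i = g * coord w1 i) \<and>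
           (\<forall>i. coord v2 i = a * coord w1 i + b * coord w2 i) \<and>
           (\<forall>i j. \<bar>minor2 (coord v1) (coord v2) i j\<bar> \<le> 4096 * (h i * h j) / card T)"
      unfolding T_def by (rule small_minor2[OF M_diff hpos(2) w(1) w8 w(5) w4 nz])
    then obtain v1 v2 g a b where v: "v1 \<in> M l" "v2 \<in> M l" "g \<noteq> 0" "b \<noteq> 0"
      "\<And>i. coord v1 i = g * coord w1 i" "\<And>i. coord v2 i = a * coord w1 i + b * coord w2 i"
      "\<And>i j. \<bar>minor2 (coord v1) (coord v2) i j\<bar> \<le> 4096 * (h i * h j) / card T" by blast
    have "M l \<inter> lbox h 1 \<subseteq> T" using S lbox_mono[of 1 4 h] hpos unfolding T_def by auto
    hence nT: "n \<le> card T" unfolding n using finT card_mono by blast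
    have z: "v1 $ 1 = 0" "v1 $ 3 = 0" "v2 $ 1 = 0" "v2 $ 3 = 0"
      using v(5)[of 1] v(5)[of 3] v(6)[of 1] v(6)[of 3] True w(3,4) by (simp_all add: coord_def)
    define d where "d = v1 $ 2 * v2 $ 4 - v1 $ 4 * v2 $ 2"
    have d: "real_of_int d = minor2 (coord v1) (coord v2) 2 4" unfolding d_def minor2_def coord_def by simp
    have "p dvd a2 * (v1 $ 2 - l * v1 $ 4)" "p dvd a2 * (v2 $ 2 - l * v2 $ 4)"
      using v(1,2) z unfolding M_def by (simp_all add: algebra_simps)
    hence "p dvd v1 $ 2 - l * v1 $ 4" "p dvd v2 $ 2 - l * v2 $ 4" using dvd_cancel a2 by blast+
    hence "p dvd (v1 $ 2 - l * v1 $ 4) * v2 $ 4 - (v2 $ 2 - l * v2 $ 4) * v1 $ 4"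
      by (rule dvd_diff[OF dvd_mult2 dvd_mult2])
    hence pd: "p dvd d" unfolding d_def by (simp add: algebra_simps)
    have "minor2 (coord v1) (coord v2) i0 j0 = g * b * minor2 (coord w1) (coord w2) i0 j0"
      unfolding minor2_def v(5,6) by (simp add: algebra_simps)
    hence nz': "minor2 (coord v1) (coord v2) i0 j0 \<noteq> 0" using v nz by simp
    have dnz: "d \<noteq> 0"
    proof
      assume "d = 0"
      hence "minor2 (coord v1) (coord v2) 2 4 = 0" "minor2 (coord v1) (coord v2) 4 2 = 0"
        using d minor2_swap[of "coord v1" "coord v2" 4 2] by simp_all
      moreover have "coord v1 1 = 0" "coord v1 3 = 0" "coord v2 1 = 0" "coord v2 3 = 0" using z by (simp_all add: coord_def)
      ultimately have "minor2 (coord v1) (coord v2) i0 j0 = 0"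
        using exhaust_4[of i0] exhaust_4[of j0] by (elim disjE) (simp_all add: minor2_def)
      thus False using nz' by simp
    qed
    have "\<bar>real_of_int d\<bar> \<le> 4096 * (real H2 * real H2) / card T" using v(7)[of 2 4] unfolding d by simp
    also have "\<dots> \<le> 4096 * (real H2 * real H2) / n" using nT n0 by (intro divide_left_mono) auto
    finally have "n * real_of_int p \<le> 4096 * (real H2 * real H2)" using mult_le_if_dvd_abs_le[OF pd dnz p0 _ n0] by blast
    also have "\<dots> \<le> 4096 * N ^ 2"
    proof -
      have "real H2 \<le> N" unfolding N_def using H by simp
      hence "real H2 * real H2 \<le> N * N" by (intro mult_mono) auto
      thus ?thesis by (simp add: power2_eq_square)
    qed
    finally show ?thesis using big by simp
  next
    case False
    then obtain m where m: "m = 1 \<or> m = 3" "w2 $ m \<noteq> 0" by blast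
    have m': "coord w2 m \<noteq> 0" "coord w1 m = 0" "h m = H1" using m w(3,4) by (auto simp: coord_def)
    define U where "U = M l \<inter> lbox h 8 \<inter> span1 w1"
    define S where "S = M l \<inter> lbox h 1"
    have finU: "finite U" and finS: "finite S" using hpos by (simp_all add: U_def S_def)
    have fib: "card {y \<in> S. y $ m = t} \<le> card U" for t
    proof (cases "{y \<in> S. y $ m = t} = {}")
      case True thus ?thesis by (simp only: card.empty)
    next
      case False
      then obtain x where x: "x \<in> S" "x $ m = t" by blast
      have "card {y \<in> S. y $ m = t} = card {y \<in> S. coord y m = coord x m}" using x by (simp add: coord_def)
      also have "\<dots> \<le> card U"
      proof (rule fibre_card_le[OF _ finU])
        fix y assume y: "y \<in> S" "coord y m = coord x m"
        have "y - x \<in> lbox h (1 + 1)" using x y unfolding S_def by (intro lbox_diff) auto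
        hence b8: "y - x \<in> lbox h 8" by (rule lbox_mono[rotated 2]) (use hpos in auto)
        obtain a b where ab: "\<And>i. coord x i = a * coord w1 i + b * coord w2 i" 
          using x assms(8) unfolding S_def span2_def by blast
        obtain a' b' where ab': "\<And>i. coord y i = a' * coord w1 i + b' * coord w2 i"
          using y assms(8) unfolding S_def span2_def by blast
        have "b' = b" using y(2) m' unfolding ab ab' by simp
        hence "coord (y - x) i = (a' - a) * coord w1 i" for i using ab ab' by (simp add: algebra_simps)
        hence "y - x \<in> span1 w1" by (rule span1I)
        thus "y - x \<in> U" using b8 M_diff x y unfolding U_def S_def by simp
      qed
      finally show ?thesis .
    qed
    have "S = (\<Union>t\<in>{- int H1..int H1}. {y \<in> S. y $ m = t})"
    proof -
      have "y $ m \<in> {- int H1..int H1}" if "y \<in> S" for y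
        using that lboxD[of y h 1 m] m' unfolding S_def by simp linarith
      thus ?thesis by blast
    qed
    hence "card S \<le> (\<Sum>t\<in>{- int H1..int H1}. card {y \<in> S. y $ m = t})"
      using card_UN_le[of "{- int H1..int H1}" "\<lambda>t. {y \<in> S. y $ m = t}"] by simp
    also have "\<dots> \<le> (\<Sum>t\<in>{- int H1..int H1}. card U)" by (intro sum_mono fib)
    also have "\<dots> = (2 * H1 + 1) * card U"
    proof -
      have "card {- int H1..int H1} = 2 * H1 + 1" by auto
      thus ?thesis by (simp only: sum_constant of_nat_id)
    qed
    also have "\<dots> \<le> (3 * H1) * card U" using H by (intro mult_right_mono) auto
    finally have "n \<le> 3 * H1 * card U" unfolding n S_def .
    hence nU: "real n \<le> 3 * real H1 * card U" by (metis of_nat_le_iff of_nat_mult of_nat_numeral)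
    hence U0: "real (card U) > 0" using n0 by (cases "card U = 0") auto
    have "\<exists>v g. v \<in> M l \<and> v \<in> lbox h 16 \<and> g \<noteq> 0 \<and> (\<forall>i. coord v i = g * coord w1 i) \<and>
           (\<forall>i. \<bar>coord v i\<bar> \<le> 64 * h i / card U)"
      unfolding U_def by (rule short_vector_on_line[OF M_diff hpos(2) w(1) w8 w1nz])
    then obtain v g where v: "v \<in> M l" "v \<in> lbox h 16" "g \<noteq> 0" "\<And>i. coord v i = g * coord w1 i"
      "\<And>i. \<bar>coord v i\<bar> \<le> 64 * h i / card U" by blast
    have "v \<noteq> 0"
    proof
      assume "v = 0"
      hence "coord w1 i = 0" for i using v(3) v(4)[of i] by simp
      thus False using w1nz by (simp add: coord_eq_iff)
    qed
    moreover have "v $ 1 = 0" "v $ 3 = 0" using v(4)[of 1] v(4)[of 3] w(3,4) by (simp_all add: coord_def)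
    moreover have "64 * real H2 / card U \<le> 192 * N / n"
    proof -
      have "64 * real H2 * n \<le> 64 * real H2 * (3 * real H1 * card U)" using nU by (intro mult_left_mono) auto
      thus ?thesis using U0 n0 unfolding N_def by (simp add: field_simps)
    qed
    moreover have "\<bar>coord v 2\<bar> \<le> 64 * real H2 / card U" "\<bar>coord v 4\<bar> \<le> 64 * real H2 / card U"
      using v(5)[of 2] v(5)[of 4] by simp_all
    ultimately show ?thesis using v(1,2) by (intro bexI[of _ v]) auto
  qed
qed

text \<open>Independent vectors are added until their span contains all points of the box. Stopping
  at rank 1 gives \<open>?P1\<close>, at rank 2 \<open>?P2\<close> or \<open>?P3\<close>, at rank 3
  \<open>?P4\<close>; rank 4 contradicts \<open>big\<close>. \<open>?P2\<close> carries
  \<open>n <= 9 * H1 ^ 2\<close> because its box can be counted efficiently only then.\<close>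

lemma many_points_imp_small_vector:
  assumes l: "\<not> p dvd l" and n: "n = card (M l \<inter> lbox h 1)" "n \<ge> 2"
    and big: "6291456 * N ^ 2 < n * real_of_int p"
  shows "(\<exists>v\<in>M l \<inter> lbox h 16. v \<noteq> 0 \<and> (\<forall>i. \<bar>coord v i\<bar> \<le> 64 * h i / n)) \<or>
    (n \<le> 9 * H1 ^ 2 \<and> (\<exists>v\<in>M l \<inter> lbox h 16. v \<noteq> 0 \<and> (\<forall>i. \<bar>coord v i\<bar> \<le> 12 * h i / sqrt n))) \<or>
    (\<exists>v\<in>M l \<inter> lbox h 16. v \<noteq> 0 \<and> v $ 1 = 0 \<and> v $ 3 = 0 \<and>
     \<bar>coord v 2\<bar> \<le> 192 * N / n \<and> \<bar>coord v 4\<bar> \<le> 192 * N / n) \<or>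
    (\<exists>w1 w2 w3 w4 :: int. \<not> (p dvd w1 \<and> p dvd w2) \<and> p dvd a1 * w2 - a2 * w1 \<and>
     p dvd a1 * w4 - a2 * w3 \<and> p dvd w3 + l * w1 \<and> p dvd w4 + l * w2 \<and>
     \<bar>real_of_int w1\<bar> \<le> 196608 * N * H2 / n \<and> \<bar>real_of_int w2\<bar> \<le> 196608 * N * H1 / n \<and>
     \<bar>real_of_int w3\<bar> \<le> 196608 * N * H2 / n \<and> \<bar>real_of_int w4\<bar> \<le> 196608 * N * H1 / n)"
    (is "?P1 \<or> ?P2 \<or> ?P3 \<or> ?P4")
proof -
  define S where "S = M l \<inter> lbox h 1"
  have finS: "finite S" using hpos by (simp add: S_def)
  have N2: "N ^ 2 \<ge> 0" by simp
  have b1: "196608 * N ^ 2 < n * real_of_int p" "4096 * N ^ 2 < n * real_of_int p" using big N2 by linarith+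
  have Sb: "x \<in> lbox h t" if "x \<in> S" "t \<ge> 1" for x t
    using that lbox_mono[of 1 t h x] hpos unfolding S_def by auto
  \<comment> \<open>The first vector is fixed before the rank is known. If
    \<open>n > 9 * H1 ^ 2\<close>, the points outnumber the \<open>(2 * H1 + 1)^2\<close> possible
    pairs of short coordinates, so some difference vanishes in both.\<close>
  have "\<exists>w. w \<in> M l \<and> w \<in> lbox h 2 \<and> w \<noteq> 0 \<and> (n > 9 * H1 ^ 2 \<longrightarrow> w $ 1 = 0 \<and> w $ 3 = 0)"
  proof (cases "n > 9 * H1 ^ 2")
    case True
    have r: "x $ 1 \<in> {- int H1..int H1} \<and> x $ 3 \<in> {- int H1..int H1}" if "x \<in> S" for x
      using that lboxD[of x h 1 1] lboxD[of x h 1 3] unfolding S_def by simp linarith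
    have c: "card {- int H1..int H1} = 2 * H1 + 1" by auto
    have "card ((\<lambda>x. (x $ 1, x $ 3)) ` S) \<le> card ({- int H1..int H1} \<times> {- int H1..int H1})"
      using r by (intro card_mono) auto
    also have "\<dots> = (2 * H1 + 1) * (2 * H1 + 1)" by (simp only: card_cartesian_product c)
    also have "\<dots> \<le> (3 * H1) * (3 * H1)" using H by (intro mult_mono) auto
    also have "\<dots> < card S" using True unfolding n S_def by (simp add: power2_eq_square)
    finally have "\<not> inj_on (\<lambda>x. (x $ 1, x $ 3)) S" by (rule pigeonhole)
    then obtain x y where xy: "x \<in> S" "y \<in> S" "x \<noteq> y" "x $ 1 = y $ 1" "x $ 3 = y $ 3"
      unfolding inj_on_def by auto
    have "x - y \<in> lbox h (1 + 1)" using xy unfolding S_def by (intro lbox_diff) auto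
    thus ?thesis using xy M_diff unfolding S_def by (intro exI[of _ "x - y"]) auto
  next
    case False
    obtain x y where xy: "x \<in> S" "y \<in> S" "x \<noteq> y"
      using n by (metis S_def card_le_Suc0_iff_eq finS not_less_eq_eq numeral_2_eq_2)
    have "x - y \<in> lbox h (1 + 1)" using xy unfolding S_def by (intro lbox_diff) auto
    thus ?thesis using xy M_diff False unfolding S_def by (intro exI[of _ "x - y"]) auto
  qed
  then obtain w1 where w1: "w1 \<in> M l" "w1 \<in> lbox h 2" "w1 \<noteq> 0"
    "n > 9 * H1 ^ 2 \<Longrightarrow> w1 $ 1 = 0 \<and> w1 $ 3 = 0" by blast
  have w18: "w1 \<in> lbox h 8" by (rule lbox_mono[OF _ _ w1(2)]) (use hpos in auto)
  obtain i0 where i0: "coord w1 i0 \<noteq> 0" using w1(3) coord_eq_iff by (metis coord_zero)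
  show ?thesis
  proof (cases "\<forall>x\<in>S. \<forall>j. minor2 (coord w1) (coord x) i0 j = 0")
    case True
    define T where "T = M l \<inter> lbox h 8 \<inter> span1 w1"
    have "S \<subseteq> T" using True span1_if_minors_zero[OF i0] Sb[of _ 8] unfolding S_def T_def by auto
    moreover have "finite T" using hpos by (simp add: T_def)
    ultimately have nT: "n \<le> card T" unfolding n S_def using card_mono by blast
    have "\<exists>v g. v \<in> M l \<and> v \<in> lbox h 16 \<and> g \<noteq> 0 \<and> (\<forall>i. coord v i = g * coord w1 i) \<and>
           (\<forall>i. \<bar>coord v i\<bar> \<le> 64 * h i / card T)"
      unfolding T_def by (rule short_vector_on_line[OF M_diff hpos(2) w1(1) w18 w1(3)])
    then obtain v g where v: "v \<in> M l" "v \<in> lbox h 16" "g \<noteq> 0" "\<And>i. coord v i = g * coord w1 i"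
      "\<And>i. \<bar>coord v i\<bar> \<le> 64 * h i / card T" by blast
    have "v \<noteq> 0" using v(3) v(4)[of i0] i0 by auto
    moreover have "\<bar>coord v i\<bar> \<le> 64 * h i / n" for i
    proof -
      have "64 * h i / card T \<le> 64 * h i / n" using nT n(2) hpos by (intro divide_left_mono) auto
      thus ?thesis using v(5)[of i] by linarith
    qed
    ultimately have ?P1 using v(1,2) by blast
    thus ?thesis by blast
  next
    case False
    then obtain w2 j0 where w2: "w2 \<in> S" "minor2 (coord w1) (coord w2) i0 j0 \<noteq> 0" by blast
    have w2': "w2 \<in> M l" "w2 \<in> lbox h 1" "w2 \<in> lbox h 4" using w2 Sb[of w2 4] unfolding S_def by auto
    show ?thesis
    proof (cases "\<forall>x\<in>S. \<forall>k. minor3 (coord w1) (coord w2) (coord x) i0 j0 k = 0")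
      case True
      hence SS: "S \<subseteq> span2 w1 w2" using span2_if_minors_zero[OF w2(2)] by blast
      show ?thesis
      proof (cases "n \<le> 9 * H1 ^ 2")
        case True
        have "\<exists>x\<in>S. \<exists>y\<in>S. x \<noteq> y \<and> (\<forall>k. \<bar>coord x k - coord y k\<bar> \<le> 12 * h k / sqrt (card S))"
          by (rule plane_pigeonhole[OF finS _ hpos(1) _ SS w2(2)]) (use n S_def in auto)
        then obtain x y where xy: "x \<in> S" "y \<in> S" "x \<noteq> y"
          "\<And>k. \<bar>coord x k - coord y k\<bar> \<le> 12 * h k / sqrt n" unfolding n S_def by blast
        have "x - y \<in> lbox h (1 + 1)" using xy unfolding S_def by (intro lbox_diff) auto
        hence "x - y \<in> lbox h 16" by (rule lbox_mono[rotated 2]) (use hpos in auto)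
        hence ?P2 using xy True M_diff unfolding S_def by (intro conjI bexI[of _ "x - y"]) auto
        thus ?thesis by blast
      next
        case False
        hence "w1 $ 1 = 0" "w1 $ 3 = 0" using w1(4) by auto
        hence ?P3 using rank2_kernel_vector[OF w1(1,2) _ _ w2'(1,2) w2(2) SS[unfolded S_def] n(1) b1(2)] by blast
        thus ?thesis by blast
      qed
    next
      case False
      then obtain w3 k0 where w3: "w3 \<in> S" "minor3 (coord w1) (coord w2) (coord w3) i0 j0 k0 \<noteq> 0" by blast
      have w3': "w3 \<in> M l" "w3 \<in> lbox h 2" using w3 Sb[of w3 2] unfolding S_def by auto
      show ?thesis
      proof (cases "\<forall>x\<in>S. \<forall>m. minor4 (coord w1) (coord w2) (coord w3) (coord x) i0 j0 k0 m = 0")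
        case True
        hence SS: "S \<subseteq> span3 w1 w2 w3" using span3_if_minors_zero[OF w3(2)] by blast
        have ?P4 by (rule rank3_dual_vector[OF l w1(1) w18 w2'(1,3) w3' w3(2) SS[unfolded S_def] n(1) b1(1)])
        thus ?thesis by blast
      next
        case False
        then obtain w4 m where w4: "w4 \<in> S" "minor4 (coord w1) (coord w2) (coord w3) (coord w4) i0 j0 k0 m \<noteq> 0" by blast
        have "card (M l \<inter> lbox h 1) * real_of_int p \<le> 6291456 * N ^ 2"
          by (rule rank4_bound[OF l w1(1) w18 w2'(1,3) w3' _ _ w3(2) w4(2)]) (use w4 S_def in auto)
        thus ?thesis using big n by simp
      qed
    qed
  qed
qed

end

section \<open>Counting ratios\<close>

text \<open>The \<open>r l\<close> of the overview. Pairs with \<open>c\<close> divisible by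
  \<open>p\<close> are left out: the zero pair would count for every \<open>l\<close>.\<close>

definition ratio_count :: "int \<Rightarrow> int set \<Rightarrow> int \<Rightarrow> nat" where
  "ratio_count p A l = card {(a, c). a \<in> A \<and> c \<in> A \<and> \<not> p dvd c \<and> p dvd a - l * c}"

context proper_gap
begin

lemma eq_if_dvd_diff:
  assumes "l \<in> {1..<p}" "l' \<in> {1..<p}" "p dvd l - l'"
  shows "l = l'"
proof (rule ccontr)
  assume "l \<noteq> l'"
  hence "p \<le> \<bar>l - l'\<bar>" using assms(3) by (intro zdvd_imp_le) auto
  thus False using assms(1,2) by auto
qed

text \<open>\<open>l\<close> is the quotient of \<open>?x\<close> by \<open>?y\<close> modulo
  \<open>p\<close>. If \<open>?y\<close> were zero modulo \<open>p\<close>, then so would be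
  \<open>?x\<close>, and properness would force \<open>v = 0\<close>.\<close>

lemma M_unique:
  assumes l: "l \<in> {1..<p}" "l' \<in> {1..<p}" and v: "v \<in> M l" "v \<in> M l'" "v \<in> lbox h 16" "v \<noteq> 0"
  shows "l = l'"
proof -
  let ?x = "a1 * v $ 1 + a2 * v $ 2" and ?y = "a1 * v $ 3 + a2 * v $ 4"
  have b: "\<bar>v $ 1\<bar> \<le> 16 * int H1" "\<bar>v $ 2\<bar> \<le> 16 * int H2" "\<bar>v $ 3\<bar> \<le> 16 * int H1" "\<bar>v $ 4\<bar> \<le> 16 * int H2"
    using lboxD[OF v(3), of 1] lboxD[OF v(3), of 2] lboxD[OF v(3), of 3] lboxD[OF v(3), of 4] by simp_all
  have d: "p dvd ?x - l * ?y" "p dvd ?x - l' * ?y" using v(1,2) by (simp_all add: M_def)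
  have ny: "\<not> p dvd ?y"
  proof
    assume y: "p dvd ?y"
    have "p dvd (?x - l * ?y) + l * ?y" by (rule dvd_add[OF d(1) dvd_mult[OF y]])
    hence "p dvd ?x" by simp
    hence "v $ 1 = 0 \<and> v $ 2 = 0" using proper b by blast
    moreover have "v $ 3 = 0 \<and> v $ 4 = 0" using proper b y by blast
    ultimately have "v $ i = 0" for i using exhaust_4[of i] by auto
    thus False using v(4) by (simp add: vec_eq_iff)
  qed
  have "p dvd (?x - l' * ?y) - (?x - l * ?y)" by (rule dvd_diff[OF d(2,1)])
  hence "p dvd ?y * (l - l')" by (simp add: algebra_simps)
  hence "p dvd l - l'" using dvd_cancel ny by blast
  thus ?thesis by (rule eq_if_dvd_diff[OF l])
qed

text \<open>The second conclusion bounds some side of the box \<open>B\<close> from below, so that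
  the \<open>+ 1\<close> in the count of integers along that side can be absorbed.\<close>

lemma count_vectors:
  assumes "X \<subseteq> {1..<p}" "\<And>l. l \<in> X \<Longrightarrow> \<exists>v\<in>M l \<inter> lbox h 16. v \<noteq> 0 \<and> v \<in> B" "finite B"
  shows "card X \<le> card B" "X \<noteq> {} \<Longrightarrow> \<exists>v\<in>B. v \<noteq> 0"
proof -
  obtain f where f: "\<And>l. l \<in> X \<Longrightarrow> f l \<in> M l \<inter> lbox h 16 \<and> f l \<noteq> 0 \<and> f l \<in> B"
    using assms(2) by metis
  have "inj_on f X"
  proof (rule inj_onI)
    fix l l' assume l: "l \<in> X" "l' \<in> X" "f l = f l'"
    show "l = l'"
    proof (rule M_unique)
      show "l \<in> {1..<p}" "l' \<in> {1..<p}" using l assms(1) by blast+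
      show "f l \<in> M l" "f l \<in> lbox h 16" "f l \<noteq> 0" using f[OF l(1)] by blast+
      show "f l \<in> M l'" using f[OF l(2)] l(3) by simp
    qed
  qed
  thus "card X \<le> card B" using f assms(3) by (intro card_inj_on_le) auto
  show "X \<noteq> {} \<Longrightarrow> \<exists>v\<in>B. v \<noteq> 0" using f by blast
qed

lemma lbox_nonzero:
  assumes "v \<in> lbox g t" "v \<noteq> 0"
  shows "\<exists>i. t * g i \<ge> 1"
proof -
  obtain i where "v $ i \<noteq> 0" using assms(2) by (auto simp: vec_eq_iff)
  hence "1 \<le> \<bar>v $ i\<bar>" by linarith
  hence "1 \<le> \<bar>real_of_int (v $ i)\<bar>" by linarith
  thus ?thesis using lboxD[OF assms(1), of i] by (intro exI[of _ i]) linarith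
qed

lemma card_lbox_4:
  assumes "\<And>i. t * g i \<ge> 0"
  shows "real (card (lbox g t :: (int ^ 4) set)) \<le>
    (2 * (t * g 1) + 1) * (2 * (t * g 2) + 1) * (2 * (t * g 3) + 1) * (2 * (t * g 4) + 1)"
  using card_lbox[of t g] assms unfolding UNIV_4 by (simp add: mult.assoc)

definition big_ratios :: "real \<Rightarrow> int set" where
  "big_ratios R = {l \<in> {1..<p}. card (M l \<inter> lbox h 1) \<ge> 2 \<and> real (card (M l \<inter> lbox h 1)) \<ge> R}"

text \<open>A nonzero vector forces \<open>64 / R * H2 >= 1\<close>, so each long side has at most
  \<open>192 / R * H2\<close> integers. The short sides may be below \<open>1\<close> and are only
  bounded by \<open>129 * H1\<close>; the two long ones already supply
  \<open>1 / R^2\<close>.\<close>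

lemma card_ratios_short_vector:
  assumes R: "R \<ge> 1" and X: "X \<subseteq> {1..<p}"
    and ex: "\<And>l. l \<in> X \<Longrightarrow> \<exists>v\<in>M l \<inter> lbox h 16. v \<noteq> 0 \<and> (\<forall>i. \<bar>coord v i\<bar> \<le> 64 * h i / R)"
  shows "real (card X) \<le> (129 * 192) ^ 2 * (N ^ 2 / R ^ 2)"
proof (cases "X = {}")
  case False
  define B :: "(int ^ 4) set" where "B = lbox h (64 / R)"
  have finB: "finite B" unfolding B_def using R hpos by simp
  have exB: "\<exists>v\<in>M l \<inter> lbox h 16. v \<noteq> 0 \<and> v \<in> B" if "l \<in> X" for l
    using ex[OF that] unfolding B_def lbox_def coord_def by auto
  have cv: "card X \<le> card B" "X \<noteq> {} \<Longrightarrow> \<exists>v\<in>B. v \<noteq> 0"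
    by (rule count_vectors[OF X _ finB], rule exB, assumption+)+
  obtain i where "64 / R * h i \<ge> 1" using cv(2)[OF False] lbox_nonzero unfolding B_def by blast
  moreover have "64 / R * h i \<le> 64 / R * H2" unfolding h_def using R H by (intro mult_left_mono) auto
  ultimately have s: "64 / R * H2 \<ge> 1" by linarith
  have s1: "64 / R * H1 \<le> 64 * H1" "0 \<le> 64 / R * H1" using R mult_right_mono[of 1 R "real H1"] by (simp_all add: pos_divide_le_eq mult.commute)
  have "real (card B) \<le> (2 * (64 / R * H1) + 1) * (2 * (64 / R * H2) + 1) * (2 * (64 / R * H1) + 1) * (2 * (64 / R * H2) + 1)"
    using card_lbox_4[of "64 / R" h] R hpos unfolding B_def by simp
  also have "\<dots> = ((2 * (64 / R * H1) + 1) * (2 * (64 / R * H2) + 1)) ^ 2" by (simp add: power2_eq_square)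
  also have "\<dots> \<le> (129 * H1 * (192 / R * H2)) ^ 2"
  proof (rule power_mono)
    have "2 * (64 / R * H1) + 1 \<le> 129 * real H1" using s1 H by linarith
    moreover have "2 * (64 / R * H2) + 1 \<le> 192 / R * H2" using s by simp
    ultimately show "(2 * (64 / R * H1) + 1) * (2 * (64 / R * H2) + 1) \<le> 129 * H1 * (192 / R * H2)"
      using s by (intro mult_mono) auto
    show "0 \<le> (2 * (64 / R * H1) + 1) * (2 * (64 / R * H2) + 1)" using s s1 by simp
  qed
  also have "\<dots> = (129 * 192) ^ 2 * (N ^ 2 / R ^ 2)" unfolding N_def by (simp add: power_mult_distrib power_divide)
  finally show ?thesis using cv(1) by linarith
qed simp

text \<open>\<open>R <= 9 * H1 ^ 2\<close> gives \<open>3 * H1 / sqrt R >= 1\<close>, so all four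
  sides absorb their \<open>+ 1\<close>, with constant \<open>27 = 2 * 12 + 3\<close>, and each
  contributes \<open>1 / sqrt R\<close>.\<close>

lemma card_ratios_plane:
  assumes R: "R \<ge> 1" "R \<le> 9 * real H1 ^ 2" and X: "X \<subseteq> {1..<p}"
    and ex: "\<And>l. l \<in> X \<Longrightarrow> \<exists>v\<in>M l \<inter> lbox h 16. v \<noteq> 0 \<and> (\<forall>i. \<bar>coord v i\<bar> \<le> 12 * h i / sqrt R)"
  shows "real (card X) \<le> 27 ^ 4 * (N ^ 2 / R ^ 2)"
proof -
  define B :: "(int ^ 4) set" where "B = lbox h (12 / sqrt R)"
  have sR: "sqrt R > 0" using R by simp
  have finB: "finite B" unfolding B_def using sR hpos by simp
  have exB: "\<exists>v\<in>M l \<inter> lbox h 16. v \<noteq> 0 \<and> v \<in> B" if "l \<in> X" for l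
    using ex[OF that] unfolding B_def lbox_def coord_def by auto
  have cv: "card X \<le> card B" "X \<noteq> {} \<Longrightarrow> \<exists>v\<in>B. v \<noteq> 0"
    by (rule count_vectors[OF X _ finB], rule exB, assumption+)+
  have "sqrt R \<le> 3 * H1" by (rule real_le_lsqrt) (use R in \<open>auto simp: power_mult_distrib\<close>)
  hence s: "1 \<le> 3 * H1 / sqrt R" using sR by (simp add: pos_le_divide_eq)
  moreover have "3 * real H1 / sqrt R \<le> 3 * H2 / sqrt R" using sR H by (intro divide_right_mono) auto
  ultimately have s': "1 \<le> 3 * H2 / sqrt R" by linarith
  have "real (card B) \<le> (2 * (12 / sqrt R * H1) + 1) * (2 * (12 / sqrt R * H2) + 1) * (2 * (12 / sqrt R * H1) + 1) * (2 * (12 / sqrt R * H2) + 1)"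
    using card_lbox_4[of "12 / sqrt R" h] sR hpos unfolding B_def by simp
  also have "\<dots> = ((2 * (12 / sqrt R * H1) + 1) * (2 * (12 / sqrt R * H2) + 1)) ^ 2" by (simp add: power2_eq_square)
  also have "\<dots> \<le> ((27 * H1 / sqrt R) * (27 * H2 / sqrt R)) ^ 2"
  proof -
    have e: "12 / sqrt R * x = 4 * (3 * x / sqrt R)" "27 * x / sqrt R = 9 * (3 * x / sqrt R)" for x by simp_all
    have "2 * (12 / sqrt R * H1) + 1 \<le> 27 * H1 / sqrt R" "2 * (12 / sqrt R * H2) + 1 \<le> 27 * H2 / sqrt R"
      unfolding e using s s' by linarith+
    thus ?thesis using sR by (intro power_mono mult_mono) auto
  qed
  also have "\<dots> = 27 ^ 4 * (N ^ 2 / R ^ 2)"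
    unfolding N_def using R by (simp add: power_mult_distrib power_divide field_simps)
  finally show ?thesis using cv(1) by linarith
qed

text \<open>Only coordinates 2 and 4 vary, each contributing \<open>1 / R\<close>;
  \<open>576 = 2 * 192 + 192\<close>, the last part absorbing the \<open>+ 1\<close>.\<close>

lemma card_ratios_kernel:
  assumes R: "R \<ge> 1" and X: "X \<subseteq> {1..<p}"
    and ex: "\<And>l. l \<in> X \<Longrightarrow> \<exists>v\<in>M l \<inter> lbox h 16. v \<noteq> 0 \<and> v $ 1 = 0 \<and> v $ 3 = 0 \<and>
     \<bar>coord v 2\<bar> \<le> 192 * N / R \<and> \<bar>coord v 4\<bar> \<le> 192 * N / R"
  shows "real (card X) \<le> 576 ^ 2 * (N ^ 2 / R ^ 2)"
proof (cases "X = {}")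
  case False
  define g :: "4 \<Rightarrow> real" where "g i = (if i = 1 \<or> i = 3 then 0 else 192 * N / R)" for i
  define B :: "(int ^ 4) set" where "B = lbox g 1"
  have gs: "g 1 = 0" "g 3 = 0" "g 2 = 192 * N / R" "g 4 = 192 * N / R" by (simp_all add: g_def)
  have g: "1 * g i \<ge> 0" for i unfolding g_def using R N1 by simp
  have finB: "finite B" unfolding B_def using g by (rule finite_lbox)
  have exB: "\<exists>v\<in>M l \<inter> lbox h 16. v \<noteq> 0 \<and> v \<in> B" if "l \<in> X" for l
    using ex[OF that] unfolding B_def lbox_def coord_def forall_4 gs by auto
  have cv: "card X \<le> card B" "X \<noteq> {} \<Longrightarrow> \<exists>v\<in>B. v \<noteq> 0"
    by (rule count_vectors[OF X _ finB], rule exB, assumption+)+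
  obtain i where "1 * g i \<ge> 1" using cv(2)[OF False] lbox_nonzero unfolding B_def by blast
  hence s: "192 * N / R \<ge> 1" unfolding g_def by (auto split: if_splits)
  have "real (card B) \<le> (2 * (192 * N / R) + 1) ^ 2"
    using card_lbox_4[of 1 g, OF g] unfolding gs B_def by (simp add: power2_eq_square)
  also have "\<dots> \<le> (576 * N / R) ^ 2" using s by (intro power_mono) auto
  also have "\<dots> = 576 ^ 2 * (N ^ 2 / R ^ 2)" by (simp add: power_mult_distrib power_divide)
  finally show ?thesis using cv(1) by linarith
qed simp

text \<open>Here \<open>l\<close> is read off from two vectors of \<open>L\<close> with
  \<open>v = - l u\<close> modulo \<open>p\<close> and \<open>u\<close> nonzero modulo
  \<open>p\<close>. The lower bound on \<open>R * p\<close> says \<open>B * N <= p\<close>, so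
  \<open>card_L_le\<close> applies with \<open>k = 1\<close> and each of the two vectors has
  \<open>O(N / R)\<close> choices.\<close>

lemma card_ratios_dual:
  assumes R: "R \<ge> 1" "196608 * N ^ 2 \<le> R * real_of_int p" and X: "X \<subseteq> {1..<p}"
    and ex: "\<And>l. l \<in> X \<Longrightarrow> \<exists>w1 w2 w3 w4 :: int. \<not> (p dvd w1 \<and> p dvd w2) \<and> p dvd a1 * w2 - a2 * w1 \<and>
     p dvd a1 * w4 - a2 * w3 \<and> p dvd w3 + l * w1 \<and> p dvd w4 + l * w2 \<and>
     \<bar>real_of_int w1\<bar> \<le> 196608 * N * H2 / R \<and> \<bar>real_of_int w2\<bar> \<le> 196608 * N * H1 / R \<and>
     \<bar>real_of_int w3\<bar> \<le> 196608 * N * H2 / R \<and> \<bar>real_of_int w4\<bar> \<le> 196608 * N * H1 / R"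
  shows "real (card X) \<le> (256 * 196608) ^ 2 * (N ^ 2 / R ^ 2)"
proof (cases "X = {}")
  case False
  define B where "B = 196608 * N / R"
  have B: "B > 0" unfolding B_def using N1 R by simp
  define T where "T = L \<inter> lbox h' B"
  have finT: "finite T" unfolding T_def using B hpos' by simp
  define vec :: "int \<Rightarrow> int \<Rightarrow> int ^ 2" where "vec x y = (\<chi> i. if i = 1 then x else y)" for x y
  have vec [simp]: "vec x y $ 1 = x" "vec x y $ 2 = y" for x y by (simp_all add: vec_def)
  have vT: "vec x y \<in> T" if "p dvd a1 * y - a2 * x" "\<bar>real_of_int x\<bar> \<le> 196608 * N * H2 / R"
    "\<bar>real_of_int y\<bar> \<le> 196608 * N * H1 / R" for x y
    unfolding T_def L_def lbox_def using that by (simp add: forall_2 h'_def B_def)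
  have "\<exists>f. \<forall>l\<in>X. (case f l of (u, v) \<Rightarrow> u \<in> T \<and> v \<in> T \<and> \<not> (p dvd u $ 1 \<and> p dvd u $ 2) \<and>
     p dvd v $ 1 + l * u $ 1 \<and> p dvd v $ 2 + l * u $ 2)"
  proof (rule bchoice, rule ballI)
    fix l assume "l \<in> X"
    then obtain w1 w2 w3 w4 where "\<not> (p dvd w1 \<and> p dvd w2)" "p dvd a1 * w2 - a2 * w1"
     "p dvd a1 * w4 - a2 * w3" "p dvd w3 + l * w1" "p dvd w4 + l * w2"
     "\<bar>real_of_int w1\<bar> \<le> 196608 * N * H2 / R" "\<bar>real_of_int w2\<bar> \<le> 196608 * N * H1 / R"
     "\<bar>real_of_int w3\<bar> \<le> 196608 * N * H2 / R" "\<bar>real_of_int w4\<bar> \<le> 196608 * N * H1 / R"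
      using ex by blast
    thus "\<exists>z. case z of (u, v) \<Rightarrow> u \<in> T \<and> v \<in> T \<and> \<not> (p dvd u $ 1 \<and> p dvd u $ 2) \<and>
     p dvd v $ 1 + l * u $ 1 \<and> p dvd v $ 2 + l * u $ 2"
      using vT by (intro exI[of _ "(vec w1 w2, vec w3 w4)"]) simp
  qed
  then obtain f where f0: "\<forall>l\<in>X. (case f l of (u, v) \<Rightarrow> u \<in> T \<and> v \<in> T \<and> \<not> (p dvd u $ 1 \<and> p dvd u $ 2) \<and>
     p dvd v $ 1 + l * u $ 1 \<and> p dvd v $ 2 + l * u $ 2)" ..
  have f: "u \<in> T \<and> v \<in> T \<and> \<not> (p dvd u $ 1 \<and> p dvd u $ 2) \<and>
     p dvd v $ 1 + l * u $ 1 \<and> p dvd v $ 2 + l * u $ 2" if "l \<in> X" "f l = (u, v)" for l u v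
    using bspec[OF f0 that(1)] that(2) by simp
  have "inj_on f X"
  proof (rule inj_onI)
    fix l l' assume l: "l \<in> X" "l' \<in> X" "f l = f l'"
    obtain u v where uv: "f l = (u, v)" by (cases "f l")
    have 1: "\<not> (p dvd u $ 1 \<and> p dvd u $ 2)" "p dvd v $ 1 + l * u $ 1" "p dvd v $ 2 + l * u $ 2"
      "p dvd v $ 1 + l' * u $ 1" "p dvd v $ 2 + l' * u $ 2"
      using f[OF l(1) uv] f[OF l(2), of u v] uv l(3) by auto
    have "p dvd (v $ 1 + l * u $ 1) - (v $ 1 + l' * u $ 1)" "p dvd (v $ 2 + l * u $ 2) - (v $ 2 + l' * u $ 2)"
      by (rule dvd_diff[OF 1(2,4)], rule dvd_diff[OF 1(3,5)])
    hence "p dvd u $ 1 * (l - l')" "p dvd u $ 2 * (l - l')" by (simp_all add: algebra_simps)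
    hence "p dvd l - l'" using dvd_cancel 1(1) by blast
    thus "l = l'" using eq_if_dvd_diff l X by blast
  qed
  hence "card X \<le> card (T \<times> T)"
  proof (rule card_inj_on_le)
    show "f ` X \<subseteq> T \<times> T"
    proof
      fix z assume "z \<in> f ` X"
      then obtain l where l: "l \<in> X" "z = f l" by blast
      obtain u v where uv: "f l = (u, v)" by (cases "f l")
      show "z \<in> T \<times> T" using f[OF l(1) uv] l uv by simp
    qed
  qed (use finT in simp)
  hence cX: "real (card X) \<le> real (card T) ^ 2"
    by (metis card_cartesian_product of_nat_le_iff of_nat_mult power2_eq_square)
  have BN: "B * N \<le> real_of_int p" using R unfolding B_def by (simp add: power2_eq_square field_simps)
  obtain l where "l \<in> X" using False by blast
  moreover obtain u v where "f l = (u, v)" by (cases "f l")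
  ultimately have "u \<in> T" "\<not> (p dvd u $ 1 \<and> p dvd u $ 2)" using f by blast+
  hence "u \<in> T" "u \<noteq> 0" by auto
  hence "\<exists>w\<in>L \<inter> lbox h' B. w \<noteq> 0" unfolding T_def by blast
  hence "real (card T) \<le> 256 * B" using card_L_le[OF B, of 1] BN unfolding T_def by simp
  hence "real (card T) ^ 2 \<le> (256 * B) ^ 2" by (intro power_mono) auto
  also have "\<dots> = (256 * 196608) ^ 2 * (N ^ 2 / R ^ 2)" unfolding B_def by (simp add: power_mult_distrib power_divide)
  finally show ?thesis using cX by linarith
qed simp

lemma big_ratios_card:
  assumes R: "R \<ge> 1" "6291456 * N ^ 2 < R * real_of_int p"
  shows "real (card (big_ratios R)) \<le> 10 ^ 16 * (N ^ 2 / R ^ 2)"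
proof -
  let ?n = "\<lambda>l. card (M l \<inter> lbox h 1)"
  define X1 where "X1 = {l \<in> big_ratios R. \<exists>v\<in>M l \<inter> lbox h 16. v \<noteq> 0 \<and> (\<forall>i. \<bar>coord v i\<bar> \<le> 64 * h i / R)}"
  define X2 where "X2 = {l \<in> big_ratios R. R \<le> 9 * real H1 ^ 2 \<and> (\<exists>v\<in>M l \<inter> lbox h 16. v \<noteq> 0 \<and> (\<forall>i. \<bar>coord v i\<bar> \<le> 12 * h i / sqrt R))}"
  define X3 where "X3 = {l \<in> big_ratios R. \<exists>v\<in>M l \<inter> lbox h 16. v \<noteq> 0 \<and> v $ 1 = 0 \<and> v $ 3 = 0 \<and>
     \<bar>coord v 2\<bar> \<le> 192 * N / R \<and> \<bar>coord v 4\<bar> \<le> 192 * N / R}"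
  define X4 where "X4 = {l \<in> big_ratios R. \<exists>w1 w2 w3 w4 :: int. \<not> (p dvd w1 \<and> p dvd w2) \<and> p dvd a1 * w2 - a2 * w1 \<and>
     p dvd a1 * w4 - a2 * w3 \<and> p dvd w3 + l * w1 \<and> p dvd w4 + l * w2 \<and>
     \<bar>real_of_int w1\<bar> \<le> 196608 * N * H2 / R \<and> \<bar>real_of_int w2\<bar> \<le> 196608 * N * H1 / R \<and>
     \<bar>real_of_int w3\<bar> \<le> 196608 * N * H2 / R \<and> \<bar>real_of_int w4\<bar> \<le> 196608 * N * H1 / R}"
  have sub: "big_ratios R \<subseteq> {1..<p}" unfolding big_ratios_def by blast
  have fin: "finite (big_ratios R)" using sub finite_subset by blast
  have "big_ratios R \<subseteq> X1 \<union> X2 \<union> X3 \<union> X4"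
  proof
    fix l assume l: "l \<in> big_ratios R"
    have n: "?n l \<ge> 2" "real (?n l) \<ge> R" and lp: "\<not> p dvd l"
      using l zdvd_not_zless[of l p] unfolding big_ratios_def by auto
    have "R * real_of_int p \<le> ?n l * real_of_int p" using n p0 by (intro mult_right_mono) auto
    hence big: "6291456 * N ^ 2 < ?n l * real_of_int p" using R by linarith
    have dR: "y \<le> x / real (?n l) \<Longrightarrow> x \<ge> 0 \<Longrightarrow> y \<le> x / R" for x y
    proof -
      assume "y \<le> x / real (?n l)" "x \<ge> 0"
      moreover have "x / real (?n l) \<le> x / R" using n R \<open>x \<ge> 0\<close> by (intro divide_left_mono) auto
      ultimately show ?thesis by linarith
    qed
    have sq: "y \<le> x / sqrt (real (?n l)) \<Longrightarrow> x \<ge> 0 \<Longrightarrow> y \<le> x / sqrt R" for x y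
    proof -
      assume "y \<le> x / sqrt (real (?n l))" "x \<ge> 0"
      moreover have "x / sqrt (real (?n l)) \<le> x / sqrt R"
        using n R \<open>x \<ge> 0\<close> by (intro divide_left_mono) auto
      ultimately show ?thesis by linarith
    qed
    have nn: "0 \<le> 64 * h i" "0 \<le> 12 * h i" "0 \<le> 192 * N" "0 \<le> 196608 * N * H2" "0 \<le> 196608 * N * H1" for i
      using hpos N1 by simp_all
    consider (1) "\<exists>v\<in>M l \<inter> lbox h 16. v \<noteq> 0 \<and> (\<forall>i. \<bar>coord v i\<bar> \<le> 64 * h i / ?n l)"
      | (2) "?n l \<le> 9 * H1 ^ 2" "\<exists>v\<in>M l \<inter> lbox h 16. v \<noteq> 0 \<and> (\<forall>i. \<bar>coord v i\<bar> \<le> 12 * h i / sqrt (?n l))"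
      | (3) "\<exists>v\<in>M l \<inter> lbox h 16. v \<noteq> 0 \<and> v $ 1 = 0 \<and> v $ 3 = 0 \<and>
           \<bar>coord v 2\<bar> \<le> 192 * N / ?n l \<and> \<bar>coord v 4\<bar> \<le> 192 * N / ?n l"
      | (4) "\<exists>w1 w2 w3 w4 :: int. \<not> (p dvd w1 \<and> p dvd w2) \<and> p dvd a1 * w2 - a2 * w1 \<and>
         p dvd a1 * w4 - a2 * w3 \<and> p dvd w3 + l * w1 \<and> p dvd w4 + l * w2 \<and>
         \<bar>real_of_int w1\<bar> \<le> 196608 * N * H2 / ?n l \<and> \<bar>real_of_int w2\<bar> \<le> 196608 * N * H1 / ?n l \<and>
         \<bar>real_of_int w3\<bar> \<le> 196608 * N * H2 / ?n l \<and> \<bar>real_of_int w4\<bar> \<le> 196608 * N * H1 / ?n l"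
      using many_points_imp_small_vector[OF lp refl n(1) big] by blast
    thus "l \<in> X1 \<union> X2 \<union> X3 \<union> X4"
    proof cases
      case 1
      hence "l \<in> X1" unfolding X1_def using l dR nn(1) by blast
      thus ?thesis by blast
    next
      case 2
      have "real (?n l) \<le> real (9 * H1 ^ 2)" using 2(1) by (simp only: of_nat_le_iff)
      hence "R \<le> 9 * real H1 ^ 2" using n by simp
      hence "l \<in> X2" unfolding X2_def using l 2(2) sq nn(2) by blast
      thus ?thesis by blast
    next
      case 3
      hence "l \<in> X3" unfolding X3_def using l dR nn(3) by blast
      thus ?thesis by blast
    next
      case 4
      hence "l \<in> X4" unfolding X4_def using l dR nn(4,5) by blast
      thus ?thesis by blast
    qed
  qed
  hence "card (big_ratios R) \<le> card (X1 \<union> X2 \<union> X3 \<union> X4)"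
    using fin by (intro card_mono) (auto simp: X1_def X2_def X3_def X4_def)
  also have "\<dots> \<le> card X1 + card X2 + card X3 + card X4"
    by (meson add_le_mono card_Un_le order_refl order_trans)
  finally have "real (card (big_ratios R)) \<le> real (card X1) + real (card X2) + real (card X3) + real (card X4)" by simp
  also have "\<dots> \<le> (129 * 192) ^ 2 * (N ^ 2 / R ^ 2) + 27 ^ 4 * (N ^ 2 / R ^ 2)
      + 576 ^ 2 * (N ^ 2 / R ^ 2) + (256 * 196608) ^ 2 * (N ^ 2 / R ^ 2)"
  proof (intro add_mono)
    show "real (card X1) \<le> (129 * 192) ^ 2 * (N ^ 2 / R ^ 2)"
      by (rule card_ratios_short_vector[OF R(1)]) (use sub in \<open>auto simp: X1_def\<close>)
    show "real (card X2) \<le> 27 ^ 4 * (N ^ 2 / R ^ 2)"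
    proof (cases "X2 = {}")
      case False
      hence "R \<le> 9 * real H1 ^ 2" unfolding X2_def by blast
      thus ?thesis by (rule card_ratios_plane[OF R(1)]) (use sub in \<open>auto simp: X2_def\<close>)
    qed simp
    show "real (card X3) \<le> 576 ^ 2 * (N ^ 2 / R ^ 2)"
      by (rule card_ratios_kernel[OF R(1)]) (use sub in \<open>auto simp: X3_def\<close>)
    have "N ^ 2 \<ge> 0" by simp
    hence "196608 * N ^ 2 \<le> R * real_of_int p" using R by linarith
    thus "real (card X4) \<le> (256 * 196608) ^ 2 * (N ^ 2 / R ^ 2)"
      by (rule card_ratios_dual[OF R(1)]) (use sub in \<open>auto simp: X4_def\<close>)
  qed
  also have "\<dots> = ((129 * 192) ^ 2 + 27 ^ 4 + 576 ^ 2 + (256 * 196608) ^ 2) * (N ^ 2 / R ^ 2)"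
    by (simp only: distrib_right)
  \<comment> \<open>The dual term dominates: \<open>(256 * 196608) ^ 2\<close> is about
    \<open>2.5 * 10^15\<close>.\<close>
  also have "\<dots> \<le> 10 ^ 16 * (N ^ 2 / R ^ 2)" by (intro mult_right_mono) auto
  finally show ?thesis .
qed

end

section \<open>Multiplicative energy\<close>

lemma harm_le: "n \<ge> 1 \<Longrightarrow> harm n \<le> 1 + ln (real n)"
proof -
  assume "n \<ge> 1"
  then obtain m where m: "n = Suc m" by (cases n) auto
  have "harm (Suc m) - ln (real (Suc m)) \<le> harm (Suc 0) - ln (real (Suc 0))"
    using decseqD[OF decseq_harm_diff_ln, of 0 m] by simp
  thus ?thesis unfolding m by (simp add: harm_def)
qed

text \<open>Summation by layers: \<open>n^2\<close> is at most the sum of \<open>2 * R\<close> over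
  \<open>R <= n\<close>, and after exchanging sums the layer \<open>R\<close> contributes at most
  \<open>2 * R * K / R^2\<close>.\<close>

lemma sum_squares_layers:
  fixes f :: "'a \<Rightarrow> nat" and K :: real
  assumes G: "finite G" and m: "\<And>l. l \<in> G \<Longrightarrow> f l \<le> m"
    and K: "\<And>R. R \<in> {1..m} \<Longrightarrow> real (card {l \<in> G. R \<le> f l}) \<le> K / real R ^ 2"
  shows "(\<Sum>l\<in>G. real (f l) ^ 2) \<le> 2 * K * harm m"
proof -
  have "real n ^ 2 \<le> (\<Sum>R\<in>{1..n}. 2 * real R)" for n
    by (induction n) (simp_all add: power2_eq_square algebra_simps)
  hence "(\<Sum>l\<in>G. real (f l) ^ 2) \<le> (\<Sum>l\<in>G. \<Sum>R\<in>{1..f l}. 2 * real R)" by (intro sum_mono)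
  also have "\<dots> = (\<Sum>l\<in>G. \<Sum>R\<in>{R \<in> {1..m}. R \<le> f l}. 2 * real R)"
    using m by (intro sum.cong) (force)+
  also have "\<dots> = (\<Sum>R\<in>{1..m}. \<Sum>l\<in>{l \<in> G. R \<le> f l}. 2 * real R)"
    using G by (intro sum.swap_restrict) auto
  also have "\<dots> = (\<Sum>R\<in>{1..m}. 2 * real R * card {l \<in> G. R \<le> f l})" by (simp add: mult.commute)
  also have "\<dots> \<le> (\<Sum>R\<in>{1..m}. 2 * K * inverse (real R))"
  proof (rule sum_mono)
    fix R assume R: "R \<in> {1..m}"
    have "2 * real R * card {l \<in> G. R \<le> f l} \<le> 2 * real R * (K / real R ^ 2)"
      using K[OF R] by (intro mult_left_mono) auto
    also have "\<dots> = 2 * K * inverse (real R)" using R by (simp add: power2_eq_square field_simps)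
    finally show "2 * real R * card {l \<in> G. R \<le> f l} \<le> 2 * K * inverse (real R)" .
  qed
  also have "\<dots> = 2 * K * harm m" unfolding harm_def sum_distrib_left by simp
  finally show ?thesis .
qed

lemma finite_ratio_pairs: "finite A \<Longrightarrow> finite {(a, c). a \<in> A \<and> c \<in> A \<and> P a c}"
  by (rule finite_subset[of _ "A \<times> A"]) auto

lemma dvd_diff_imp_eq:
  fixes a b p :: int
  assumes "a \<in> {0..<p}" "b \<in> {0..<p}" "p dvd a - b"
  shows "a = b"
proof (rule ccontr)
  assume "a \<noteq> b"
  hence "p \<le> \<bar>a - b\<bar>" using assms(3) by (intro zdvd_imp_le) auto
  thus False using assms(1,2) by auto
qed

text \<open>A pair whose second entry is invertible has at most one ratio \<open>l\<close> in the
  range.\<close>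

lemma sum_ratio_count_le:
  assumes p: "prime (p :: int)" and A: "finite A"
  shows "(\<Sum>l\<in>{1..<p}. ratio_count p A l) \<le> card A ^ 2"
proof -
  let ?P = "\<lambda>l. {(a, c). a \<in> A \<and> c \<in> A \<and> \<not> p dvd c \<and> p dvd a - l * c}"
  have disj: "?P l \<inter> ?P l' = {}" if "l \<in> {1..<p}" "l' \<in> {1..<p}" "l \<noteq> l'" for l l'
  proof (rule ccontr)
    assume "?P l \<inter> ?P l' \<noteq> {}"
    then obtain a c where ac: "\<not> p dvd c" "p dvd a - l * c" "p dvd a - l' * c" by blast
    have "p dvd (a - l' * c) - (a - l * c)" by (rule dvd_diff[OF ac(3,2)])
    hence "p dvd (l - l') * c" by (simp add: algebra_simps)
    hence "p dvd l - l'" using ac(1) p by (simp add: prime_dvd_mult_iff)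
    thus False using dvd_diff_imp_eq[of l p l'] that by auto
  qed
  have "(\<Sum>l\<in>{1..<p}. ratio_count p A l) = card (\<Union>l\<in>{1..<p}. ?P l)"
    unfolding ratio_count_def
    by (rule card_UN_disjoint[symmetric]) (use disj finite_ratio_pairs[OF A] in auto)
  also have "\<dots> \<le> card (A \<times> A)" using A by (intro card_mono) auto
  finally show ?thesis by (simp add: card_cartesian_product power2_eq_square)
qed

lemma ratio_count_le_card:
  assumes A: "A \<subseteq> {0..<p}"
  shows "ratio_count p A l \<le> card A"
  unfolding ratio_count_def
proof (rule card_inj_on_le[of snd])
  show "inj_on snd {(a, c). a \<in> A \<and> c \<in> A \<and> \<not> p dvd c \<and> p dvd a - l * c}"
  proof (rule inj_onI, clarify)
    fix a c a' c' assume a: "a \<in> A" "a' \<in> A" "p dvd a - l * c" "p dvd a' - l * c'" "snd (a, c) = snd (a', c')"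
    have "p dvd (a - l * c) - (a' - l * c')" by (rule dvd_diff[OF a(3,4)])
    hence "p dvd a - a'" using a(5) by simp
    moreover have "a \<in> {0..<p}" "a' \<in> {0..<p}" using a(1,2) A by blast+
    ultimately show "a = a' \<and> c = c'" using a(5) dvd_diff_imp_eq[of a p a'] by simp
  qed
  show "finite A" using A finite_subset by blast
qed auto

section \<open>From lattice points to squared ratio counts\<close>

context proper_gap
begin

text \<open>Subtracting one fixed pair \<open>(a', c')\<close> with the same ratio removes the shift
  \<open>a0\<close>, and the differences of parameters satisfy the homogeneous relation of
  \<open>M l\<close>.\<close>

lemma ratio_count_le_lattice:
  assumes A: "A \<subseteq> (\<lambda>(x, y). (a0 + x * a1 + y * a2) mod p) ` ({1..int H1} \<times> {1..int H2})"
  shows "ratio_count p A l \<le> card (M l \<inter> lbox h 1)"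
proof -
  let ?P = "{(a, c). a \<in> A \<and> c \<in> A \<and> \<not> p dvd c \<and> p dvd a - l * c}"
  show ?thesis
  proof (cases "?P = {}")
    case True thus ?thesis unfolding ratio_count_def by (simp only: card.empty)
  next
    case False
    then obtain a' c' where ac': "a' \<in> A" "c' \<in> A" "p dvd a' - l * c'" by blast
    have "\<forall>a\<in>A. \<exists>x y. x \<in> {1..int H1} \<and> y \<in> {1..int H2} \<and> a = (a0 + x * a1 + y * a2) mod p"
      using A by force
    then obtain X Y where XY: "\<And>a. a \<in> A \<Longrightarrow> X a \<in> {1..int H1}" "\<And>a. a \<in> A \<Longrightarrow> Y a \<in> {1..int H2}"
      "\<And>a. a \<in> A \<Longrightarrow> a = (a0 + X a * a1 + Y a * a2) mod p" by metis
    define f :: "int \<times> int \<Rightarrow> int ^ 4" where "f = (\<lambda>(a, c). \<chi> i. if i = 1 then X a - X a' else if i = 2 then Y a - Y a'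
      else if i = 3 then X c - X c' else Y c - Y c')"
    have fs: "f (a, c) $ 1 = X a - X a'" "f (a, c) $ 2 = Y a - Y a'" "f (a, c) $ 3 = X c - X c'"
      "f (a, c) $ 4 = Y c - Y c'" for a c by (simp_all add: f_def)
    have dv: "p dvd a1 * (X a - X b) + a2 * (Y a - Y b) - (a - b)" if "a \<in> A" "b \<in> A" for a b
    proof -
      have m: "p dvd (a0 + X a * a1 + Y a * a2) - a" if "a \<in> A" for a
        using XY(3)[OF that] by (metis dvd_minus_mod)
      have "p dvd ((a0 + X a * a1 + Y a * a2) - a) - ((a0 + X b * a1 + Y b * a2) - b)"
        by (rule dvd_diff[OF m[OF that(1)] m[OF that(2)]])
      thus ?thesis by (simp add: algebra_simps)
    qed
    have "inj_on f ?P"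
    proof (rule inj_onI, clarify)
      fix a c b d assume a: "a \<in> A" "c \<in> A" "b \<in> A" "d \<in> A" "f (a, c) = f (b, d)"
      have "X a = X b" "Y a = Y b" "X c = X d" "Y c = Y d"
        using fs[of a c] fs[of b d] a(5) by simp_all
      thus "a = b \<and> c = d" using XY(3) a(1-4) by metis
    qed
    moreover have "f ` ?P \<subseteq> M l \<inter> lbox h 1"
    proof clarify
      fix a c assume a: "a \<in> A" "c \<in> A" "p dvd a - l * c"
      have "p dvd (a1 * (X a - X a') + a2 * (Y a - Y a') - (a - a'))
        - l * (a1 * (X c - X c') + a2 * (Y c - Y c') - (c - c')) + ((a - l * c) - (a' - l * c'))"
        by (rule dvd_add[OF dvd_diff[OF dv[OF a(1) ac'(1)] dvd_mult[OF dv[OF a(2) ac'(2)]]] dvd_diff[OF a(3) ac'(3)]])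
      hence "f (a, c) \<in> M l" unfolding M_def mem_Collect_eq fs by (simp add: algebra_simps)
      moreover have "\<bar>x - y\<bar> \<le> int n" if "x \<in> {1..int n}" "y \<in> {1..int n}" for x y n using that by auto
      hence "\<bar>real_of_int (x - y)\<bar> \<le> real n" if "x \<in> {1..int n}" "y \<in> {1..int n}" for x y n
        using that by (metis of_int_abs of_int_le_iff of_int_of_nat_eq)
      hence "f (a, c) \<in> lbox h 1"
        unfolding lbox_def mem_Collect_eq forall_4 fs h_simps mult_1 using XY(1,2) a(1,2) ac'(1,2) by blast
      ultimately show "f (a, c) \<in> M l \<inter> lbox h 1" by blast
    qed
    ultimately show ?thesis unfolding ratio_count_def using hpos by (intro card_inj_on_le) auto
  qed
qed

lemma H2_less: "16 * int H2 < p"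
proof (rule ccontr)
  assume "\<not> ?thesis"
  hence "0 = (0::int) \<and> p = 0" using p0 by (intro proper) auto
  thus False using p0 by simp
qed

text \<open>Only the length of the harmonic sum is at stake, so any fixed power of \<open>p\<close>
  would do.\<close>

lemma lattice_card_le: "card (M l \<inter> lbox h 1) \<le> nat p ^ 4"
proof -
  have "card (M l \<inter> lbox h 1) \<le> card (lbox h 1)" using hpos by (intro card_mono) auto
  hence "real (card (M l \<inter> lbox h 1)) \<le> (2 * real H1 + 1) * (2 * real H2 + 1) * (2 * real H1 + 1) * (2 * real H2 + 1)"
    using card_lbox_4[of 1 h] hpos by simp
  also have "\<dots> \<le> real_of_int p * p * p * p"
  proof -
    have "2 * int H1 + 1 \<le> p" "2 * int H2 + 1 \<le> p" using H2_less H by linarith+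
    hence "real_of_int (2 * int H1 + 1) \<le> p" "real_of_int (2 * int H2 + 1) \<le> p" by (simp_all only: of_int_le_iff)
    hence "2 * real H1 + 1 \<le> p" "2 * real H2 + 1 \<le> p" by simp_all
    thus ?thesis using p0 by (intro mult_mono) auto
  qed
  also have "\<dots> = real (nat p ^ 4)" using p0 by (simp add: power4_eq_xxxx)
  finally show ?thesis by (simp only: of_nat_le_iff)
qed

lemma sum_ratio_count_sq:
  assumes A: "A \<subseteq> (\<lambda>(x, y). (a0 + x * a1 + y * a2) mod p) ` ({1..int H1} \<times> {1..int H2})"
  shows "(\<Sum>l\<in>{1..<p}. real (ratio_count p A l) ^ 2) \<le> 10 ^ 18 * (N ^ 2 + N ^ 4 / p) * ln p"
proof -
  let ?n = "\<lambda>l. card (M l \<inter> lbox h 1)"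
  let ?r = "ratio_count p A"
  have finA: "finite A" using A finite_subset by blast
  have cA: "real (card A) \<le> N"
  proof -
    have "card A \<le> card ({1..int H1} \<times> {1..int H2})" using A by (intro surj_card_le) auto
    also have "\<dots> = H1 * H2" by (simp add: card_cartesian_product)
    finally show ?thesis unfolding N_def by (metis of_nat_le_iff of_nat_mult)
  qed
  have "real (\<Sum>l\<in>{1..<p}. ?r l) \<le> real (card A ^ 2)"
    using sum_ratio_count_le[OF p finA] by (simp only: of_nat_le_iff)
  also have "\<dots> \<le> N ^ 2" using cA by (simp add: power_mono)
  finally have sr: "(\<Sum>l\<in>{1..<p}. real (?r l)) \<le> N ^ 2" by simp
  \<comment> \<open>Twice the threshold of \<open>big_ratios_card\<close>, whose inequality is
    strict.\<close>
  define t where "t = 12582912 * N ^ 2 / p"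
  have t0: "t > 0" unfolding t_def using N1 p0 by simp
  define G where "G = {l \<in> {1..<p}. ?n l \<ge> 2 \<and> real (?n l) > t}"
  have finG: "finite G" by (rule finite_subset[of _ "{1..<p}"]) (auto simp: G_def)
  \<comment> \<open>Three ranges. If \<open>?r l <= 1\<close> the square is the number itself; this
    is separate because \<open>big_ratios\<close> asks for two lattice points. If
    \<open>?n l <= t\<close>, one factor is replaced by \<open>t\<close>, which leads to
    \<open>N^4 / p\<close>. The rest is \<open>G\<close>.\<close>
  have pt: "real (?r l) ^ 2 \<le> real (?r l) + t * real (?r l) + (if l \<in> G then real (?n l) ^ 2 else 0)"
    if "l \<in> {1..<p}" for l
  proof -
    have rn: "real (?r l) \<le> real (?n l)" using ratio_count_le_lattice[OF A] by simp
    consider "?r l \<le> 1" | "l \<in> G" | "?r l \<ge> 2" "l \<notin> G" by linarith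
    thus ?thesis
    proof cases
      case 1
      hence "?r l = 0 \<or> ?r l = 1" by linarith
      hence "real (?r l) ^ 2 = real (?r l)" by auto
      moreover have "0 \<le> t * real (?r l)" "0 \<le> (if l \<in> G then real (?n l) ^ 2 else 0)" using t0 by simp_all
      ultimately show ?thesis by linarith
    next
      case 2
      have "real (?r l) ^ 2 \<le> real (?n l) ^ 2" using rn by (intro power_mono) auto
      thus ?thesis using 2 t0 by (simp add: add_increasing)
    next
      case 3
      hence "?n l \<ge> 2" using rn by linarith
      hence "real (?n l) \<le> t" using 3 that unfolding G_def by auto
      hence "real (?r l) \<le> t" using rn by linarith
      hence "real (?r l) ^ 2 \<le> t * real (?r l)" unfolding power2_eq_square by (intro mult_right_mono) auto
      thus ?thesis using 3 by simp
    qed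
  qed
  have "(\<Sum>l\<in>{1..<p}. real (?r l) ^ 2) \<le>
      (\<Sum>l\<in>{1..<p}. real (?r l) + t * real (?r l) + (if l \<in> G then real (?n l) ^ 2 else 0))"
    by (intro sum_mono pt)
  also have "\<dots> = (\<Sum>l\<in>{1..<p}. real (?r l)) + t * (\<Sum>l\<in>{1..<p}. real (?r l))
      + (\<Sum>l\<in>{1..<p}. if l \<in> G then real (?n l) ^ 2 else 0)"
    by (simp add: sum.distrib sum_distrib_left)
  also have "(\<Sum>l\<in>{1..<p}. if l \<in> G then real (?n l) ^ 2 else 0) = (\<Sum>l\<in>G. real (?n l) ^ 2)"
  proof -
    have "sum (\<lambda>l. real (?n l) ^ 2) ({1..<p} \<inter> G) = (\<Sum>l\<in>{1..<p}. if l \<in> G then real (?n l) ^ 2 else 0)"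
      by (rule sum.inter_restrict) simp
    moreover have "{1..<p} \<inter> G = G" unfolding G_def by blast
    ultimately show ?thesis by simp
  qed
  finally have s1: "(\<Sum>l\<in>{1..<p}. real (?r l) ^ 2) \<le> N ^ 2 + t * N ^ 2 + (\<Sum>l\<in>G. real (?n l) ^ 2)"
    using sr mult_left_mono[OF sr, of t] t0 by linarith
  have "(\<Sum>l\<in>G. real (?n l) ^ 2) \<le> 2 * (10 ^ 16 * N ^ 2) * harm (nat p ^ 4)"
  proof (rule sum_squares_layers[OF finG])
    show "?n l \<le> nat p ^ 4" for l by (rule lattice_card_le)
    fix R assume R: "R \<in> {1..nat p ^ 4}"
    \<comment> \<open>For \<open>R < t\<close> the count is made at \<open>t\<close>: all of
      \<open>G\<close> lies above \<open>t\<close>, and the bound at \<open>R'\<close> is no worse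
      than the one wanted at \<open>R\<close>.\<close>
    define R' where "R' = max (real R) t"
    have R': "R' \<ge> 1" "R' \<ge> real R" "R' \<ge> t" unfolding R'_def using R by auto
    have "{l \<in> G. R \<le> ?n l} \<subseteq> big_ratios R'" unfolding G_def big_ratios_def R'_def by auto
    moreover have "finite (big_ratios R')"
      by (rule finite_subset[of _ "{1..<p}"]) (auto simp: big_ratios_def)
    ultimately have "real (card {l \<in> G. R \<le> ?n l}) \<le> real (card (big_ratios R'))" using card_mono by simp
    also have "\<dots> \<le> 10 ^ 16 * (N ^ 2 / R' ^ 2)"
    proof (rule big_ratios_card[OF R'(1)])
      have "t * p \<le> R' * p" using R' p0 by (intro mult_right_mono) auto
      moreover have "t * p = 12582912 * N ^ 2" unfolding t_def using p0 by simp
      moreover have "N ^ 2 > 0" using N1 by simp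
      ultimately show "6291456 * N ^ 2 < R' * p" by linarith
    qed
    also have "\<dots> \<le> 10 ^ 16 * (N ^ 2 / real R ^ 2)"
      using R R' by (intro mult_left_mono divide_left_mono power_mono) auto
    finally show "real (card {l \<in> G. R \<le> ?n l}) \<le> 10 ^ 16 * N ^ 2 / real R ^ 2" by simp
  qed
  also have "\<dots> \<le> 2 * (10 ^ 16 * N ^ 2) * (6 * ln p)"
  proof (intro mult_left_mono)
    have "p \<ge> 2" using p prime_ge_2_int by blast
    hence "ln (2::real) \<le> ln p" by simp
    hence l2: "1 \<le> 2 * ln p" using ln2_ge_two_thirds by linarith
    have np: "nat p ^ 4 \<ge> 1" using p0 by (simp add: Suc_le_eq)
    have "harm (nat p ^ 4) \<le> 1 + ln (real (nat p ^ 4))" by (rule harm_le[OF np])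
    also have "ln (real (nat p ^ 4)) = 4 * ln p" using p0 by (simp add: ln_realpow)
    finally show "harm (nat p ^ 4) \<le> 6 * ln p" using l2 by linarith
  qed auto
  finally have s2: "(\<Sum>l\<in>G. real (?n l) ^ 2) \<le> 12 * 10 ^ 16 * (N ^ 2 * ln p)" by simp
  have "p \<ge> 2" using p prime_ge_2_int by blast
  hence "ln (2::real) \<le> ln p" by simp
  hence l2: "1 \<le> 2 * ln p" using ln2_ge_two_thirds by linarith
  define y where "y = N ^ 4 / p"
  have y0: "y \<ge> 0" unfolding y_def using p0 by simp
  have m1: "N ^ 2 \<le> 2 * (N ^ 2 * ln p)" using mult_left_mono[OF l2, of "N ^ 2"] by simp
  have m2: "y \<le> 2 * (y * ln p)" using mult_left_mono[OF l2 y0] by simp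
  have tN: "t * N ^ 2 = 12582912 * y" unfolding t_def y_def by (simp flip: power_add)
  have "N ^ 2 + t * N ^ 2 + 12 * 10 ^ 16 * (N ^ 2 * ln p) \<le> 10 ^ 18 * (N ^ 2 * ln p) + 10 ^ 18 * (y * ln p)"
  proof -
    have "y * ln p \<ge> 0" "N ^ 2 * ln p \<ge> 0" using l2 y0 by simp_all
    moreover have "a + 12582912 * b + 12 * 10 ^ 16 * u \<le> 10 ^ 18 * u + 10 ^ 18 * w"
      if "a \<le> 2 * u" "b \<le> 2 * w" "0 \<le> w" "0 \<le> u" for a b u w :: real
      using that by simp
    ultimately show ?thesis unfolding tN using m1 m2 by blast
  qed
  also have "\<dots> = 10 ^ 18 * (N ^ 2 + N ^ 4 / p) * ln p" unfolding y_def by (simp add: algebra_simps)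
  finally show ?thesis using s1 s2 by linarith
qed

end

text \<open>Without zero entries, \<open>a * b = c * d\<close> means \<open>a = l * c\<close> and
  \<open>d = l * b\<close> for one ratio \<open>l\<close>, that is, two pairs of ratio
  \<open>l\<close>. If an entry is zero, both products are, which leaves four families with two free
  entries each.\<close>

lemma mult_energy_le_sum:
  assumes p: "prime (p :: int)" and A: "A \<subseteq> {0..<p}"
  shows "real (mult_energy (residue_ring p) A) \<le> 4 * real (card A) ^ 2 + (\<Sum>l\<in>{1..<p}. real (ratio_count p A l) ^ 2)"
proof -
  have finA: "finite A" using A finite_subset by blast
  have p0: "p > 0" using p prime_gt_0_int by blast
  let ?P = "\<lambda>l. {(a, c). a \<in> A \<and> c \<in> A \<and> \<not> p dvd c \<and> p dvd a - l * c}"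
  define Q where "Q = {(a, b, c, d). a \<in> A \<and> b \<in> A \<and> c \<in> A \<and> d \<in> A \<and> (a * b) mod p = (c * d) mod p}"
  define Z where "Z = (\<lambda>(x, y). (0, x, 0, y)) ` (A \<times> A) \<union> (\<lambda>(x, y). (0, x, y, 0)) ` (A \<times> A)
     \<union> (\<lambda>(x, y). (x, 0, 0, y)) ` (A \<times> A) \<union> (\<lambda>(x, y). (x, 0, y, 0 :: int)) ` (A \<times> A)"
  define W where "W = (\<Union>l\<in>{1..<p}. (\<lambda>((a, c), (d, b)). (a, b, c, d)) ` (?P l \<times> ?P l))"
  have z: "p dvd a \<longleftrightarrow> a = 0" if "a \<in> A" for a
    using that A dvd_diff_imp_eq[of a p 0] p0 by auto
  have "Q \<subseteq> Z \<union> W"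
  proof
    fix q assume "q \<in> Q"
    then obtain a b c d where q: "q = (a, b, c, d)" "a \<in> A" "b \<in> A" "c \<in> A" "d \<in> A"
      "(a * b) mod p = (c * d) mod p" unfolding Q_def by blast
    have d: "p dvd a * b - c * d" using q(6) by (simp add: mod_eq_dvd_iff)
    show "q \<in> Z \<union> W"
    proof (cases "a = 0 \<or> b = 0 \<or> c = 0 \<or> d = 0")
      case True
      have "p dvd a * b \<longleftrightarrow> p dvd c * d" using q(6) by (metis dvd_eq_mod_eq_0)
      moreover have "p dvd a * b \<longleftrightarrow> a = 0 \<or> b = 0" "p dvd c * d \<longleftrightarrow> c = 0 \<or> d = 0"
        using p z q by (simp_all add: prime_dvd_mult_iff)
      ultimately have "(a = 0 \<or> b = 0) \<and> (c = 0 \<or> d = 0)" using True by blast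
      hence "q \<in> Z" unfolding q(1) Z_def using q(2-5) by (auto simp: image_iff)
      thus ?thesis by blast
    next
      case False
      hence nd: "\<not> p dvd a" "\<not> p dvd b" "\<not> p dvd c" "\<not> p dvd d" using z q by auto
      have "coprime c p" using nd(3) p prime_imp_coprime coprime_commute by blast
      then obtain i where i: "[c * i = 1] (mod p)" using cong_solve_coprime_int by blast
      define l where "l = (a * i) mod p"
      have "p dvd a * (c * i - 1)" using i by (simp add: cong_iff_dvd_diff)
      moreover have "p dvd c * (a * i - l)" unfolding l_def by simp
      ultimately have "p dvd c * (a * i - l) - a * (c * i - 1)" by (intro dvd_diff)
      hence l: "p dvd a - l * c" by (simp add: algebra_simps)
      have "l \<noteq> 0" using l nd(1) by auto
      hence l1: "l \<in> {1..<p}" unfolding l_def using p0 pos_mod_bound[OF p0, of "a * i"] pos_mod_sign[OF p0, of "a * i"] by auto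
      have "p dvd (a - l * c) * b - (a * b - c * d)" by (rule dvd_diff[OF dvd_mult2[OF l] d])
      hence "p dvd c * (d - l * b)" by (simp add: algebra_simps)
      hence "p dvd d - l * b" using nd(3) p by (simp add: prime_dvd_mult_iff)
      hence "((a, c), (d, b)) \<in> ?P l \<times> ?P l" using q nd l by simp
      hence "(\<lambda>((a, c), (d, b)). (a, b, c, d)) ((a, c), (d, b)) \<in> W" unfolding W_def using l1 by blast
      thus ?thesis unfolding q(1) by simp
    qed
  qed
  hence QZW: "Q \<subseteq> Z \<union> W" .
  have finP: "finite (?P l)" for l using finite_ratio_pairs[OF finA] .
  have finW: "finite W" unfolding W_def by (intro finite_UN_I finite_imageI finite_cartesian_product finP) simp
  have finZ: "finite Z" unfolding Z_def using finA by simp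
  have "card Q \<le> card (Z \<union> W)" by (rule card_mono[OF _ QZW]) (use finZ finW in simp)
  also have "\<dots> \<le> card Z + card W" by (rule card_Un_le)
  finally have "card Q \<le> card Z + card W" .
  moreover have "card Z \<le> card (A \<times> A) + card (A \<times> A) + card (A \<times> A) + card (A \<times> A)"
    unfolding Z_def using finA
    by (intro order_trans[OF card_Un_le] add_mono card_image_le) auto
  moreover have "card W \<le> (\<Sum>l\<in>{1..<p}. ratio_count p A l ^ 2)"
  proof -
    have "card W \<le> (\<Sum>l\<in>{1..<p}. card ((\<lambda>((a, c), (d, b)). (a, b, c, d)) ` (?P l \<times> ?P l)))"
      unfolding W_def by (rule card_UN_le) simp
    also have "\<dots> \<le> (\<Sum>l\<in>{1..<p}. card (?P l \<times> ?P l))"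
      using finP by (intro sum_mono card_image_le) simp
    finally show ?thesis unfolding ratio_count_def by (simp add: card_cartesian_product power2_eq_square)
  qed
  ultimately have "card Q \<le> 4 * card A ^ 2 + (\<Sum>l\<in>{1..<p}. ratio_count p A l ^ 2)"
    by (simp add: card_cartesian_product power2_eq_square)
  hence "real (card Q) \<le> real (4 * card A ^ 2 + (\<Sum>l\<in>{1..<p}. ratio_count p A l ^ 2))"
    by (simp only: of_nat_le_iff)
  moreover have "mult_energy (residue_ring p) A = card Q"
    unfolding mult_energy_def Q_def residue_ring_def by simp
  ultimately show ?thesis by simp
qed

lemma mult_energy_cube:
  assumes p: "prime (p :: int)" and A: "A \<subseteq> {0..<p}"
  shows "real (mult_energy (residue_ring p) A) \<le> 4 * real (card A) ^ 2 + real (card A) ^ 3"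
proof -
  have finA: "finite A" using A finite_subset by blast
  have "(\<Sum>l\<in>{1..<p}. real (ratio_count p A l) ^ 2) \<le> (\<Sum>l\<in>{1..<p}. real (card A) * real (ratio_count p A l))"
    unfolding power2_eq_square using ratio_count_le_card[OF A] by (intro sum_mono mult_right_mono) auto
  also have "\<dots> = real (card A) * real (\<Sum>l\<in>{1..<p}. ratio_count p A l)" by (simp add: sum_distrib_left)
  also have "\<dots> \<le> real (card A) * real (card A ^ 2)"
  proof (rule mult_left_mono)
    show "real (\<Sum>l\<in>{1..<p}. ratio_count p A l) \<le> real (card A ^ 2)"
      using sum_ratio_count_le[OF p finA] by (simp only: of_nat_le_iff)
  qed simp
  also have "\<dots> = real (card A) ^ 3" by (simp add: power2_eq_square power3_eq_cube)
  finally show ?thesis using mult_energy_le_sum[OF assms] by linarith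
qed

section \<open>Improper progressions\<close>

lemma one_le_two_ln: "p \<ge> 2 \<Longrightarrow> 1 \<le> 2 * ln (real_of_int p)"
proof -
  assume "p \<ge> 2"
  hence "ln (2::real) \<le> ln p" by simp
  thus ?thesis using ln2_ge_two_thirds by linarith
qed

text \<open>Once \<open>card A\<close> is comparable with \<open>p\<close>, the trivial cubic bound
  is a multiple of \<open>card A ^ 4 / p\<close>. The factor \<open>53312 = 64 * 833\<close> is what
  the improper case produces.\<close>

lemma mult_energy_dense:
  assumes p: "prime (p :: int)" and A: "A \<subseteq> {0..<p}" and dense: "real_of_int p \<le> 53312 * card A"
  shows "real (mult_energy (residue_ring p) A) \<le> 10 ^ 30 * (real (card A) ^ 2 + real (card A) ^ 4 / p) * ln p"
proof -
  define k where "k = real (card A)"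
  have p0: "p > 0" using p prime_gt_0_int by blast
  have l: "1 \<le> 2 * ln (real_of_int p)" by (rule one_le_two_ln) (use p prime_ge_2_int in blast)
  have "k ^ 3 * p \<le> k ^ 3 * (53312 * k)" using dense unfolding k_def by (intro mult_left_mono) auto
  hence 3: "k ^ 3 \<le> 53312 * (k ^ 4 / p)"
    using p0 by (simp add: field_simps power3_eq_cube power4_eq_xxxx)
  have "real (mult_energy (residue_ring p) A) \<le> 4 * k ^ 2 + k ^ 3" unfolding k_def by (rule mult_energy_cube[OF p A])
  also have "\<dots> \<le> 53312 * (k ^ 2 + k ^ 4 / p)"
  proof -
    have "0 \<le> k ^ 2" by simp
    thus ?thesis using 3 unfolding distrib_left by linarith
  qed
  also have "\<dots> \<le> 53312 * (k ^ 2 + k ^ 4 / p) * (2 * ln p)"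
    using mult_left_mono[OF l, of "53312 * (k ^ 2 + k ^ 4 / p)"] p0 k_def by simp
  also have "\<dots> = 106624 * ((k ^ 2 + k ^ 4 / p) * ln p)" by simp
  also have "\<dots> \<le> 10 ^ 30 * ((k ^ 2 + k ^ 4 / p) * ln p)"
    by (rule mult_right_mono) (use l p0 k_def in auto)
  finally show ?thesis unfolding k_def by (simp only: mult.assoc)
qed

text \<open>\<open>A\<close> need only lie in a proper progression of comparable size, so that the
  lemma also covers sets whose own parametrization is not injective.\<close>

lemma mult_energy_proper:
  assumes p: "prime (p :: int)" and H: "H1 \<ge> 1" "H2 \<ge> 1"
    and proper: "\<And>x y. \<bar>x\<bar> \<le> 16 * int H1 \<Longrightarrow> \<bar>y\<bar> \<le> 16 * int H2 \<Longrightarrow> p dvd a1 * x + a2 * y \<Longrightarrow> x = 0 \<and> y = 0"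
    and A: "A \<subseteq> (\<lambda>(x, y). (a0 + x * a1 + y * a2) mod p) ` ({1..int H1} \<times> {1..int H2})"
    and N: "real H1 * real H2 \<le> 384 * card A"
  shows "real (mult_energy (residue_ring p) A) \<le> 10 ^ 30 * (real (card A) ^ 2 + real (card A) ^ 4 / p) * ln p"
proof -
  define k where "k = real (card A)"
  define V where "V = real H1 * real H2"
  have p0: "p > 0" using p prime_gt_0_int by blast
  have l: "1 \<le> 2 * ln (real_of_int p)" by (rule one_le_two_ln) (use p prime_ge_2_int in blast)
  have A': "A \<subseteq> {0..<p}" using A p0 by auto
  have s: "(\<Sum>l\<in>{1..<p}. real (ratio_count p A l) ^ 2) \<le> 10 ^ 18 * (V ^ 2 + V ^ 4 / p) * ln p"
  proof (cases "H1 \<le> H2")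
    case True
    interpret proper_gap p a1 a2 H1 H2 by unfold_locales (use p H True proper in blast)+
    show ?thesis using sum_ratio_count_sq[OF A] unfolding V_def N_def .
  next
    \<comment> \<open>The locale wants the shorter side first, so the two generators are
      exchanged.\<close>
    case False
    interpret proper_gap p a2 a1 H2 H1
    proof
      show "x = 0 \<and> y = 0" if "\<bar>x\<bar> \<le> 16 * int H2" "\<bar>y\<bar> \<le> 16 * int H1" "p dvd a2 * x + a1 * y" for x y
        using proper[of y x] that by (simp add: add.commute)
    qed (use p H False in auto)
    have "A \<subseteq> (\<lambda>(x, y). (a0 + x * a2 + y * a1) mod p) ` ({1..int H2} \<times> {1..int H1})"
    proof
      fix a assume "a \<in> A"
      then obtain x y where "x \<in> {1..int H1}" "y \<in> {1..int H2}" "a = (a0 + x * a1 + y * a2) mod p"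
        using A by auto
      thus "a \<in> (\<lambda>(x, y). (a0 + x * a2 + y * a1) mod p) ` ({1..int H2} \<times> {1..int H1})"
        by (intro image_eqI[of _ _ "(y, x)"]) (auto simp: ac_simps)
    qed
    from sum_ratio_count_sq[OF this] show ?thesis unfolding V_def N_def by (simp add: mult.commute)
  qed
  have Nk: "V \<le> 384 * k" "0 \<le> V" using N unfolding V_def k_def by simp_all
  have "V ^ 2 \<le> (384 * k) ^ 2" using Nk by (intro power_mono)
  also have "\<dots> = 384 ^ 2 * k ^ 2" by (rule power_mult_distrib)
  also have "\<dots> \<le> 384 ^ 4 * k ^ 2" by (rule mult_right_mono) auto
  finally have n2: "V ^ 2 \<le> 384 ^ 4 * k ^ 2" .
  have "V ^ 4 \<le> (384 * k) ^ 4" using Nk by (intro power_mono)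
  hence "V ^ 4 / p \<le> 384 ^ 4 * k ^ 4 / p" using p0 by (intro divide_right_mono) (auto simp: power_mult_distrib)
  hence n: "V ^ 2 + V ^ 4 / p \<le> 384 ^ 4 * (k ^ 2 + k ^ 4 / p)" using n2 by (simp add: distrib_left)
  have k0: "0 \<le> (k ^ 2 + k ^ 4 / p) * ln p" using l p0 by simp
  have "10 ^ 18 * (V ^ 2 + V ^ 4 / p) * ln p \<le> 10 ^ 18 * (384 ^ 4 * (k ^ 2 + k ^ 4 / p)) * ln p"
    using n l by (intro mult_right_mono mult_left_mono) auto
  also have "\<dots> = (10 ^ 18 * 384 ^ 4) * ((k ^ 2 + k ^ 4 / p) * ln p)" by (simp only: mult.assoc)
  finally have 1: "(\<Sum>l\<in>{1..<p}. real (ratio_count p A l) ^ 2) \<le> (10 ^ 18 * 384 ^ 4) * ((k ^ 2 + k ^ 4 / p) * ln p)"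
    using s by linarith
  have "k ^ 2 \<le> (k ^ 2 + k ^ 4 / p) * (2 * ln p)"
    using mult_mono[of "k ^ 2" "k ^ 2 + k ^ 4 / p" 1 "2 * ln p"] l p0 by simp
  hence 2: "4 * k ^ 2 \<le> 8 * ((k ^ 2 + k ^ 4 / p) * ln p)" by (simp only: mult.assoc)
  have "real (mult_energy (residue_ring p) A) \<le> 4 * k ^ 2 + (10 ^ 18 * 384 ^ 4) * ((k ^ 2 + k ^ 4 / p) * ln p)"
    using mult_energy_le_sum[OF p A'] 1 unfolding k_def by linarith
  also have "\<dots> \<le> 8 * ((k ^ 2 + k ^ 4 / p) * ln p) + (10 ^ 18 * 384 ^ 4) * ((k ^ 2 + k ^ 4 / p) * ln p)"
    using 2 by linarith
  also have "\<dots> = (8 + 10 ^ 18 * 384 ^ 4) * ((k ^ 2 + k ^ 4 / p) * ln p)" by (simp only: distrib_right)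
  \<comment> \<open>\<open>384 ^ 4\<close> is below \<open>2.2 * 10^10\<close>, so the final
    constant has room to spare.\<close>
  also have "\<dots> \<le> 10 ^ 30 * ((k ^ 2 + k ^ 4 / p) * ln p)" by (rule mult_right_mono[OF _ k0]) simp
  finally show ?thesis unfolding k_def by (simp only: mult.assoc)
qed

text \<open>By coprimality, equal values force the first coordinates to agree modulo
  \<open>k1\<close>. So the map is injective on a strip of width \<open>m\<close>, the smaller of
  the absolute value of \<open>k1\<close> and \<open>H1\<close>; the bound on \<open>k1\<close>
  makes \<open>16 * m\<close> at least that absolute value.\<close>

lemma card_image_strip:
  fixes k1 k2 :: int and H1 H2 :: nat
  assumes cop: "coprime k1 k2" and k1: "\<bar>k1\<bar> \<le> 16 * int H1"
  shows "\<bar>k1\<bar> * int H2 \<le> 16 * int (card ((\<lambda>(x, y). k2 * x - k1 * y) ` ({1..int H1} \<times> {1..int H2})))"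
proof (cases "k1 = 0")
  case False
  let ?f = "\<lambda>(x, y). k2 * x - k1 * y"
  define m where "m = min \<bar>k1\<bar> (int H1)"
  have m0: "m \<ge> 0" unfolding m_def by simp
  have inj: "inj_on ?f ({1..m} \<times> {1..int H2})"
  proof (rule inj_onI, clarify)
    fix x y x' y' assume a: "x \<in> {1..m}" "x' \<in> {1..m}" "k2 * x - k1 * y = k2 * x' - k1 * y'"
    have e: "k2 * (x - x') = k1 * (y - y')" using a(3) by (simp add: algebra_simps)
    hence "k1 dvd k2 * (x - x')" by simp
    hence "k1 dvd x - x'" using cop by (simp add: coprime_dvd_mult_right_iff)
    hence "x = x'"
    proof (rule contrapos_pp)
      assume "x \<noteq> x'"
      moreover have "\<bar>x - x'\<bar> < \<bar>k1\<bar>" using a(1,2) unfolding m_def by auto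
      ultimately show "\<not> k1 dvd x - x'" using dvd_imp_le_int[of "x - x'" k1] by auto
    qed
    thus "x = x' \<and> y = y'" using e False by simp
  qed
  have "card ({1..m} \<times> {1..int H2}) = card (?f ` ({1..m} \<times> {1..int H2}))" by (rule card_image[OF inj, symmetric])
  also have "\<dots> \<le> card (?f ` ({1..int H1} \<times> {1..int H2}))"
    by (intro card_mono image_mono) (auto simp: m_def)
  finally have "int (card ({1..m} \<times> {1..int H2})) \<le> int (card (?f ` ({1..int H1} \<times> {1..int H2})))" by (simp only: of_nat_le_iff)
  moreover have "int (card ({1..m} \<times> {1..int H2})) = m * int H2"
    using m0 by (simp add: card_cartesian_product)
  moreover have "\<bar>k1\<bar> * int H2 \<le> (16 * m) * int H2"
    by (rule mult_right_mono) (use k1 m_def in auto)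
  ultimately show ?thesis by linarith
qed simp

lemma card_residue_class:
  fixes p X :: int
  assumes p: "p > 0" and X: "X \<ge> 0" and S: "S \<subseteq> {-X..X}"
    and c: "\<And>v w. v \<in> S \<Longrightarrow> w \<in> S \<Longrightarrow> p dvd v - w"
  shows "real (card S) \<le> 2 * (X / p) + 2"
proof -
  have inj: "inj_on (\<lambda>w. w div p) S"
  proof (rule inj_onI)
    fix v w assume a: "v \<in> S" "w \<in> S" "v div p = w div p"
    have "v mod p = w mod p" using c[OF a(1,2)] by (simp add: mod_eq_dvd_iff)
    thus "v = w" using a(3) by (metis div_mult_mod_eq)
  qed
  have "(\<lambda>w. w div p) ` S \<subseteq> {(-X) div p..X div p}"
    using S p by (auto intro!: zdiv_mono1)
  hence "card ((\<lambda>w. w div p) ` S) \<le> card {(-X) div p..X div p}" by (intro card_mono) auto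
  hence "card S \<le> nat (X div p - (-X) div p + 1)" using card_image[OF inj] by simp
  moreover have "(-X) div p \<le> X div p" using p X by (intro zdiv_mono1) auto
  ultimately have "int (card S) \<le> X div p - (-X) div p + 1" by linarith
  hence "real_of_int (int (card S)) \<le> real_of_int (X div p - (-X) div p + 1)" by (simp only: of_int_le_iff)
  moreover have "real_of_int (X div p) \<le> X / p" by (rule real_of_int_div4)
  moreover have "real_of_int ((-X) div p) \<ge> (-X) / p - 1" using real_of_int_div2[of "-X" p] real_of_int_div3[of "-X" p] by linarith
  ultimately show ?thesis by simp
qed

text \<open>A short relation between \<open>a1\<close> and \<open>a2\<close>, divided by its gcd,
  makes \<open>(a1, a2)\<close> a multiple of \<open>(k2, - k1)\<close> modulo \<open>p\<close>.
  Then \<open>A\<close> is the image of a set \<open>Y\<close> of integers filling a positive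
  proportion of an interval \<open>{-X..X}\<close>. Comparing \<open>Y\<close> with \<open>A\<close>
  residue by residue shows that \<open>A\<close> is dense in the field or has size comparable with
  \<open>X\<close>.\<close>

lemma mult_energy_image_le:
  assumes p: "prime (p :: int)" and H: "H1 \<ge> 1" "H2 \<ge> 1" and a: "\<not> p dvd a1" "\<not> p dvd a2"
    and A: "A = (\<lambda>(x, y). (a0 + x * a1 + y * a2) mod p) ` ({1..int H1} \<times> {1..int H2})"
  shows "real (mult_energy (residue_ring p) A) \<le> 10 ^ 30 * (real (card A) ^ 2 + real (card A) ^ 4 / p) * ln p"
proof -
  have p0: "p > 0" using p prime_gt_0_int by blast
  have A': "A \<subseteq> {0..<p}" using A p0 by auto
  have finA: "finite A" using A' finite_subset by blast
  have canc: "p dvd c * z \<Longrightarrow> \<not> p dvd c \<Longrightarrow> p dvd z" for c z using p by (simp add: prime_dvd_mult_iff)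
  \<comment> \<open>A single direction has at least \<open>min H p >= p / 16\<close> distinct
    residues.\<close>
  have big: "real_of_int p \<le> 53312 * card A" if "p \<le> 16 * int H" "\<not> p dvd b"
    "\<And>x. x \<in> {1..int H} \<Longrightarrow> (b0 + x * b) mod p \<in> A" for H b b0
  proof -
    define k where "k = min (int H) p"
    have "inj_on (\<lambda>x. (b0 + x * b) mod p) {1..k}"
    proof (rule inj_onI)
      fix x y assume x: "x \<in> {1..k}" "y \<in> {1..k}" "(b0 + x * b) mod p = (b0 + y * b) mod p"
      have "p dvd (b0 + x * b) - (b0 + y * b)" using x(3) by (simp add: mod_eq_dvd_iff)
      hence "p dvd b * ((x - 1) - (y - 1))" by (simp add: algebra_simps)
      hence "p dvd (x - 1) - (y - 1)" using canc that(2) by blast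
      moreover have "x - 1 \<in> {0..<p}" "y - 1 \<in> {0..<p}" using x(1,2) unfolding k_def by auto
      ultimately show "x = y" using dvd_diff_imp_eq by fastforce
    qed
    moreover have "(\<lambda>x. (b0 + x * b) mod p) ` {1..k} \<subseteq> A" using that(3) unfolding k_def by auto
    ultimately have "card {1..k} \<le> card A" using finA by (intro card_inj_on_le)
    hence "k \<le> int (card A)" by simp
    hence "p \<le> 53312 * int (card A)" using that(1) p0 unfolding k_def by auto
    hence "real_of_int p \<le> real_of_int (53312 * int (card A))" by (simp only: of_int_le_iff)
    thus ?thesis by simp
  qed
  show ?thesis
  proof (cases "p \<le> 16 * int H1 \<or> p \<le> 16 * int H2")
    case True
    have "real_of_int p \<le> 53312 * card A"
    proof (cases "p \<le> 16 * int H1")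
      case True
      show ?thesis
      proof (rule big[OF True a(1), of "a0 + a2"])
        fix x assume "x \<in> {1..int H1}"
        thus "(a0 + a2 + x * a1) mod p \<in> A" unfolding A using H by (intro image_eqI[of _ _ "(x, 1)"]) (auto simp: ac_simps)
      qed
    next
      case False
      hence "p \<le> 16 * int H2" using \<open>p \<le> 16 * int H1 \<or> p \<le> 16 * int H2\<close> by blast
      thus ?thesis
      proof (rule big[OF _ a(2), of H2 "a0 + a1"])
        fix x assume "x \<in> {1..int H2}"
        thus "(a0 + a1 + x * a2) mod p \<in> A" unfolding A using H by (intro image_eqI[of _ _ "(1, x)"]) (auto simp: ac_simps)
      qed
    qed
    thus ?thesis by (rule mult_energy_dense[OF p A'])
  next
    case False
    hence small: "16 * int H1 < p" "16 * int H2 < p" by auto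
    show ?thesis
    proof (cases "\<forall>x y. \<bar>x\<bar> \<le> 16 * int H1 \<longrightarrow> \<bar>y\<bar> \<le> 16 * int H2 \<longrightarrow> p dvd a1 * x + a2 * y \<longrightarrow> x = 0 \<and> y = 0")
      case True
      have "inj_on (\<lambda>(x, y). (a0 + x * a1 + y * a2) mod p) ({1..int H1} \<times> {1..int H2})"
      proof (rule inj_onI, clarify)
        fix x y x' y' assume x: "x \<in> {1..int H1}" "y \<in> {1..int H2}" "x' \<in> {1..int H1}" "y' \<in> {1..int H2}"
          "(a0 + x * a1 + y * a2) mod p = (a0 + x' * a1 + y' * a2) mod p"
        have "p dvd (a0 + x * a1 + y * a2) - (a0 + x' * a1 + y' * a2)" using x(5) by (simp add: mod_eq_dvd_iff)
        hence "p dvd a1 * (x - x') + a2 * (y - y')" by (simp add: algebra_simps)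
        moreover have "\<bar>x - x'\<bar> \<le> 16 * int H1" "\<bar>y - y'\<bar> \<le> 16 * int H2" using x(1-4) by auto
        ultimately have "x - x' = 0 \<and> y - y' = 0" using True by blast
        thus "x = x' \<and> y = y'" by simp
      qed
      hence "card A = H1 * H2" unfolding A by (simp add: card_image card_cartesian_product)
      hence "real H1 * real H2 \<le> 384 * card A" by simp
      thus ?thesis using mult_energy_proper[OF p H _ _ ] True A by blast
    next
      case False
      then obtain h1 h2 where h: "\<bar>h1\<bar> \<le> 16 * int H1" "\<bar>h2\<bar> \<le> 16 * int H2" "p dvd a1 * h1 + a2 * h2"
        "h1 \<noteq> 0 \<or> h2 \<noteq> 0" by blast
      define g where "g = gcd h1 h2"
      have g0: "g > 0" unfolding g_def using h(4) by (simp add: gcd_pos_int)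
      obtain k1 k2 where k: "h1 = k1 * g" "h2 = k2 * g" "coprime k1 k2"
        using gcd_coprime_exists[of h1 h2] g0 unfolding g_def by auto
      have ng: "\<not> p dvd g"
      proof
        assume "p dvd g"
        hence d: "p dvd h1" "p dvd h2" unfolding k by simp_all
        have "h1 = 0" using d(1) h(1) small dvd_imp_le_int[of h1 p] by fastforce
        moreover have "h2 = 0" using d(2) h(2) small dvd_imp_le_int[of h2 p] by fastforce
        ultimately show False using h(4) by simp
      qed
      have rel: "p dvd a1 * k1 + a2 * k2"
      proof -
        have "p dvd g * (a1 * k1 + a2 * k2)" using h(3) unfolding k by (simp add: algebra_simps)
        thus ?thesis using canc ng by blast
      qed
      have kb: "\<bar>k1\<bar> \<le> 16 * int H1" "\<bar>k2\<bar> \<le> 16 * int H2"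
      proof -
        have "\<bar>k\<bar> \<le> \<bar>k * g\<bar>" for k using g0 mult_left_mono[of 1 g "\<bar>k\<bar>"] by (simp add: abs_mult)
        thus "\<bar>k1\<bar> \<le> 16 * int H1" "\<bar>k2\<bar> \<le> 16 * int H2" using h(1,2) unfolding k by (meson order_trans)+
      qed
      obtain u v where uv: "u * k1 + v * k2 = 1" using k(3) by (metis bezout_int coprime_imp_gcd_eq_1)
      \<comment> \<open>The Bezout coefficients solve \<open>a1 = k2 * e\<close> and
        \<open>a2 = - k1 * e\<close> modulo \<open>p\<close> simultaneously.\<close>
      define e where "e = v * a1 - u * a2"
      have e1: "p dvd a1 - k2 * e"
      proof -
        have "a1 - k2 * e = a1 * (u * k1 + v * k2) - k2 * e" using uv by simp
        also have "\<dots> = u * (a1 * k1 + a2 * k2)" unfolding e_def by (simp add: algebra_simps)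
        finally show ?thesis using rel by simp
      qed
      have e2: "p dvd a2 + k1 * e"
      proof -
        have "a2 + k1 * e = a2 * (u * k1 + v * k2) + k1 * e" using uv by simp
        also have "\<dots> = v * (a1 * k1 + a2 * k2)" unfolding e_def by (simp add: algebra_simps)
        finally show ?thesis using rel by simp
      qed
      have ne: "\<not> p dvd e"
      proof
        assume "p dvd e"
        hence "p dvd (a1 - k2 * e) + k2 * e" by (rule dvd_add[OF e1 dvd_mult])
        thus False using a(1) by simp
      qed
      have red: "(a0 + x * a1 + y * a2) mod p = (a0 + (k2 * x - k1 * y) * e) mod p" for x y
      proof -
        have "p dvd x * (a1 - k2 * e) + y * (a2 + k1 * e)" by (rule dvd_add[OF dvd_mult[OF e1] dvd_mult[OF e2]])
        thus ?thesis by (simp add: mod_eq_dvd_iff algebra_simps)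
      qed
      define z where "z = (\<lambda>(x, y). k2 * x - k1 * y)"
      define Y where "Y = z ` ({1..int H1} \<times> {1..int H2})"
      define X where "X = \<bar>k2\<bar> * int H1 + \<bar>k1\<bar> * int H2"
      have AY: "A = (\<lambda>w. (a0 + w * e) mod p) ` Y"
        unfolding A Y_def z_def image_image by (rule image_cong) (auto simp: red)
      have finY: "finite Y" unfolding Y_def by simp
      have YX: "Y \<subseteq> {-X..X}"
      proof
        fix w assume "w \<in> Y"
        then obtain x y where xy: "x \<in> {1..int H1}" "y \<in> {1..int H2}" "w = k2 * x - k1 * y"
          unfolding Y_def z_def by auto
        have "\<bar>w\<bar> \<le> \<bar>k2 * x\<bar> + \<bar>k1 * y\<bar>" unfolding xy by (rule abs_triangle_ineq4)
        also have "\<dots> \<le> X" unfolding X_def abs_mult using xy by (intro add_mono mult_left_mono) auto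
        finally show "w \<in> {-X..X}" by auto
      qed
      have X1: "X \<ge> 1"
      proof -
        have "k1 \<noteq> 0 \<or> k2 \<noteq> 0" using k(3) by auto
        hence "1 \<le> \<bar>k1\<bar> \<or> 1 \<le> \<bar>k2\<bar>" by auto
        moreover have "\<bar>k2\<bar> * 1 \<le> \<bar>k2\<bar> * int H1" "\<bar>k1\<bar> * 1 \<le> \<bar>k1\<bar> * int H2"
          using H by (intro mult_left_mono; simp)+
        ultimately show ?thesis unfolding X_def by linarith
      qed
      have "X \<le> 32 * int (card Y)"
      proof -
        have "\<bar>k1\<bar> * int H2 \<le> 16 * int (card Y)"
          unfolding Y_def z_def by (rule card_image_strip[OF k(3) kb(1)])
        moreover have "\<bar>k2\<bar> * int H1 \<le> 16 * int (card Y)"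
        proof -
          have "coprime k2 k1" using k(3) by (simp add: coprime_commute)
          hence "\<bar>k2\<bar> * int H1 \<le> 16 * int (card ((\<lambda>(x, y). k1 * x - k2 * y) ` ({1..int H2} \<times> {1..int H1})))"
            using kb(2) by (rule card_image_strip)
          also have "(\<lambda>(x, y). k1 * x - k2 * y) ` ({1..int H2} \<times> {1..int H1}) = uminus ` Y"
            unfolding Y_def z_def by (force simp: image_iff)
          also have "card (uminus ` Y) = card Y" by (rule card_image) simp
          finally show ?thesis .
        qed
        ultimately show ?thesis unfolding X_def by linarith
      qed
      hence "real_of_int X \<le> real_of_int (32 * int (card Y))" by (simp only: of_int_le_iff)
      hence XY: "real_of_int X \<le> 32 * real (card Y)" by simp
      \<comment> \<open>Counting \<open>Y\<close> over the residues in \<open>A\<close>, each hit at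
        most \<open>2 * (X / p) + 2\<close> times.\<close>
      have "card Y \<le> (\<Sum>t\<in>A. card {w \<in> Y. (a0 + w * e) mod p = t})"
      proof -
        have "Y = (\<Union>t\<in>A. {w \<in> Y. (a0 + w * e) mod p = t})" unfolding AY by auto
        thus ?thesis using card_UN_le[OF finA, of "\<lambda>t. {w \<in> Y. (a0 + w * e) mod p = t}"] by simp
      qed
      hence "real (card Y) \<le> (\<Sum>t\<in>A. real (card {w \<in> Y. (a0 + w * e) mod p = t}))"
        by (simp flip: of_nat_sum)
      also have "\<dots> \<le> (\<Sum>t\<in>A. 2 * (X / p) + 2)"
      proof (rule sum_mono)
        fix t
        show "real (card {w \<in> Y. (a0 + w * e) mod p = t}) \<le> 2 * (X / p) + 2"
        proof (rule card_residue_class[OF p0])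
          show "X \<ge> 0" using X1 by simp
          show "{w \<in> Y. (a0 + w * e) mod p = t} \<subseteq> {-X..X}" using YX by blast
          fix v w assume "v \<in> {w \<in> Y. (a0 + w * e) mod p = t}" "w \<in> {w \<in> Y. (a0 + w * e) mod p = t}"
          hence "(a0 + v * e) mod p = (a0 + w * e) mod p" by simp
          hence "p dvd (a0 + v * e) - (a0 + w * e)" by (simp add: mod_eq_dvd_iff)
          hence "p dvd e * (v - w)" by (simp add: algebra_simps)
          thus "p dvd v - w" using canc ne by blast
        qed
      qed
      finally have cY: "real (card Y) \<le> card A * (2 * (X / p) + 2)" by simp
      have "real_of_int X * p \<le> 32 * (card A * (2 * (X / p) + 2)) * p"
        using XY cY p0 by (intro mult_right_mono) auto
      also have "\<dots> = 64 * real (card A) * (X + p)" using p0 by (simp add: field_simps)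
      finally have main: "real_of_int X * p \<le> 64 * real (card A) * (X + p)" .
      show ?thesis
      \<comment> \<open>\<open>832 = 544 + 288\<close>: properness below needs
        \<open>(16 * K + 1) * 16 + 16 * K = 544 * X + 288 < p\<close> for
        \<open>K = 2 * X + 1\<close>, where \<open>X >= 1\<close>. In the other case
        \<open>X + p <= 833 * X\<close>, whence \<open>64 * 833 = 53312\<close>.\<close>
      proof (cases "p \<le> 832 * X")
        case True
        hence "real_of_int p \<le> real_of_int (832 * X)" by (simp only: of_int_le_iff)
        hence "real_of_int X + p \<le> 833 * X" by simp
        hence "64 * real (card A) * (X + p) \<le> 64 * real (card A) * (833 * X)"
          by (intro mult_left_mono) auto
        hence "real_of_int X * p \<le> real_of_int X * (53312 * card A)" using main by (simp add: algebra_simps)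
        hence "real_of_int p \<le> 53312 * card A" using X1 by (simp only: mult_le_cancel_left_pos)
        thus ?thesis by (rule mult_energy_dense[OF p A'])
      next
        case False
        hence "real_of_int (832 * X) \<le> real_of_int p" by (simp only: of_int_le_iff)
        hence "real_of_int X + p \<le> 2 * p" using X1 by simp
        hence "64 * real (card A) * (X + p) \<le> 64 * real (card A) * (2 * p)"
          by (intro mult_left_mono) auto
        hence "real_of_int X * p \<le> (128 * card A) * real_of_int p" using main by (simp add: algebra_simps)
        hence XA: "real_of_int X \<le> 128 * card A" using p0 by simp
        define K where "K = nat (2 * X + 1)"
        have K: "int K = 2 * X + 1" unfolding K_def using X1 by simp
        \<comment> \<open>A rank-one progression presented with rank two: the first side is
          \<open>1\<close>, and \<open>b\<close> is too large a multiple of \<open>e\<close> to be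
          cancelled by \<open>e * y\<close> with \<open>y\<close> at most \<open>16 * K\<close> in
          absolute value.\<close>
        define b where "b = (16 * int K + 1) * e"
        \<comment> \<open>The shift makes \<open>x = 1\<close> and \<open>y = w + X + 1\<close>,
          which runs through \<open>{1..K}\<close>, represent \<open>w\<close> in
          \<open>{-X..X}\<close>. Here \<open>K <= 3 * X\<close> and
          \<open>X <= 128 * card A\<close> give the factor \<open>384\<close>.\<close>
        show ?thesis
        proof (rule mult_energy_proper[OF p, of 1 K b e A "a0 - (X + 1) * e - b"])
          show "1 \<le> (1::nat)" "1 \<le> K" using K X1 by auto
          have "real_of_int (int K) \<le> 3 * real_of_int X" unfolding K using X1 by simp
          thus "real 1 * real K \<le> 384 * card A" using XA by simp
          show "A \<subseteq> (\<lambda>(x, y). (a0 - (X + 1) * e - b + x * b + y * e) mod p) ` ({1..int 1} \<times> {1..int K})"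
          proof
            fix t assume "t \<in> A"
            then obtain w where w: "w \<in> Y" "t = (a0 + w * e) mod p" unfolding AY by blast
            have "t = (a0 - (X + 1) * e - b + 1 * b + (w + X + 1) * e) mod p"
              unfolding w(2) by (simp add: algebra_simps)
            moreover have "(1, w + X + 1) \<in> {1..int 1} \<times> {1..int K}" using w(1) YX K by auto
            ultimately show "t \<in> (\<lambda>(x, y). (a0 - (X + 1) * e - b + x * b + y * e) mod p) ` ({1..int 1} \<times> {1..int K})"
              by (intro image_eqI[of _ _ "(1, w + X + 1)"]) simp_all
          qed
          fix x y assume xy: "\<bar>x\<bar> \<le> 16 * int 1" "\<bar>y\<bar> \<le> 16 * int K" "p dvd b * x + e * y"
          have "p dvd e * ((16 * int K + 1) * x + y)" using xy(3) unfolding b_def by (simp add: algebra_simps)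
          hence d: "p dvd (16 * int K + 1) * x + y" using canc ne by blast
          have "\<bar>(16 * int K + 1) * x + y\<bar> \<le> (16 * int K + 1) * \<bar>x\<bar> + \<bar>y\<bar>"
            using abs_triangle_ineq[of "(16 * int K + 1) * x" y] by (simp add: abs_mult)
          also have "\<dots> \<le> (16 * int K + 1) * 16 + 16 * int K"
            using xy(1,2) by (intro add_mono mult_left_mono) auto
          also have "\<dots> < p" using False X1 unfolding K by simp
          finally have 0: "(16 * int K + 1) * x + y = 0" using d dvd_imp_le_int[of "(16 * int K + 1) * x + y" p] p0 by linarith
          have "x = 0"
          proof (rule ccontr)
            assume "x \<noteq> 0"
            hence a: "(16 * int K + 1) * 1 \<le> (16 * int K + 1) * \<bar>x\<bar>" by (intro mult_left_mono) auto
            have "y = - ((16 * int K + 1) * x)" using 0 by linarith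
            hence "\<bar>y\<bar> = (16 * int K + 1) * \<bar>x\<bar>" by (simp add: abs_mult)
            hence "16 * int K + 1 \<le> \<bar>y\<bar>" using a by (simp only: mult_1_right)
            thus False using xy(2) by linarith
          qed
          thus "x = 0 \<and> y = 0" using 0 by simp
        qed
      qed
    qed
  qed
qed

section \<open>Translation to the residue ring\<close>

lemma residue_ring_add_pow:
  assumes "p > 0" "x \<ge> 0"
  shows "[x] \<cdot>\<^bsub>residue_ring p\<^esub> a = (x * a) mod p"
proof -
  have "[n] \<cdot>\<^bsub>residue_ring p\<^esub> a = (int n * a) mod p" for n :: nat
    by (induction n) (simp_all add: add_pow_def nat_pow_def residue_ring_def mod_simps algebra_simps)
  from this[of "nat x"] show ?thesis using assms by (simp add: add_pow_int_ge)
qed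

theorem theorem1p2:
  "\<exists>C::real. C > 0 \<and>
     (\<forall>(p::nat) (A::int set). prime p \<longrightarrow> is_gap2 (residue_ring (int p)) A \<longrightarrow>
        real (mult_energy (residue_ring (int p)) A)
          \<le> C * (real (card A) ^ 2 + real (card A) ^ 4 / real p) * ln (real p))"
proof (intro exI[of _ "10 ^ 30"] conjI allI impI)
  fix p :: nat and A :: "int set"
  assume p: "prime p" and "is_gap2 (residue_ring (int p)) A"
  then obtain H1 H2 a0 a1 a2 where g: "H1 > 0" "H2 > 0"
    "a1 \<in> carrier (residue_ring (int p))" "a2 \<in> carrier (residue_ring (int p))"
    "a1 \<noteq> \<zero>\<^bsub>residue_ring (int p)\<^esub>" "a2 \<noteq> \<zero>\<^bsub>residue_ring (int p)\<^esub>"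
    "A = {a0 \<oplus>\<^bsub>residue_ring (int p)\<^esub> [x1] \<cdot>\<^bsub>residue_ring (int p)\<^esub> a1 \<oplus>\<^bsub>residue_ring (int p)\<^esub> [x2] \<cdot>\<^bsub>residue_ring (int p)\<^esub> a2
       | (x1::int) (x2::int). 1 \<le> x1 \<and> x1 \<le> H1 \<and> 1 \<le> x2 \<and> x2 \<le> H2}"
    unfolding is_gap2_def by blast
  have p0: "int p > 0" using p prime_gt_0_nat by simp
  have e: "a0 \<oplus>\<^bsub>residue_ring (int p)\<^esub> [x1] \<cdot>\<^bsub>residue_ring (int p)\<^esub> a1 \<oplus>\<^bsub>residue_ring (int p)\<^esub> [x2] \<cdot>\<^bsub>residue_ring (int p)\<^esub> a2
      = (a0 + x1 * a1 + x2 * a2) mod int p" if "1 \<le> x1" "1 \<le> x2" for x1 x2 :: int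
    using that p0 by (simp add: residue_ring_add_pow) (simp add: residue_ring_def mod_simps)
  have A: "A = (\<lambda>(x, y). (a0 + x * a1 + y * a2) mod int p) ` ({1..int (nat H1)} \<times> {1..int (nat H2)})"
  proof (intro equalityI subsetI)
    fix t assume "t \<in> A"
    then obtain x1 x2 where x: "1 \<le> x1" "x1 \<le> H1" "1 \<le> x2" "x2 \<le> H2"
      "t = a0 \<oplus>\<^bsub>residue_ring (int p)\<^esub> [x1] \<cdot>\<^bsub>residue_ring (int p)\<^esub> a1 \<oplus>\<^bsub>residue_ring (int p)\<^esub> [x2] \<cdot>\<^bsub>residue_ring (int p)\<^esub> a2"
      unfolding g(7) by blast
    show "t \<in> (\<lambda>(x, y). (a0 + x * a1 + y * a2) mod int p) ` ({1..int (nat H1)} \<times> {1..int (nat H2)})"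
      using x e[OF x(1,3)] g(1,2) by (intro image_eqI[of _ _ "(x1, x2)"]) auto
  next
    fix t assume "t \<in> (\<lambda>(x, y). (a0 + x * a1 + y * a2) mod int p) ` ({1..int (nat H1)} \<times> {1..int (nat H2)})"
    then obtain x1 x2 where x: "1 \<le> x1" "x1 \<le> H1" "1 \<le> x2" "x2 \<le> H2" "t = (a0 + x1 * a1 + x2 * a2) mod int p"
      using g(1,2) by auto
    show "t \<in> A" unfolding g(7) x(5) e[OF x(1,3), symmetric] using x(1-4) by blast
  qed
  have "\<not> int p dvd a1" "\<not> int p dvd a2"
    using g(3-6) zdvd_not_zless[of a1 "int p"] zdvd_not_zless[of a2 "int p"]
    by (auto simp: residue_ring_def)
  hence "real (mult_energy (residue_ring (int p)) A)
      \<le> 10 ^ 30 * (real (card A) ^ 2 + real (card A) ^ 4 / real_of_int (int p)) * ln (real_of_int (int p))"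
    by (intro mult_energy_image_le[OF _ _ _ _ _ A]) (use p g in auto)
  thus "real (mult_energy (residue_ring (int p)) A)
      \<le> 10 ^ 30 * (real (card A) ^ 2 + real (card A) ^ 4 / real p) * ln (real p)" by simp
qed simp

end
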